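(* Let $N>1$, $p\ge 2$, $s\in(0,1)$, $N>ps$, and let $\Omega\subset\mathbb{R}^N$ be a bounded domain with $C^{1,1}$ boundary. Let $f:\Omega\times\mathbb{R}\to\mathbb{R}$ be a Carathéodory function such that, for some $c_0>0$ and $q\in(p,p_s^* )$, $|f(x,t)|\le c_0(1+|t|^{q-1})$ for a.e. $x\in\Omega$ and all $t\in\mathbb{R}$. Let $(\underline{u},\overline{u})\in\widetilde{W}^{s,p}(\Omega)\times\widetilde{W}^{s,p}(\Omega)$ be a sub-supersolution pair of the problem $$(-\Delta)_p^s u=f(x,u)\ \text{ in }\Omega,\qquad u=0\ \text{ in }\Omega^c.$$ Then there exists $u\in\mathcal{S}(\underline{u},\overline{u})$; that is, the problem has a solution $u\in W^{s,p}_0(\Omega)$ with $\underline{u}\le u\le\overline{u}$ in $\Omega$.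
   Context: Notation: $\Omega^c=\mathbb{R}^N\setminus\Omega$, $p_s^*=Np/(N-ps)$, $d\mu=|x-y|^{-N-ps}\,dx\,dy$. Inequalities between measurable functions hold almost everywhere. Functions on $\Omega$ are identified with their $0$-extension to $\mathbb{R}^N$. Spaces: $[u]_{s,p}^p=\iint_{\mathbb{R}^N\times\mathbb{R}^N}|u(x)-u(y)|^p\,d\mu$; $W^{s,p}(\mathbb{R}^N)=\{u\in L^p(\mathbb{R}^N):[u]_{s,p}<\infty\}$; $W^{s,p}_0(\Omega)=\{u\in W^{s,p}(\mathbb{R}^N):u=0\text{ in }\Omega^c\}$, normed by $\|u\|_{s,p}=[u]_{s,p}$, with dual $W^{-s,p'}(\Omega)$; $W^{s,p}_0(\Omega)_+$ is the set of its a.e. non-negative elements. For $U\subseteq\mathbb{R}^N$ open, $W^{s,p}(U)$ is the usual fractional Sobolev space ($u\in L^p(U)$ with $\iint_{U\times U}|u(x)-u(y)|^p\,d\mu<\infty$). $\widetilde{W}^{s,p}(\Omega)$ is the space of all $u\in L^p_{\rm loc}(\mathbb{R}^N)$ such that $u\in W^{s,p}(U)$ for some open $U\subseteq\mathbb{R}^N$ with $\overline\Omega\subset U$, and $\int_{\mathbb{R}^N}\frac{|u(x)|^{p-1}}{(1+|x|)^{N+ps}}\,dx<\infty$. Operator: for $u\in\widetilde{W}^{s,p}(\Omega)$, $(-\Delta)_p^su\in W^{-s,p'}(\Omega)$ is defined by $$\langle(-\Delta)_p^su,v\rangle=\iint_{\mathbb{R}^N\times\mathbb{R}^N}|u(x)-u(y)|^{p-2}(u(x)-u(y))(v(x)-v(y))\,d\mu,\quad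 v\in W^{s,p}_0(\Omega).$$ Definitions: $u\in\widetilde{W}^{s,p}(\Omega)$ is a supersolution if $u\ge0$ in $\Omega^c$ and $\langle(-\Delta)_p^su,v\rangle\ge\int_\Omega f(x,u)v\,dx$ for all $v\in W^{s,p}_0(\Omega)_+$; it is a subsolution if $u\le0$ in $\Omega^c$ and $\langle(-\Delta)_p^su,v\rangle\le\int_\Omega f(x,u)v\,dx$ for all $v\in W^{s,p}_0(\Omega)_+$. $u\in W^{s,p}_0(\Omega)$ is a solution if $\langle(-\Delta)_p^su,v\rangle=\int_\Omega f(x,u)v\,dx$ for all $v\in W^{s,p}_0(\Omega)$. $(\underline{u},\overline{u})$ is a sub-supersolution pair if $\underline{u}$ is a subsolution, $\overline{u}$ is a supersolution, and $\underline{u}\le\overline{u}$ in $\Omega$. For such a pair, $\mathcal{S}(\underline{u},\overline{u})=\{u\in W^{s,p}_0(\Omega):u\text{ is a solution},\ \underline{u}\le u\le\overline{u}\}$. *)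

theory Defs
  imports "HOL-Analysis.Analysis"
begin

text \<open>
  Functions are total maps on \<open>real ^ 'n\<close>, standing for their Lebesgue a.e. classes; every
  pointwise relation between them is imposed almost everywhere.
\<close>


subsection \<open>Domains of class $C^{1,1}$\<close>

text \<open>
  Near each boundary point, $\Omega$ is the strict epigraph of a $C^{1,1}$ function in a rotated
  coordinate system. The unit vector \<open>e\<close> is the rotated last axis, and \<open>y - (y \<bullet> e) *\<^sub>R e\<close> are the
  remaining coordinates, i.e. the projection of \<open>y\<close> to the hyperplane orthogonal to \<open>e\<close>. The graph
  function \<open>\<gamma>\<close> is only ever evaluated on this hyperplane; asking it to be $C^{1,1}$ on the whole
  space is no restriction, since a function on the hyperplane extends constantly along \<open>e\<close>.
\<close>

definition C11_function :: "(real ^ 'n \<Rightarrow> real) \<Rightarrow> bool" where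
  "C11_function \<gamma> \<longleftrightarrow>
     (\<exists>grad. (\<forall>x. (\<gamma> has_derivative (\<lambda>h. grad x \<bullet> h)) (at x)) \<and> (\<exists>L. L-lipschitz_on UNIV grad))"

definition C11_boundary :: "(real ^ 'n) set \<Rightarrow> bool" where
  "C11_boundary \<Omega> \<longleftrightarrow>
     (\<forall>x0 \<in> frontier \<Omega>. \<exists>r>0. \<exists>e \<gamma>. norm e = 1 \<and> C11_function \<gamma> \<and>
        \<Omega> \<inter> ball x0 r = {y \<in> ball x0 r. \<gamma> (y - (y \<bullet> e) *\<^sub>R e) < y \<bullet> e})"

definition bounded_C11_domain :: "(real ^ 'n) set \<Rightarrow> bool" where
  "bounded_C11_domain \<Omega> \<longleftrightarrow>
     open \<Omega> \<and> connected \<Omega> \<and> \<Omega> \<noteq> {} \<and> bounded \<Omega> \<and> C11_boundary \<Omega>"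


subsection \<open>Fractional Sobolev spaces\<close>

text \<open>
  The measure $d\mu = |x-y|^{-N-ps}\,dx\,dy$. Since \<open>0 powr a = 0\<close>, the density vanishes on the
  diagonal, which is a null set.
\<close>

definition gagliardo_measure :: "real \<Rightarrow> real \<Rightarrow> ((real ^ 'n) \<times> (real ^ 'n)) measure" where
  "gagliardo_measure s p =
     density (lebesgue \<Otimes>\<^sub>M lebesgue)
       (\<lambda>(x, y). ennreal (norm (x - y) powr (- real CARD('n) - p * s)))"

text \<open>The $p$-th power of the seminorm on \<open>U\<close>; for \<open>U = UNIV\<close> this is $[u]_{s,p}^p$.\<close>

definition gagliardo_pow :: "real \<Rightarrow> real \<Rightarrow> (real ^ 'n) set \<Rightarrow> (real ^ 'n \<Rightarrow> real) \<Rightarrow> ennreal" where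
  "gagliardo_pow s p U u =
     (\<integral>\<^sup>+ z \<in> U \<times> U. ennreal (\<bar>u (fst z) - u (snd z)\<bar> powr p) \<partial>gagliardo_measure s p)"

definition frac_sobolev :: "real \<Rightarrow> real \<Rightarrow> (real ^ 'n) set \<Rightarrow> (real ^ 'n \<Rightarrow> real) set" where
  "frac_sobolev s p U =
     {u. u \<in> borel_measurable (lebesgue_on U) \<and>
         integrable (lebesgue_on U) (\<lambda>x. \<bar>u x\<bar> powr p) \<and>
         gagliardo_pow s p U u < \<infinity>}"

definition frac_sobolev_0 :: "real \<Rightarrow> real \<Rightarrow> (real ^ 'n) set \<Rightarrow> (real ^ 'n \<Rightarrow> real) set" where
  "frac_sobolev_0 s p \<Omega> = {u \<in> frac_sobolev s p UNIV. AE x in lebesgue. x \<notin> \<Omega> \<longrightarrow> u x = 0}"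

definition frac_sobolev_0_nonneg :: "real \<Rightarrow> real \<Rightarrow> (real ^ 'n) set \<Rightarrow> (real ^ 'n \<Rightarrow> real) set" where
  "frac_sobolev_0_nonneg s p \<Omega> = {v \<in> frac_sobolev_0 s p \<Omega>. AE x in lebesgue. 0 \<le> v x}"

definition Lp_loc :: "real \<Rightarrow> (real ^ 'n \<Rightarrow> real) set" where
  "Lp_loc p = {u \<in> borel_measurable lebesgue.
     \<forall>K. compact K \<longrightarrow> set_integrable lebesgue K (\<lambda>x. \<bar>u x\<bar> powr p)}"

definition frac_sobolev_tilde :: "real \<Rightarrow> real \<Rightarrow> (real ^ 'n) set \<Rightarrow> (real ^ 'n \<Rightarrow> real) set" where
  "frac_sobolev_tilde s p \<Omega> =
     {u \<in> Lp_loc p.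
        (\<exists>U. open U \<and> closure \<Omega> \<subseteq> U \<and> u \<in> frac_sobolev s p U) \<and>
        integrable lebesgue
          (\<lambda>x. \<bar>u x\<bar> powr (p - 1) / (1 + norm x) powr (real CARD('n) + p * s))}"

definition sobolev_exponent :: "'n itself \<Rightarrow> real \<Rightarrow> real \<Rightarrow> real" where
  "sobolev_exponent _ s p = real CARD('n) * p / (real CARD('n) - p * s)"


subsection \<open>The fractional $p$-Laplacian and its Dirichlet problem\<close>

text \<open>
  \<open>frac_p_laplacian s p u v\<close> is the duality pairing $\langle(-\Delta)_p^s u, v\rangle$. For \<open>u\<close> in
  \<open>frac_sobolev_tilde s p \<Omega>\<close>, \<open>v\<close> in \<open>frac_sobolev_0 s p \<Omega>\<close> and bounded \<open>\<Omega>\<close> the integrand is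
  integrable, so the default value of the Bochner integral plays no role.
\<close>

definition frac_p_laplacian ::
  "real \<Rightarrow> real \<Rightarrow> (real ^ 'n \<Rightarrow> real) \<Rightarrow> (real ^ 'n \<Rightarrow> real) \<Rightarrow> real" where
  "frac_p_laplacian s p u v =
     (\<integral>z. \<bar>u (fst z) - u (snd z)\<bar> powr (p - 2) * (u (fst z) - u (snd z))
            * (v (fst z) - v (snd z)) \<partial>gagliardo_measure s p)"

definition caratheodory :: "(real ^ 'n) set \<Rightarrow> (real ^ 'n \<Rightarrow> real \<Rightarrow> real) \<Rightarrow> bool" where
  "caratheodory \<Omega> f \<longleftrightarrow>
     (\<forall>t. (\<lambda>x. f x t) \<in> borel_measurable (lebesgue_on \<Omega>)) \<and>
     (AE x in lebesgue. x \<in> \<Omega> \<longrightarrow> continuous_on UNIV (f x))"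

definition supersolution ::
  "real \<Rightarrow> real \<Rightarrow> (real ^ 'n) set \<Rightarrow> (real ^ 'n \<Rightarrow> real \<Rightarrow> real) \<Rightarrow> (real ^ 'n \<Rightarrow> real) \<Rightarrow> bool" where
  "supersolution s p \<Omega> f u \<longleftrightarrow>
     u \<in> frac_sobolev_tilde s p \<Omega> \<and>
     (AE x in lebesgue. x \<notin> \<Omega> \<longrightarrow> 0 \<le> u x) \<and>
     (\<forall>v \<in> frac_sobolev_0_nonneg s p \<Omega>.
        frac_p_laplacian s p u v \<ge> (LINT x:\<Omega>|lebesgue. f x (u x) * v x))"

definition subsolution ::
  "real \<Rightarrow> real \<Rightarrow> (real ^ 'n) set \<Rightarrow> (real ^ 'n \<Rightarrow> real \<Rightarrow> real) \<Rightarrow> (real ^ 'n \<Rightarrow> real) \<Rightarrow> bool" where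
  "subsolution s p \<Omega> f u \<longleftrightarrow>
     u \<in> frac_sobolev_tilde s p \<Omega> \<and>
     (AE x in lebesgue. x \<notin> \<Omega> \<longrightarrow> u x \<le> 0) \<and>
     (\<forall>v \<in> frac_sobolev_0_nonneg s p \<Omega>.
        frac_p_laplacian s p u v \<le> (LINT x:\<Omega>|lebesgue. f x (u x) * v x))"

definition solution ::
  "real \<Rightarrow> real \<Rightarrow> (real ^ 'n) set \<Rightarrow> (real ^ 'n \<Rightarrow> real \<Rightarrow> real) \<Rightarrow> (real ^ 'n \<Rightarrow> real) \<Rightarrow> bool" where
  "solution s p \<Omega> f u \<longleftrightarrow>
     u \<in> frac_sobolev_0 s p \<Omega> \<and>
     (\<forall>v \<in> frac_sobolev_0 s p \<Omega>.
        frac_p_laplacian s p u v = (LINT x:\<Omega>|lebesgue. f x (u x) * v x))"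

definition sub_supersolution_pair ::
  "real \<Rightarrow> real \<Rightarrow> (real ^ 'n) set \<Rightarrow> (real ^ 'n \<Rightarrow> real \<Rightarrow> real) \<Rightarrow>
   (real ^ 'n \<Rightarrow> real) \<Rightarrow> (real ^ 'n \<Rightarrow> real) \<Rightarrow> bool" where
  "sub_supersolution_pair s p \<Omega> f lo up \<longleftrightarrow>
     subsolution s p \<Omega> f lo \<and> supersolution s p \<Omega> f up \<and>
     (AE x in lebesgue. x \<in> \<Omega> \<longrightarrow> lo x \<le> up x)"

text \<open>
  The order bounds are required on the whole space; outside \<open>\<Omega>\<close> they hold automatically for a
  sub-supersolution pair, because there \<open>lo \<le> 0 = u \<le> up\<close>.
\<close>

definition solution_set ::
  "real \<Rightarrow> real \<Rightarrow> (real ^ 'n) set \<Rightarrow> (real ^ 'n \<Rightarrow> real \<Rightarrow> real) \<Rightarrow>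
   (real ^ 'n \<Rightarrow> real) \<Rightarrow> (real ^ 'n \<Rightarrow> real) \<Rightarrow> (real ^ 'n \<Rightarrow> real) set" where
  "solution_set s p \<Omega> f lo up =
     {u. solution s p \<Omega> f u \<and> (AE x in lebesgue. lo x \<le> u x \<and> u x \<le> up x)}"

end

theory Submission
  imports Defs "HOL-Complex_Analysis.Great_Picard"
begin

text \<open>
  The solution is found by minimization. Replace \<open>f x t\<close> by its value at the point of the interval
  \<open>[lo x, up x]\<close> closest to \<open>t\<close>, where \<open>lo\<close> and \<open>up\<close> are the sub- and the supersolution. This truncated
  nonlinearity is dominated by \<open>h powr (q - 1)\<close> for a fixed \<open>h\<close> in \<open>L\<^sup>q\<close>, so the functional
  \<open>[u]\<^sup>p / p - \<integral> G(x, u)\<close>, with \<open>G\<close> its primitive in \<open>t\<close>, is coercive on \<open>W\<^sub>0\<^sup>s\<^sup>,\<^sup>p\<close>. A minimizer exists and solves the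
  truncated equation (\<open>exists_weak_solution_dominated\<close>). Testing that equation with the positive parts of
  \<open>u - up\<close> and \<open>lo - u\<close>, where the truncation turns the right-hand side into that of the super- or
  subsolution, the strict monotonicity of the operator forces
  \<open>lo \<le> u \<le> up\<close> (\<open>fractional_comparison\<close>). There the truncation is inactive, so \<open>u\<close> solves the given problem
  (\<open>exists_solution_between\<close>).

  Two facts about fractional Sobolev functions carry the argument: the subcritical embedding into \<open>L\<^sup>q\<close>
  (\<open>fractional_embedding\<close>), which makes \<open>h powr q\<close> and all right-hand sides integrable, and the extraction of
  subsequences that converge almost everywhere (\<open>fractional_rellich\<close>). Both follow from averaging over dyadic
  cubes. On a cube of side length \<open>2 powr (- k)\<close> the Gagliardo kernel is bounded below by a multiple of
  \<open>2 powr (k * (N + p * s))\<close>, so the energy of the cube controls the mean \<open>p\<close>-th power oscillation of a function on it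
  with a gain that is geometric in \<open>k\<close>. Hence the averages approximate the function in \<open>L\<^sup>p\<close>, and
  their telescoping series converges in \<open>L\<^sup>q\<close> for subcritical \<open>q\<close>, while for fixed \<open>k\<close> the averages of
  a bounded sequence of functions are bounded functions of countably many cubes and thus have
  pointwise convergent subsequences. Given convergence almost everywhere, the energy is lower
  semicontinuous by Fatou's lemma (\<open>gagliardo_pow_le_liminf\<close>) and the lower-order term is continuous
  (\<open>weighted_integral_tendsto_0\<close>).

  The sub- and supersolution are not supported in \<open>\<Omega>\<close>. Interactions between \<open>\<Omega>\<close> and points at positive distance are
  controlled by the integrable tail of the kernel. This gives the positive parts above finite energy
  (\<open>frac_sobolev_0_of_local\<close>) and makes their pairings with the sub- and supersolution integrable
  (\<open>integrable_pairing_frac_sobolev_tilde\<close>).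
\<close>

section \<open>Elementary inequalities for powers\<close>

lemma powr_add_le:
  fixes a b p :: real
  assumes "a \<ge> 0" "b \<ge> 0" "p \<ge> 0"
  shows "(a + b) powr p \<le> 2 powr p * (a powr p + b powr p)"
proof -
  have "(a + b) powr p \<le> (2 * max a b) powr p"
    using assms by (intro powr_mono2) auto
  also have "\<dots> = 2 powr p * (max a b) powr p"
    using assms by (simp add: powr_mult)
  also have "(max a b) powr p \<le> a powr p + b powr p"
    by (auto simp: max_def)
  finally show ?thesis by simp
qed

lemma abs_diff_powr_le:
  fixes a b p :: real
  assumes "p \<ge> 0"
  shows "\<bar>a - b\<bar> powr p \<le> 2 powr p * (\<bar>a\<bar> powr p + \<bar>b\<bar> powr p)"
proof -
  have "\<bar>a - b\<bar> powr p \<le> (\<bar>a\<bar> + \<bar>b\<bar>) powr p" using assms by (intro powr_mono2) auto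
  also have "\<dots> \<le> 2 powr p * (\<bar>a\<bar> powr p + \<bar>b\<bar> powr p)" using assms by (intro powr_add_le) auto
  finally show ?thesis .
qed

lemma powr_mult_le_sum:
  fixes a b p :: real
  assumes "a \<ge> 0" "b \<ge> 0" "p \<ge> 1"
  shows "a powr (p - 1) * b \<le> a powr p + b powr p"
proof (cases "a \<ge> b")
  case True
  have "a powr (p - 1) * b \<le> a powr (p - 1) * a" using True assms by (intro mult_left_mono) auto
  also have "\<dots> = a powr p" using assms by (cases "a = 0") (auto simp: powr_mult_base mult.commute)
  finally show ?thesis by (smt (verit) powr_ge_zero)
next
  case False
  have "a powr (p - 1) * b \<le> b powr (p - 1) * b" using False assms by (intro mult_right_mono powr_mono2) auto
  also have "\<dots> = b powr p" using assms by (cases "b = 0") (auto simp: powr_mult_base mult.commute)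
  finally show ?thesis by (smt (verit) powr_ge_zero)
qed

text \<open>
  The substitute for the inequalities of Jensen and Hoelder: integrate it, then choose the level \<open>\<delta>\<close>
  in terms of the integral of \<open>t powr p\<close>.
\<close>

lemma le_level_plus_powr:
  fixes t \<delta> p :: real
  assumes "t \<ge> 0" "\<delta> > 0" "p \<ge> 1"
  shows "t \<le> \<delta> + \<delta> powr (1 - p) * t powr p"
proof (cases "t \<le> \<delta>")
  case True
  then show ?thesis using assms by (smt (verit) mult_nonneg_nonneg powr_ge_zero)
next
  case False
  have "t = t powr (1 - p) * t powr p" using False assms by (simp flip: powr_add)
  also have "\<dots> \<le> \<delta> powr (1 - p) * t powr p"
    using False assms by (intro mult_right_mono powr_mono2') auto
  finally show ?thesis using assms by simp
qed

definition signed_powr :: "real \<Rightarrow> real \<Rightarrow> real" where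
  "signed_powr p t = \<bar>t\<bar> powr (p - 2) * t"

lemma signed_powr_alt: "signed_powr p t = sgn t * \<bar>t\<bar> powr (p - 1)"
proof (cases "t = 0")
  case False
  have "\<bar>t\<bar> powr (p - 1) = \<bar>t\<bar> powr (p - 2) * \<bar>t\<bar>"
    using False powr_add[of "\<bar>t\<bar>" "p - 2" 1] by simp
  then show ?thesis by (simp add: signed_powr_def sgn_if abs_if)
qed (simp add: signed_powr_def)

lemma abs_signed_powr: "\<bar>signed_powr p t\<bar> = \<bar>t\<bar> powr (p - 1)"
  by (cases "t = 0") (auto simp: signed_powr_alt abs_mult abs_sgn_eq)

lemma signed_powr_less:
  assumes "p > 1" "a < b"
  shows "signed_powr p a < signed_powr p b"
proof -
  consider "0 \<le> a" | "a < 0" "0 \<le> b" | "b < 0" using assms by linarith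
  then show ?thesis
  proof cases
    case 1
    then show ?thesis using assms by (auto simp: signed_powr_alt sgn_if intro!: powr_less_mono2)
  next
    case 2
    have "signed_powr p a < 0" using 2 by (simp add: signed_powr_alt)
    also have "0 \<le> signed_powr p b" using 2 by (simp add: signed_powr_alt)
    finally show ?thesis .
  next
    case 3
    then show ?thesis using assms by (auto simp: signed_powr_alt sgn_if intro!: powr_less_mono2)
  qed
qed

lemma continuous_on_signed_powr:
  assumes "p \<ge> 2" shows "continuous_on UNIV (signed_powr p)"
proof (cases "p = 2")
  case True
  have "signed_powr p = (\<lambda>t. t)"
    using True by (auto simp: signed_powr_alt fun_eq_iff sgn_if)
  then show ?thesis by simp
next
  case False
  then have "continuous_on UNIV (\<lambda>t. \<bar>t\<bar> powr (p - 2) * t)"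
    using assms by (intro continuous_on_mult continuous_on_powr' continuous_intros) auto
  then show ?thesis by (simp add: signed_powr_def[abs_def])
qed

text \<open>Young's inequality, read as the tangent line inequality of the convex function
  \<open>\<lambda>t. \<bar>t\<bar> powr p\<close> with derivative \<open>\<lambda>t. p * signed_powr p t\<close>.\<close>

lemma powr_tangent:
  fixes x y p :: real
  assumes "p > 1"
  shows "\<bar>x\<bar> powr p + p * signed_powr p x * (y - x) \<le> \<bar>y\<bar> powr p"
proof -
  define r where "r = p / (p - 1)"
  have r: "r > 1" "1 / p + 1 / r = 1" using assms by (auto simp: r_def field_simps)
  have "\<bar>y\<bar> * \<bar>x\<bar> powr (p - 1) \<le> \<bar>y\<bar> powr p / p + (\<bar>x\<bar> powr (p - 1)) powr r / r"
    using assms r by (intro Youngs_inequality) auto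
  also have "(\<bar>x\<bar> powr (p - 1)) powr r = \<bar>x\<bar> powr p" using assms by (simp add: powr_powr r_def)
  finally have "p * (\<bar>y\<bar> * \<bar>x\<bar> powr (p - 1)) \<le> p * (\<bar>y\<bar> powr p / p + \<bar>x\<bar> powr p / r)"
    using assms by (intro mult_left_mono) auto
  also have "\<dots> = \<bar>y\<bar> powr p + (p - 1) * \<bar>x\<bar> powr p"
    using assms by (simp add: r_def field_simps)
  finally have 1: "p * (\<bar>y\<bar> * \<bar>x\<bar> powr (p - 1)) \<le> \<bar>y\<bar> powr p + (p - 1) * \<bar>x\<bar> powr p" .
  have "signed_powr p x * y \<le> \<bar>signed_powr p x * y\<bar>" by simp
  also have "\<dots> = \<bar>y\<bar> * \<bar>x\<bar> powr (p - 1)" by (simp add: abs_mult abs_signed_powr)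
  finally have 2: "p * (signed_powr p x * y) \<le> p * (\<bar>y\<bar> * \<bar>x\<bar> powr (p - 1))" using assms by simp
  have 3: "signed_powr p x * x = \<bar>x\<bar> powr p"
  proof (cases "x = 0")
    case False
    have "signed_powr p x * x = \<bar>x\<bar> powr (p - 1) * \<bar>x\<bar>"
      by (simp add: signed_powr_alt sgn_if)
    also have "\<dots> = \<bar>x\<bar> powr p" using False powr_add[of "\<bar>x\<bar>" "p - 1" 1] by simp
    finally show ?thesis .
  qed simp
  have "p * signed_powr p x * (y - x) = p * (signed_powr p x * y) - p * (signed_powr p x * x)"
    by (simp add: algebra_simps)
  also have "\<dots> \<le> \<bar>y\<bar> powr p + (p - 1) * \<bar>x\<bar> powr p - p * \<bar>x\<bar> powr p"
    using 1 2 3 by simp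
  finally show ?thesis by (simp add: algebra_simps)
qed

lemma abs_signed_powr_mult_le:
  fixes a b p :: real
  assumes "p \<ge> 1"
  shows "\<bar>signed_powr p a * b\<bar> \<le> \<bar>a\<bar> powr p + \<bar>b\<bar> powr p"
  using powr_mult_le_sum[of "\<bar>a\<bar>" "\<bar>b\<bar>" p] assms by (simp add: abs_mult abs_signed_powr)

section \<open>The product of Lebesgue measure with itself\<close>

lemma sigma_finite_lebesgue: "sigma_finite_measure (lebesgue :: 'a::euclidean_space measure)"
proof
  obtain A :: "'a set set" where A: "countable A" "A \<subseteq> sets lborel" "\<Union>A = space lborel" "\<forall>a\<in>A. emeasure lborel a \<noteq> \<infinity>"
    using lborel.sigma_finite_countable by blast
  then show "\<exists>A::'a set set. countable A \<and> A \<subseteq> sets lebesgue \<and> \<Union>A = space lebesgue \<and> (\<forall>a\<in>A. emeasure lebesgue a \<noteq> \<infinity>)"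
    by (intro exI[of _ A]) auto
qed

interpretation lebesgue: sigma_finite_measure "lebesgue :: 'a::euclidean_space measure"
  by (rule sigma_finite_lebesgue)

interpretation lebesgue_pair: pair_sigma_finite
  "lebesgue :: 'a::euclidean_space measure" "lebesgue :: 'b::euclidean_space measure" ..

lemma measurable_lebesgue_ident [measurable]: "(\<lambda>x. x) \<in> lebesgue \<rightarrow>\<^sub>M (borel :: 'a::euclidean_space measure)"
  by (rule measurable_completion) simp

lemma measurable_pair_fst_borel [measurable]:
  "fst \<in> (lebesgue :: 'a::euclidean_space measure) \<Otimes>\<^sub>M (M :: 'b measure) \<rightarrow>\<^sub>M borel"
  by (rule measurable_compose[OF measurable_fst measurable_lebesgue_ident])

lemma measurable_pair_snd_borel [measurable]:
  "snd \<in> (M :: 'b measure) \<Otimes>\<^sub>M (lebesgue :: 'a::euclidean_space measure) \<rightarrow>\<^sub>M borel"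
  by (rule measurable_compose[OF measurable_snd measurable_lebesgue_ident])

lemma AE_lebesgue_fst:
  assumes "AE x in (lebesgue :: 'a::euclidean_space measure). P x"
  shows "AE z in lebesgue \<Otimes>\<^sub>M (lebesgue :: 'b::euclidean_space measure). P (fst z)"
proof -
  obtain A where A: "A \<in> null_sets lebesgue" "{x. \<not> P x} \<subseteq> A"
    using assms by (auto simp: eventually_ae_filter)
  have "AE z in lebesgue \<Otimes>\<^sub>M (lebesgue :: 'b measure). fst z \<notin> A"
  proof (rule lebesgue_pair.AE_pair_measure)
    have "{z \<in> space (lebesgue \<Otimes>\<^sub>M (lebesgue :: 'b measure)). fst z \<notin> A} = (- A) \<times> UNIV"
      by (auto simp: space_pair_measure)
    then show "{z \<in> space (lebesgue \<Otimes>\<^sub>M (lebesgue :: 'b measure)). fst z \<notin> A} \<in> sets (lebesgue \<Otimes>\<^sub>M (lebesgue :: 'b measure))"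
      using A by (auto intro!: pair_measureI simp: Compl_in_sets_lebesgue)
    have "AE x in lebesgue. x \<notin> A" using A(1) by (rule AE_not_in)
    then show "AE x in lebesgue. AE y in (lebesgue :: 'b measure). fst (x, y) \<notin> A" by eventually_elim simp
  qed
  then show ?thesis by (rule AE_mp) (use A in auto)
qed

lemma AE_lebesgue_snd:
  assumes "AE x in (lebesgue :: 'a::euclidean_space measure). P x"
  shows "AE z in (lebesgue :: 'b::euclidean_space measure) \<Otimes>\<^sub>M lebesgue. P (snd z)"
proof -
  obtain A where A: "A \<in> null_sets lebesgue" "{x. \<not> P x} \<subseteq> A"
    using assms by (auto simp: eventually_ae_filter)
  have "AE z in (lebesgue :: 'b measure) \<Otimes>\<^sub>M lebesgue. snd z \<notin> A"
  proof (rule lebesgue_pair.AE_pair_measure)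
    have "{z \<in> space ((lebesgue :: 'b measure) \<Otimes>\<^sub>M lebesgue). snd z \<notin> A} = UNIV \<times> (- A)"
      by (auto simp: space_pair_measure)
    then show "{z \<in> space ((lebesgue :: 'b measure) \<Otimes>\<^sub>M lebesgue). snd z \<notin> A} \<in> sets ((lebesgue :: 'b measure) \<Otimes>\<^sub>M lebesgue)"
      using A by (auto intro!: pair_measureI simp: Compl_in_sets_lebesgue)
    have "AE x in lebesgue. x \<notin> A" using A(1) by (rule AE_not_in)
    then show "AE x in (lebesgue :: 'b measure). AE y in lebesgue. snd (x, y) \<notin> A" by simp
  qed
  then show ?thesis by (rule AE_mp) (use A in auto)
qed

section \<open>The Gagliardo kernel and energies\<close>

definition gagliardo_kernel :: "real \<Rightarrow> real \<Rightarrow> real ^ 'n \<Rightarrow> real ^ 'n \<Rightarrow> real" where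
  "gagliardo_kernel s p x y = norm (x - y) powr (- real CARD('n) - p * s)"

lemma gagliardo_kernel_nonneg [simp]: "gagliardo_kernel s p x y \<ge> 0"
  by (simp add: gagliardo_kernel_def)

lemma gagliardo_kernel_commute: "gagliardo_kernel s p x y = gagliardo_kernel s p y x"
  by (simp add: gagliardo_kernel_def norm_minus_commute)

lemma measurable_gagliardo_kernel [measurable]:
  "(\<lambda>z. gagliardo_kernel s p (fst z) (snd z)) \<in> borel_measurable (lebesgue \<Otimes>\<^sub>M lebesgue)"
  unfolding gagliardo_kernel_def by measurable

lemma measurable_gagliardo_kernel_section [measurable]:
  "(\<lambda>y. gagliardo_kernel s p x y) \<in> borel_measurable lebesgue"
  unfolding gagliardo_kernel_def by measurable

lemma gagliardo_measure_eq:
  "gagliardo_measure s p =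
     density (lebesgue \<Otimes>\<^sub>M lebesgue) (\<lambda>z. ennreal (gagliardo_kernel s p (fst z) (snd z)))"
  by (simp add: gagliardo_measure_def gagliardo_kernel_def case_prod_beta')

lemma sets_gagliardo_measure [simp]:
  "sets (gagliardo_measure s p) = sets (lebesgue \<Otimes>\<^sub>M lebesgue)"
  by (simp add: gagliardo_measure_eq)

lemma measurable_gagliardo_measure [simp]:
  "f \<in> borel_measurable (gagliardo_measure s p) \<longleftrightarrow> f \<in> borel_measurable (lebesgue \<Otimes>\<^sub>M lebesgue)"
  by (simp add: measurable_cong_sets[OF sets_gagliardo_measure refl])

lemma AE_gagliardo_measureI:
  assumes "AE z in lebesgue \<Otimes>\<^sub>M lebesgue. P z"
  shows "AE z in gagliardo_measure s p. P z"
proof -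
  have "AE z in lebesgue \<Otimes>\<^sub>M lebesgue. 0 < ennreal (gagliardo_kernel s p (fst z) (snd z)) \<longrightarrow> P z"
    using assms by eventually_elim simp
  then show ?thesis unfolding gagliardo_measure_eq by (subst AE_density) simp_all
qed

lemma nn_integral_gagliardo_measure:
  assumes "f \<in> borel_measurable (lebesgue \<Otimes>\<^sub>M lebesgue)"
  shows "(\<integral>\<^sup>+z. f z \<partial>gagliardo_measure s p) =
    (\<integral>\<^sup>+z. ennreal (gagliardo_kernel s p (fst z) (snd z)) * f z \<partial>(lebesgue \<Otimes>\<^sub>M lebesgue))"
  unfolding gagliardo_measure_eq by (rule nn_integral_density) (use assms in auto)

lemma gagliardo_pow_eq_pair:
  fixes U :: "(real ^ 'n) set"
  assumes [measurable]: "u \<in> borel_measurable lebesgue" "U \<in> sets lebesgue"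
  shows "gagliardo_pow s p U u =
    (\<integral>\<^sup>+z. ennreal (gagliardo_kernel s p (fst z) (snd z)) * (ennreal (\<bar>u (fst z) - u (snd z)\<bar> powr p) * indicator (U \<times> U) z) \<partial>(lebesgue \<Otimes>\<^sub>M lebesgue))"
  unfolding gagliardo_pow_def by (rule nn_integral_gagliardo_measure) simp

lemma gagliardo_pow_eq:
  fixes U :: "(real ^ 'n) set"
  assumes [measurable]: "u \<in> borel_measurable lebesgue" "U \<in> sets lebesgue"
  shows "gagliardo_pow s p U u =
    (\<integral>\<^sup>+x. \<integral>\<^sup>+y. ennreal (gagliardo_kernel s p x y) * (ennreal (\<bar>u x - u y\<bar> powr p) * indicator (U \<times> U) (x, y)) \<partial>lebesgue \<partial>lebesgue)"
  unfolding gagliardo_pow_eq_pair[OF assms] by (subst lebesgue.nn_integral_fst[symmetric]) simp_all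

lemma gagliardo_pow_mono:
  "U \<subseteq> V \<Longrightarrow> gagliardo_pow s p U u \<le> gagliardo_pow s p V u"
  unfolding gagliardo_pow_def by (intro nn_integral_mono) (auto simp: indicator_def)

lemma gagliardo_pow_UNIV:
  "gagliardo_pow s p UNIV u = (\<integral>\<^sup>+ z. ennreal (\<bar>u (fst z) - u (snd z)\<bar> powr p) \<partial>gagliardo_measure s p)"
  by (simp add: gagliardo_pow_def)

abbreviation Lp_pow :: "real \<Rightarrow> ('a::euclidean_space \<Rightarrow> real) \<Rightarrow> ennreal" where
  "Lp_pow p u \<equiv> \<integral>\<^sup>+x. ennreal (\<bar>u x\<bar> powr p) \<partial>lebesgue"

abbreviation Lp_pow_on :: "real \<Rightarrow> 'a set \<Rightarrow> ('a::euclidean_space \<Rightarrow> real) \<Rightarrow> ennreal" where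
  "Lp_pow_on p U u \<equiv> \<integral>\<^sup>+x. ennreal (\<bar>u x\<bar> powr p) * indicator U x \<partial>lebesgue"

lemma nn_integral_powr_le_add:
  assumes [measurable]: "u \<in> borel_measurable M" "v \<in> borel_measurable M" "U \<in> sets M" and p: "p \<ge> 0"
    and le: "\<And>x. \<bar>w x\<bar> \<le> \<bar>u x\<bar> + \<bar>v x\<bar>"
  shows "(\<integral>\<^sup>+x. ennreal (\<bar>w x\<bar> powr p) * indicator U x \<partial>M) \<le> ennreal (2 powr p) *
    ((\<integral>\<^sup>+x. ennreal (\<bar>u x\<bar> powr p) * indicator U x \<partial>M) + (\<integral>\<^sup>+x. ennreal (\<bar>v x\<bar> powr p) * indicator U x \<partial>M))"
proof -
  have "(\<integral>\<^sup>+x. ennreal (\<bar>w x\<bar> powr p) * indicator U x \<partial>M) \<le>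
    (\<integral>\<^sup>+x. ennreal (2 powr p) * (ennreal (\<bar>u x\<bar> powr p) * indicator U x + ennreal (\<bar>v x\<bar> powr p) * indicator U x) \<partial>M)"
  proof (rule nn_integral_mono)
    fix x
    have "\<bar>w x\<bar> powr p \<le> (\<bar>u x\<bar> + \<bar>v x\<bar>) powr p" using le p by (intro powr_mono2) auto
    also have "\<dots> \<le> 2 powr p * (\<bar>u x\<bar> powr p + \<bar>v x\<bar> powr p)" using p by (intro powr_add_le) auto
    finally have "ennreal (\<bar>w x\<bar> powr p) \<le> ennreal (2 powr p) * (ennreal (\<bar>u x\<bar> powr p) + ennreal (\<bar>v x\<bar> powr p))"
      by (simp flip: ennreal_plus ennreal_mult')
    then show "ennreal (\<bar>w x\<bar> powr p) * indicator U x
      \<le> ennreal (2 powr p) * (ennreal (\<bar>u x\<bar> powr p) * indicator U x + ennreal (\<bar>v x\<bar> powr p) * indicator U x)"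
      by (auto simp: indicator_def)
  qed
  also have "\<dots> = ennreal (2 powr p) *
    ((\<integral>\<^sup>+x. ennreal (\<bar>u x\<bar> powr p) * indicator U x \<partial>M) + (\<integral>\<^sup>+x. ennreal (\<bar>v x\<bar> powr p) * indicator U x \<partial>M))"
    by (subst nn_integral_cmult, measurable, subst nn_integral_add, measurable)
  finally show ?thesis .
qed

lemma gagliardo_pow_le_add:
  fixes U :: "(real ^ 'n) set"
  assumes [measurable]: "u \<in> borel_measurable lebesgue" "v \<in> borel_measurable lebesgue" "U \<in> sets lebesgue"
    and p: "p \<ge> 0"
    and le: "\<And>x y. \<bar>w x - w y\<bar> \<le> \<bar>u x - u y\<bar> + \<bar>v x - v y\<bar>"
  shows "gagliardo_pow s p U w \<le> ennreal (2 powr p) * (gagliardo_pow s p U u + gagliardo_pow s p U v)"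
  unfolding gagliardo_pow_def by (rule nn_integral_powr_le_add) (use p le in simp_all)

lemma gagliardo_pow_scale:
  assumes [measurable]: "u \<in> borel_measurable lebesgue"
  shows "gagliardo_pow s p UNIV (\<lambda>x. c * u x) = ennreal (\<bar>c\<bar> powr p) * gagliardo_pow s p UNIV u"
proof -
  have "\<bar>c * u x - c * u y\<bar> powr p = \<bar>c\<bar> powr p * \<bar>u x - u y\<bar> powr p" for x y
    by (simp add: powr_mult abs_mult flip: right_diff_distrib)
  then show ?thesis
    unfolding gagliardo_pow_UNIV by (simp add: ennreal_mult nn_integral_cmult)
qed

lemma nn_integral_pair_times:
  fixes f :: "'a::euclidean_space \<Rightarrow> ennreal" and g :: "'b::euclidean_space \<Rightarrow> ennreal"
  assumes [measurable]: "f \<in> borel_measurable lebesgue" "g \<in> borel_measurable lebesgue"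
  shows "(\<integral>\<^sup>+z. f (fst z) * g (snd z) \<partial>(lebesgue \<Otimes>\<^sub>M lebesgue)) = (\<integral>\<^sup>+x. f x \<partial>lebesgue) * (\<integral>\<^sup>+y. g y \<partial>lebesgue)"
  by (subst lebesgue.nn_integral_fst[symmetric]) (simp_all add: nn_integral_cmult nn_integral_multc)

lemma le_suminf_ennreal: "(F :: nat \<Rightarrow> ennreal) k \<le> suminf F"
  using sum_le_suminf[of F "{k}"] by simp

section \<open>The spaces \<open>W\<^sup>s\<^sup>,\<^sup>p\<close> and \<open>W\<^sub>0\<^sup>s\<^sup>,\<^sup>p\<close>\<close>

lemma frac_sobolev_iff:
  fixes U :: "(real ^ 'n) set"
  assumes [measurable]: "u \<in> borel_measurable lebesgue" "U \<in> sets lebesgue"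
  shows "u \<in> frac_sobolev s p U \<longleftrightarrow>
    Lp_pow_on p U u < \<infinity> \<and> gagliardo_pow s p U u < \<infinity>"
proof -
  have "u \<in> borel_measurable (lebesgue_on U)" by (simp add: measurable_restrict_space1)
  then show ?thesis
    by (auto simp: frac_sobolev_def integrable_iff_bounded nn_integral_restrict_space)
qed

lemma frac_sobolev_0_iff:
  "u \<in> frac_sobolev_0 s p \<Omega> \<longleftrightarrow> u \<in> borel_measurable lebesgue \<and>
    Lp_pow p u < \<infinity> \<and> gagliardo_pow s p UNIV u < \<infinity> \<and>
    (AE x in lebesgue. x \<notin> \<Omega> \<longrightarrow> u x = 0)"
proof (cases "u \<in> borel_measurable lebesgue")
  case True
  then show ?thesis using frac_sobolev_iff[of u UNIV s p] by (auto simp: frac_sobolev_0_def)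
next
  case False
  then show ?thesis by (auto simp: frac_sobolev_0_def frac_sobolev_def)
qed

lemma measurable_frac_sobolev_0 [measurable_dest]:
  "u \<in> frac_sobolev_0 s p \<Omega> \<Longrightarrow> u \<in> borel_measurable lebesgue"
  by (simp add: frac_sobolev_0_iff)

lemma measurable_frac_sobolev_tilde [measurable_dest]:
  "u \<in> frac_sobolev_tilde s p \<Omega> \<Longrightarrow> u \<in> borel_measurable lebesgue"
  by (simp add: frac_sobolev_tilde_def Lp_loc_def)

lemma frac_sobolev_le_add:
  fixes U :: "(real ^ 'n) set"
  assumes [measurable]: "u \<in> borel_measurable lebesgue" "v \<in> borel_measurable lebesgue"
      "w \<in> borel_measurable lebesgue" "U \<in> sets lebesgue"
    and p: "p \<ge> 0" and uv: "u \<in> frac_sobolev s p U" "v \<in> frac_sobolev s p U"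
    and le: "\<And>x. \<bar>w x\<bar> \<le> \<bar>u x\<bar> + \<bar>v x\<bar>"
    and le': "\<And>x y. \<bar>w x - w y\<bar> \<le> \<bar>u x - u y\<bar> + \<bar>v x - v y\<bar>"
  shows "w \<in> frac_sobolev s p U"
proof -
  note 1 = nn_integral_powr_le_add[of u lebesgue v U p w, OF _ _ _ p le]
  note 2 = gagliardo_pow_le_add[of u v U p w s, OF _ _ _ p le']
  have "Lp_pow_on p U w < \<infinity>"
    using uv by (intro le_less_trans[OF 1]) (simp_all add: frac_sobolev_iff ennreal_mult_less_top)
  moreover have "gagliardo_pow s p U w < \<infinity>"
    using uv by (intro le_less_trans[OF 2]) (simp_all add: frac_sobolev_iff ennreal_mult_less_top)
  ultimately show ?thesis by (simp add: frac_sobolev_iff)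
qed

lemma frac_sobolev_0_le_add:
  assumes "p \<ge> 0" "u \<in> frac_sobolev_0 s p \<Omega>" "v \<in> frac_sobolev_0 s p \<Omega>" "w \<in> borel_measurable lebesgue"
    and "\<And>x. \<bar>w x\<bar> \<le> \<bar>u x\<bar> + \<bar>v x\<bar>"
    and "\<And>x y. \<bar>w x - w y\<bar> \<le> \<bar>u x - u y\<bar> + \<bar>v x - v y\<bar>"
  shows "w \<in> frac_sobolev_0 s p \<Omega>"
proof -
  have "w \<in> frac_sobolev s p UNIV"
    by (rule frac_sobolev_le_add[OF _ _ assms(4) _ assms(1) _ _ assms(5) assms(6)])
      (use assms(2,3) in \<open>auto simp: frac_sobolev_0_def frac_sobolev_def\<close>)
  moreover have "AE x in lebesgue. x \<notin> \<Omega> \<longrightarrow> u x = 0" "AE x in lebesgue. x \<notin> \<Omega> \<longrightarrow> v x = 0"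
    using assms by (auto simp: frac_sobolev_0_def)
  then have "AE x in lebesgue. x \<notin> \<Omega> \<longrightarrow> w x = 0"
  proof eventually_elim
    case (elim x) then show ?case using assms(5)[of x] by auto
  qed
  ultimately show ?thesis by (simp add: frac_sobolev_0_def)
qed

lemma frac_sobolev_0_scale:
  assumes "u \<in> frac_sobolev_0 s p \<Omega>"
  shows "(\<lambda>x. c * u x) \<in> frac_sobolev_0 s p \<Omega>"
proof -
  have [measurable]: "u \<in> borel_measurable lebesgue" using assms by measurable
  have "Lp_pow p (\<lambda>x. c * u x) = ennreal (\<bar>c\<bar> powr p) * Lp_pow p u"
    by (subst nn_integral_cmult[symmetric]) (auto simp: abs_mult powr_mult ennreal_mult)
  then show ?thesis
    using assms by (auto simp: frac_sobolev_0_iff gagliardo_pow_scale ennreal_mult_less_top)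
qed

lemma frac_sobolev_0_add_scale:
  assumes "p \<ge> 0" "u \<in> frac_sobolev_0 s p \<Omega>" "v \<in> frac_sobolev_0 s p \<Omega>"
  shows "(\<lambda>x. u x + c * v x) \<in> frac_sobolev_0 s p \<Omega>"
proof -
  have [measurable]: "u \<in> borel_measurable lebesgue" "v \<in> borel_measurable lebesgue" using assms by measurable
  note cv = frac_sobolev_0_scale[OF assms(3), of c]
  show ?thesis
    by (rule frac_sobolev_0_le_add[OF assms(1,2) cv]) auto
qed

lemma zero_frac_sobolev_0: "(\<lambda>x. 0) \<in> frac_sobolev_0 s p \<Omega>"
  by (simp add: frac_sobolev_0_iff gagliardo_pow_UNIV)

text \<open>All functions in the space vanish on a common ball near \<open>\<Omega>\<close>, and the part of the energy that
  couples \<open>\<Omega>\<close> with this ball already controls the \<open>L\<^sup>p\<close> norm.\<close>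

lemma fractional_poincare:
  fixes \<Omega> :: "(real ^ 'n) set"
  assumes "bounded \<Omega>" "p \<ge> 0" "s \<ge> 0"
  obtains C where "C > 0"
    "\<And>u. u \<in> frac_sobolev_0 s p \<Omega> \<Longrightarrow> Lp_pow p u \<le> ennreal C * gagliardo_pow s p UNIV u"
proof -
  obtain R where R: "R > 0" "\<Omega> \<subseteq> ball 0 R"
    using assms(1) bounded_subset_ballD by blast
  obtain a :: "real ^ 'n" where a: "norm a = 3 * R"
    using vector_choose_size[of "3 * R"] R by auto
  define B where "B = ball a R"
  have [measurable]: "B \<in> sets lebesgue" by (simp add: B_def)
  \<comment> \<open>A lower bound of the kernel, because \<open>norm (x - y) < R + 3 * R + R\<close> for \<open>x \<in> \<Omega>\<close> and \<open>y \<in> B\<close>.\<close>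
  define \<kappa> where "\<kappa> = (5 * R) powr (- real CARD('n) - p * s)"
  have \<kappa>: "\<kappa> > 0" using R by (simp add: \<kappa>_def)
  define m where "m = measure lebesgue B"
  have m: "m > 0" using R by (simp add: m_def B_def content_ball_pos)
  have emB: "emeasure lebesgue B = ennreal m"
    unfolding m_def B_def by (rule emeasure_eq_ennreal_measure) (use emeasure_lborel_ball_finite[of a R] in \<open>auto simp del: emeasure_lborel_ball_finite\<close>)
  have ker: "\<kappa> \<le> gagliardo_kernel s p x y" if "x \<in> \<Omega>" "y \<in> B" for x y
  proof -
    have x: "norm x < R" using that R by auto
    have y: "norm (a - y) < R" using that by (simp add: B_def dist_norm)
    have "norm a \<le> norm (a - y) + norm (y - x) + norm x" by norm
    with a x y have "norm (y - x) > 0" using R by linarith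
    moreover have "norm (x - y) \<le> norm x + norm a + norm (a - y)" by norm
    ultimately have "0 < norm (x - y)" "norm (x - y) \<le> 5 * R" using a x y by (auto simp: norm_minus_commute)
    then show ?thesis unfolding \<kappa>_def gagliardo_kernel_def
      using mult_nonneg_nonneg[OF assms(2,3)] by (intro powr_mono2') auto
  qed
  have notin: "y \<notin> \<Omega>" if "y \<in> B" for y
  proof
    assume "y \<in> \<Omega>"
    then have "norm y < R" "norm (a - y) < R" using that R by (auto simp: B_def dist_norm)
    moreover have "norm a \<le> norm (a - y) + norm y" by norm
    ultimately show False using a R by linarith
  qed
  show thesis
  proof
    show "1 / (\<kappa> * m) > 0" using \<kappa> m by simp
    fix u :: "real ^ 'n \<Rightarrow> real" assume u: "u \<in> frac_sobolev_0 s p \<Omega>"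
    then have [measurable]: "u \<in> borel_measurable lebesgue" by measurable
    let ?g = "\<lambda>x y. ennreal (gagliardo_kernel s p x y) * (ennreal (\<bar>u x - u y\<bar> powr p) * indicator (UNIV \<times> UNIV) (x, y))"
    have ae: "AE x in lebesgue. x \<notin> \<Omega> \<longrightarrow> u x = 0" using u by (simp add: frac_sobolev_0_def)
    have "(\<integral>\<^sup>+x. ennreal (\<kappa> * m) * ennreal (\<bar>u x\<bar> powr p) \<partial>lebesgue) \<le>
      (\<integral>\<^sup>+x. \<integral>\<^sup>+y. ?g x y \<partial>lebesgue \<partial>lebesgue)"
    proof (rule nn_integral_mono_AE)
      show "AE x in lebesgue. ennreal (\<kappa> * m) * ennreal (\<bar>u x\<bar> powr p) \<le>
        (\<integral>\<^sup>+y. ?g x y \<partial>lebesgue)"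
        using ae
      proof eventually_elim
        case (elim x)
        show ?case
        proof (cases "x \<in> \<Omega>")
          case True
          have "ennreal (\<kappa> * m) * ennreal (\<bar>u x\<bar> powr p) = ennreal (\<kappa> * \<bar>u x\<bar> powr p) * emeasure lebesgue B"
            using \<kappa> m by (simp add: emB mult_ac flip: ennreal_mult)
          also have "\<dots> = (\<integral>\<^sup>+y. ennreal (\<kappa> * \<bar>u x\<bar> powr p) * indicator B y \<partial>lebesgue)"
            by (simp add: nn_integral_cmult_indicator)
          also have "\<dots> \<le> (\<integral>\<^sup>+y. ?g x y \<partial>lebesgue)"
          proof (rule nn_integral_mono_AE)
            show "AE y in lebesgue. ennreal (\<kappa> * \<bar>u x\<bar> powr p) * indicator B y \<le>
              ?g x y"
              using ae
            proof eventually_elim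
              case (elim y)
              show ?case
              proof (cases "y \<in> B")
                case True
                then have "u y = 0" using elim notin by auto
                then show ?thesis using ker[OF \<open>x \<in> \<Omega>\<close> True] True
                  by (auto simp: indicator_def simp flip: ennreal_mult intro!: mult_right_mono)
              qed simp
            qed
          qed
          finally show ?thesis .
        qed (use elim in simp)
      qed
    qed
    also have "\<dots> = gagliardo_pow s p UNIV u" by (rule gagliardo_pow_eq[symmetric]) auto
    finally have *: "ennreal (\<kappa> * m) * Lp_pow p u \<le> gagliardo_pow s p UNIV u"
      by (simp add: nn_integral_cmult)
    have "Lp_pow p u = ennreal (1 / (\<kappa> * m)) * (ennreal (\<kappa> * m) * Lp_pow p u)"
      using \<kappa> m by (simp add: mult.assoc[symmetric] flip: ennreal_mult)
    also have "\<dots> \<le> ennreal (1 / (\<kappa> * m)) * gagliardo_pow s p UNIV u"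
      using * by (rule mult_left_mono) simp
    finally show "Lp_pow p u \<le> ennreal (1 / (\<kappa> * m)) * gagliardo_pow s p UNIV u" .
  qed
qed

section \<open>Long-range interactions\<close>

text \<open>The integrand is dominated by a series of multiples \<open>2 powr (- (a * k))\<close> of indicators of the dyadic
  balls \<open>ball 0 (2 ^ (k + 1))\<close>. Their volumes grow with exponent \<open>CARD('n) < a\<close>, so the integrals form
  a convergent geometric series.\<close>

lemma nn_integral_tail_finite:
  assumes a: "a > real CARD('n)"
  shows "(\<integral>\<^sup>+y. ennreal ((1 + norm (y :: real ^ 'n)) powr (- a)) \<partial>lebesgue) < \<infinity>"
proof -
  define V where "V = unit_ball_vol (real CARD('n))"
  have V: "V \<ge> 0" by (simp add: V_def)
  let ?b = "\<lambda>k::nat. (2::real) powr (- (a * k))"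
  have bound: "ennreal ((1 + norm (y :: real ^ 'n)) powr (- a)) \<le> (\<Sum>k. ennreal (?b k) * indicator (ball 0 (2 ^ (k + 1))) y)" for y
  proof -
    define k where "k = nat \<lfloor>log 2 (1 + norm y)\<rfloor>"
    have l0: "0 \<le> log 2 (1 + norm y)" by (subst zero_le_log_cancel_iff) (auto simp: add_pos_nonneg)
    have k1: "real k \<le> log 2 (1 + norm y)" and k2: "log 2 (1 + norm y) < real k + 1"
      unfolding k_def using l0 by linarith+
    have "2 powr real k \<le> 1 + norm y"
      using k1 by (simp add: le_log_iff add_pos_nonneg)
    then have "(1 + norm y) powr (- a) \<le> (2 powr real k) powr (- a)"
      using a by (intro powr_mono2') auto
    also have "\<dots> = ?b k" by (simp add: powr_powr mult.commute)
    finally have 1: "(1 + norm y) powr (- a) \<le> ?b k" .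
    have "1 + norm y < 2 powr (real k + 1)"
      using k2 by (simp add: log_less_iff add_pos_nonneg)
    then have "y \<in> ball 0 (2 ^ (k + 1))" by (simp add: powr_add powr_realpow mult.commute)
    then have "ennreal ((1 + norm y) powr (- a)) \<le> ennreal (?b k) * indicator (ball 0 (2 ^ (k + 1))) y"
      using 1 by simp
    also have "\<dots> \<le> (\<Sum>k. ennreal (?b k) * indicator (ball 0 (2 ^ (k + 1))) y)"
      by (rule le_suminf_ennreal[of "\<lambda>k. ennreal (?b k) * indicator (ball 0 (2 ^ (k + 1))) y"])
    finally show ?thesis .
  qed
  have geo: "?b k * (V * (2 ^ (k + 1)) ^ CARD('n)) = V * 2 ^ CARD('n) * (2 powr (real CARD('n) - a)) ^ k" for k
  proof -
    have "(2 ^ (k + 1)) ^ CARD('n) = (2::real) ^ CARD('n) * (2 powr real k) ^ CARD('n)"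
      by (simp add: power_mult_distrib powr_realpow)
    also have "(2 powr real k) ^ CARD('n) = (2::real) powr (real CARD('n) * real k)"
      by (simp add: powr_power mult.commute)
    finally have "(2 ^ (k + 1)) ^ CARD('n) = (2::real) ^ CARD('n) * 2 powr (real CARD('n) * real k)" .
    moreover have "(2 powr (real CARD('n) - a)) ^ k = 2 powr (real CARD('n) * real k) * ?b k"
      by (simp add: powr_power flip: powr_add) (simp add: algebra_simps)
    ultimately show ?thesis by simp
  qed
  define B :: "nat \<Rightarrow> (real ^ 'n) set" where "B k = ball 0 (2 ^ (k + 1))" for k
  have B [measurable]: "B k \<in> sets lebesgue" for k by (simp add: B_def)
  have "(\<integral>\<^sup>+y. ennreal ((1 + norm (y :: real ^ 'n)) powr (- a)) \<partial>lebesgue) \<le>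
     (\<integral>\<^sup>+y. (\<Sum>k. ennreal (?b k) * indicator (B k) y) \<partial>lebesgue)"
    unfolding B_def by (intro nn_integral_mono bound)
  also have "\<dots> = (\<Sum>k. \<integral>\<^sup>+y. ennreal (?b k) * indicator (B k) y \<partial>lebesgue)"
  proof (rule nn_integral_suminf)
    show "(\<lambda>y. ennreal (?b k) * indicator (B k) y) \<in> borel_measurable lebesgue" for k
      by measurable
  qed
  also have "\<dots> = (\<Sum>k. ennreal (?b k) * emeasure lebesgue (B k))"
    by (intro suminf_cong nn_integral_cmult_indicator B)
  also have "\<dots> = (\<Sum>k. ennreal (V * 2 ^ CARD('n) * (2 powr (real CARD('n) - a)) ^ k))"
  proof (rule suminf_cong)
    fix k :: nat
    have "emeasure lebesgue (B k) = ennreal (V * (2 ^ (k + 1)) ^ CARD('n))"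
      using emeasure_ball[of "2 ^ (k + 1)" "0 :: real ^ 'n"] by (simp add: V_def B_def del: power_Suc)
    then show "ennreal (?b k) * emeasure lebesgue (B k) =
        ennreal (V * 2 ^ CARD('n) * (2 powr (real CARD('n) - a)) ^ k)"
      unfolding geo[of k, symmetric] by (simp only: ennreal_mult'[OF powr_ge_zero])
  qed
  also have "\<dots> < \<infinity>"
  proof -
    have "(2::real) powr (real CARD('n) - a) < 2 powr 0" using a by (intro powr_less_mono) auto
    then have "summable (\<lambda>k. V * 2 ^ CARD('n) * (2 powr (real CARD('n) - a)) ^ k)"
      by (intro summable_mult summable_geometric) simp
    then show ?thesis using V by (subst suminf_ennreal_eq[OF _ summable_sums]) (auto intro!: mult_nonneg_nonneg)
  qed
  finally show ?thesis .
qed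

text \<open>If \<open>d\<close> is the distance between \<open>closure \<Omega>\<close> and the complement of \<open>U\<close>, and \<open>\<Omega> \<subseteq> ball 0 R\<close>, then
  \<open>1 + norm y \<le> ((1 + R) / d + 1) * norm (x - y)\<close>.\<close>

lemma gagliardo_kernel_far:
  fixes \<Omega> U :: "(real ^ 'n) set"
  assumes "bounded \<Omega>" "open U" "closure \<Omega> \<subseteq> U" and ps: "p * s \<ge> 0"
  obtains C where "C > 0"
    "\<And>x y. x \<in> \<Omega> \<Longrightarrow> y \<notin> U \<Longrightarrow> gagliardo_kernel s p x y \<le> C * (1 + norm y) powr (- (real CARD('n) + p * s))"
proof -
  obtain R where R: "R > 0" "\<Omega> \<subseteq> ball 0 R"
    using assms(1) bounded_subset_ballD by blast
  have "compact (closure \<Omega>)" "closed (- U)" "closure \<Omega> \<inter> - U = {}"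
    using assms by (auto simp: compact_closure)
  then obtain d where d: "d > 0" "\<And>x y. x \<in> closure \<Omega> \<Longrightarrow> y \<in> - U \<Longrightarrow> d \<le> dist x y"
    using separate_compact_closed[of "closure \<Omega>" "- U"] by auto
  define c where "c = (1 + R) / d + 1"
  have c: "c > 0" using R d by (simp add: c_def add_pos_pos)
  show thesis
  proof
    show "c powr (real CARD('n) + p * s) > 0" using c by simp
    fix x y assume x: "x \<in> \<Omega>" and y: "y \<notin> U"
    have dxy: "d \<le> norm (x - y)" using d(2)[of x y] x y closure_subset by (auto simp: dist_norm)
    have "norm y \<le> norm x + norm (x - y)" by norm
    moreover have "norm x < R" using x R by auto
    moreover have "(1 + R) / d * d \<le> (1 + R) / d * norm (x - y)"
      using dxy d(1) R(1) by (intro mult_left_mono) auto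
    then have "1 + R \<le> (1 + R) / d * norm (x - y)" using d(1) by simp
    ultimately have "1 + norm y \<le> c * norm (x - y)" by (simp add: c_def algebra_simps)
    then have "(c * norm (x - y)) powr (- (real CARD('n) + p * s)) \<le> (1 + norm y) powr (- (real CARD('n) + p * s))"
      using ps by (intro powr_mono2') (auto simp: add_pos_nonneg)
    then have "c powr (real CARD('n) + p * s) * (c * norm (x - y)) powr (- (real CARD('n) + p * s))
      \<le> c powr (real CARD('n) + p * s) * (1 + norm y) powr (- (real CARD('n) + p * s))"
      by (intro mult_left_mono) auto
    moreover have "c powr (real CARD('n) + p * s) * (c * norm (x - y)) powr (- (real CARD('n) + p * s)) = gagliardo_kernel s p x y"
      using c by (simp add: powr_mult gagliardo_kernel_def mult.assoc[symmetric] flip: powr_add)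
    ultimately show "gagliardo_kernel s p x y \<le> c powr (real CARD('n) + p * s) * (1 + norm y) powr (- (real CARD('n) + p * s))"
      by simp
  qed
qed

text \<open>A function that vanishes outside \<open>\<Omega>\<close> only has to be tested near \<open>closure \<Omega>\<close>: points at
  positive distance interact through the integrable tail of the kernel.\<close>

lemma frac_sobolev_0_of_local:
  fixes \<Omega> U :: "(real ^ 'n) set"
  assumes \<Omega>: "open \<Omega>" "bounded \<Omega>" and U: "open U" "closure \<Omega> \<subseteq> U" and p: "p > 0" "s > 0"
    and w [measurable]: "w \<in> borel_measurable lebesgue"
    and ae: "AE x in lebesgue. x \<notin> \<Omega> \<longrightarrow> w x = 0" and wU: "w \<in> frac_sobolev s p U"
  shows "w \<in> frac_sobolev_0 s p \<Omega>"
proof -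
  have ps: "p * s > 0" using p by simp
  have [measurable]: "\<Omega> \<in> sets lebesgue" "U \<in> sets lebesgue" using \<Omega> U by auto
  obtain C where C: "C > 0"
    "\<And>x y. x \<in> \<Omega> \<Longrightarrow> y \<notin> U \<Longrightarrow> gagliardo_kernel s p x y \<le> C * (1 + norm y) powr (- (real CARD('n) + p * s))"
    using gagliardo_kernel_far[OF \<Omega>(2) U, of p s] ps by auto
  define \<kappa> where "\<kappa> y = ennreal ((1 + norm y) powr (- (real CARD('n) + p * s)))" for y :: "real ^ 'n"
  define A where "A x = ennreal C * (ennreal (\<bar>w x\<bar> powr p) * indicator U x)" for x
  have [measurable]: "\<kappa> \<in> borel_measurable lebesgue" unfolding \<kappa>_def by measurable
  have [measurable]: "A \<in> borel_measurable lebesgue" unfolding A_def by measurable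
  have Ufin: "Lp_pow_on p U w < \<infinity>" and Efin: "gagliardo_pow s p U w < \<infinity>"
    using wU by (simp_all add: frac_sobolev_iff)
  have \<kappa>fin: "(\<integral>\<^sup>+y. \<kappa> y \<partial>lebesgue) < \<infinity>"
    unfolding \<kappa>_def by (rule nn_integral_tail_finite) (use ps in simp)
  have Afin: "(\<integral>\<^sup>+y. A y \<partial>lebesgue) < \<infinity>"
    unfolding A_def using Ufin by (simp add: nn_integral_cmult ennreal_mult_less_top)
  have UA: "\<Omega> \<subseteq> U" using U closure_subset by blast
  have far: "ennreal (gagliardo_kernel s p x y) * ennreal (\<bar>w x\<bar> powr p) \<le> A x * \<kappa> y" if "x \<in> \<Omega>" "y \<notin> U" for x y
  proof -
    have "gagliardo_kernel s p x y * \<bar>w x\<bar> powr p \<le> C * (1 + norm y) powr (- (real CARD('n) + p * s)) * \<bar>w x\<bar> powr p"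
      by (intro mult_right_mono C(2) that) auto
    then show ?thesis using that UA C(1)
      by (auto simp: A_def \<kappa>_def indicator_def mult_ac simp flip: ennreal_mult intro!: ennreal_leI)
  qed
  have "Lp_pow p w = Lp_pow_on p U w"
    by (rule nn_integral_cong_AE, use ae in eventually_elim) (use UA in \<open>auto simp: indicator_def\<close>)
  moreover have "gagliardo_pow s p UNIV w < \<infinity>"
  proof -
    let ?k = "\<lambda>z. ennreal (gagliardo_kernel s p (fst z) (snd z))"
    let ?e = "\<lambda>U z. ?k z * (ennreal (\<bar>w (fst z) - w (snd z)\<bar> powr p) * indicator (U \<times> U) z)"
    have "gagliardo_pow s p UNIV w = (\<integral>\<^sup>+z. ?e UNIV z \<partial>(lebesgue \<Otimes>\<^sub>M lebesgue))"
      by (rule gagliardo_pow_eq_pair) auto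
    also have "\<dots> \<le> (\<integral>\<^sup>+z. ?e U z + (A (fst z) * \<kappa> (snd z) + \<kappa> (fst z) * A (snd z)) \<partial>(lebesgue \<Otimes>\<^sub>M lebesgue))"
    proof (rule nn_integral_mono_AE)
      show "AE z in lebesgue \<Otimes>\<^sub>M lebesgue. ?e UNIV z \<le> ?e U z + (A (fst z) * \<kappa> (snd z) + \<kappa> (fst z) * A (snd z))"
        using AE_lebesgue_fst[OF ae] AE_lebesgue_snd[OF ae]
      proof eventually_elim
        case (elim z)
        obtain x y where z: "z = (x, y)" by (cases z)
        consider "x \<in> U" "y \<in> U" | "x \<in> \<Omega>" "y \<notin> U" | "x \<notin> U" "y \<in> \<Omega>" | "x \<notin> \<Omega>" "y \<notin> \<Omega>"
          using UA by blast
        then show ?case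
        proof cases
          case 1
          then show ?thesis by (simp add: z)
        next
          case 2
          then have "w y = 0" using elim UA by (auto simp: z)
          then have "?e UNIV z \<le> A x * \<kappa> y" using far[of x y] 2 by (simp add: z)
          then show ?thesis by (simp add: z add_increasing add_increasing2)
        next
          case 3
          then have "w x = 0" using elim UA by (auto simp: z)
          then have "?e UNIV z \<le> A y * \<kappa> x" using far[of y x] 3 by (simp add: z gagliardo_kernel_commute[of s p x y])
          then show ?thesis by (simp add: z add_increasing add_increasing2 mult.commute)
        next
          case 4
          then show ?thesis using elim by (simp add: z)
        qed
      qed
    qed
    also have "\<dots> = gagliardo_pow s p U w + ((\<integral>\<^sup>+z. A (fst z) * \<kappa> (snd z) \<partial>(lebesgue \<Otimes>\<^sub>M lebesgue))
        + (\<integral>\<^sup>+z. \<kappa> (fst z) * A (snd z) \<partial>(lebesgue \<Otimes>\<^sub>M lebesgue)))"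
      by (simp add: nn_integral_add gagliardo_pow_eq_pair)
    also have "\<dots> < \<infinity>"
      using Efin Afin \<kappa>fin by (simp add: nn_integral_pair_times ennreal_mult_less_top)
    finally show ?thesis .
  qed
  ultimately show ?thesis using Ufin ae w by (simp add: frac_sobolev_0_iff)
qed

section \<open>The pairing with the fractional \<open>p\<close>-Laplacian\<close>

lemma frac_p_laplacian_eq:
  "frac_p_laplacian s p u v =
     (\<integral>z. signed_powr p (u (fst z) - u (snd z)) * (v (fst z) - v (snd z)) \<partial>gagliardo_measure s p)"
  by (simp add: frac_p_laplacian_def signed_powr_def)

abbreviation pairing_integrand ::
  "real \<Rightarrow> (real ^ 'n \<Rightarrow> real) \<Rightarrow> (real ^ 'n \<Rightarrow> real) \<Rightarrow> (real ^ 'n) \<times> (real ^ 'n) \<Rightarrow> real" where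
  "pairing_integrand p u v \<equiv> \<lambda>z. signed_powr p (u (fst z) - u (snd z)) * (v (fst z) - v (snd z))"

lemma measurable_signed_powr [measurable]: "signed_powr p \<in> borel_measurable borel"
  unfolding signed_powr_def[abs_def] by measurable

lemma integrable_pairing_frac_sobolev_0:
  fixes \<Omega> :: "(real ^ 'n) set"
  assumes "p \<ge> 1" "u \<in> frac_sobolev_0 s p \<Omega>" "v \<in> frac_sobolev_0 s p \<Omega>"
  shows "integrable (gagliardo_measure s p)
    (pairing_integrand p u v)"
proof (rule integrableI_bounded)
  have [measurable]: "u \<in> borel_measurable lebesgue" "v \<in> borel_measurable lebesgue" using assms by measurable
  show "(pairing_integrand p u v) \<in> borel_measurable (gagliardo_measure s p)"
    by simp
  have "(\<integral>\<^sup>+z. ennreal (norm (pairing_integrand p u v z)) \<partial>gagliardo_measure s p)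
    \<le> (\<integral>\<^sup>+z. ennreal (\<bar>u (fst z) - u (snd z)\<bar> powr p) + ennreal (\<bar>v (fst z) - v (snd z)\<bar> powr p) \<partial>gagliardo_measure s p)"
    using abs_signed_powr_mult_le[OF assms(1)] by (intro nn_integral_mono) (simp flip: ennreal_plus)
  also have "\<dots> = gagliardo_pow s p UNIV u + gagliardo_pow s p UNIV v"
    by (simp add: nn_integral_add gagliardo_pow_UNIV)
  also have "\<dots> < \<infinity>" using assms by (simp add: frac_sobolev_0_iff)
  finally show "(\<integral>\<^sup>+z. ennreal (norm (pairing_integrand p u v z)) \<partial>gagliardo_measure s p) < \<infinity>" .
qed

lemma frac_sobolev_tilde_localE:
  fixes \<Omega> :: "(real ^ 'n) set"
  assumes "u \<in> frac_sobolev_tilde s p \<Omega>"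
  obtains U where "open U" "closure \<Omega> \<subseteq> U" "u \<in> frac_sobolev s p U"
  using assms by (auto simp: frac_sobolev_tilde_def)

lemma frac_sobolev_tilde_tail:
  fixes \<Omega> :: "(real ^ 'n) set"
  assumes "u \<in> frac_sobolev_tilde s p \<Omega>"
  shows "(\<integral>\<^sup>+y. ennreal (\<bar>u y\<bar> powr (p - 1) * (1 + norm y) powr (- (real CARD('n) + p * s))) \<partial>lebesgue) < \<infinity>"
proof -
  have "integrable lebesgue (\<lambda>x. \<bar>u x\<bar> powr (p - 1) / (1 + norm x) powr (real CARD('n) + p * s))"
    using assms by (simp add: frac_sobolev_tilde_def)
  then have "integrable lebesgue (\<lambda>y. \<bar>u y\<bar> powr (p - 1) * (1 + norm y) powr (- (real CARD('n) + p * s)))"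
    by (simp only: powr_minus divide_inverse)
  then show ?thesis by (simp add: integrable_iff_bounded)
qed

text \<open>Near \<open>closure \<Omega>\<close> the two energies bound the integrand. Between \<open>\<Omega>\<close> and the complement of \<open>U\<close> it is bounded by
  products of integrable functions of one variable each: \<open>A1\<close> or \<open>A2\<close> near \<open>\<Omega>\<close>, and far away \<open>\<kappa>\<close> or \<open>\<kappa>u\<close>, where \<open>\<kappa>u\<close>
  is integrable by the growth condition in the definition of \<open>frac_sobolev_tilde\<close>.\<close>

lemma integrable_pairing_frac_sobolev_tilde:
  fixes \<Omega> :: "(real ^ 'n) set"
  assumes \<Omega>: "open \<Omega>" "bounded \<Omega>" and p: "p \<ge> 1" "s > 0"
    and u: "u \<in> frac_sobolev_tilde s p \<Omega>" and v: "v \<in> frac_sobolev_0 s p \<Omega>"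
  shows "integrable (gagliardo_measure s p)
    (pairing_integrand p u v)"
proof (rule integrableI_bounded)
  have [measurable]: "u \<in> borel_measurable lebesgue" "v \<in> borel_measurable lebesgue" using u v by measurable
  obtain U where U: "open U" "closure \<Omega> \<subseteq> U" "u \<in> frac_sobolev s p U"
    using frac_sobolev_tilde_localE[OF u] .
  have ps: "p * s > 0" using p by simp
  have [measurable]: "\<Omega> \<in> sets lebesgue" "U \<in> sets lebesgue" using \<Omega> U by auto
  have UA: "\<Omega> \<subseteq> U" using U closure_subset by blast
  have ae: "AE x in lebesgue. x \<notin> \<Omega> \<longrightarrow> v x = 0" using v by (simp add: frac_sobolev_0_def)
  obtain C where C: "C > 0"
    "\<And>x y. x \<in> \<Omega> \<Longrightarrow> y \<notin> U \<Longrightarrow> gagliardo_kernel s p x y \<le> C * (1 + norm y) powr (- (real CARD('n) + p * s))"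
    using gagliardo_kernel_far[OF \<Omega>(2) U(1,2), of p s] ps by auto
  let ?\<kappa> = "\<lambda>y :: real ^ 'n. (1 + norm y) powr (- (real CARD('n) + p * s))"
  let ?D = "C * 2 powr (p - 1)"
  define \<kappa> where "\<kappa> y = ennreal (?\<kappa> y)" for y
  define \<kappa>u where "\<kappa>u y = ennreal (\<bar>u y\<bar> powr (p - 1) * ?\<kappa> y)" for y
  define A1 where "A1 x = ennreal ?D * (ennreal (\<bar>u x\<bar> powr p) * indicator U x + ennreal (\<bar>v x\<bar> powr p))" for x
  define A2 where "A2 x = ennreal ?D * (indicator \<Omega> x + ennreal (\<bar>v x\<bar> powr p))" for x
  have [measurable]: "\<kappa> \<in> borel_measurable lebesgue" "\<kappa>u \<in> borel_measurable lebesgue"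
    "A1 \<in> borel_measurable lebesgue" "A2 \<in> borel_measurable lebesgue"
    unfolding \<kappa>_def \<kappa>u_def A1_def A2_def by measurable
  have fin: "(\<integral>\<^sup>+y. \<kappa> y \<partial>lebesgue) < \<infinity>" "(\<integral>\<^sup>+y. \<kappa>u y \<partial>lebesgue) < \<infinity>"
    unfolding \<kappa>_def \<kappa>u_def using nn_integral_tail_finite[where 'n='n, of "real CARD('n) + p * s"] ps frac_sobolev_tilde_tail[OF u]
    by auto
  have em: "emeasure lebesgue \<Omega> < \<infinity>" using \<Omega> emeasure_bounded_finite by simp
  have finA: "(\<integral>\<^sup>+y. A1 y \<partial>lebesgue) < \<infinity>" "(\<integral>\<^sup>+y. A2 y \<partial>lebesgue) < \<infinity>"
    unfolding A1_def A2_def using U(3) v em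
    by (simp_all add: nn_integral_cmult nn_integral_add frac_sobolev_iff frac_sobolev_0_iff ennreal_mult_less_top)
  define H where "H x y = A1 x * \<kappa> y + A2 x * \<kappa>u y" for x y
  have far: "ennreal (gagliardo_kernel s p x y) * ennreal \<bar>signed_powr p (u x - u y) * v x\<bar> \<le> H x y"
    if "x \<in> \<Omega>" "y \<notin> U" for x y
  proof -
    have "\<bar>signed_powr p (u x - u y) * v x\<bar> = \<bar>u x - u y\<bar> powr (p - 1) * \<bar>v x\<bar>"
      by (simp add: abs_mult abs_signed_powr)
    also have "\<dots> \<le> 2 powr (p - 1) * (\<bar>u x\<bar> powr (p - 1) + \<bar>u y\<bar> powr (p - 1)) * \<bar>v x\<bar>"
      using p by (intro mult_right_mono abs_diff_powr_le) auto
    also have "\<dots> = 2 powr (p - 1) * (\<bar>u x\<bar> powr (p - 1) * \<bar>v x\<bar> + \<bar>u y\<bar> powr (p - 1) * \<bar>v x\<bar>)"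
      by (simp add: algebra_simps)
    also have "\<dots> \<le> 2 powr (p - 1) * ((\<bar>u x\<bar> powr p + \<bar>v x\<bar> powr p) + \<bar>u y\<bar> powr (p - 1) * (1 + \<bar>v x\<bar> powr p))"
      using p le_level_plus_powr[of "\<bar>v x\<bar>" 1 p]
      by (intro mult_left_mono add_mono powr_mult_le_sum) auto
    finally have "gagliardo_kernel s p x y * \<bar>signed_powr p (u x - u y) * v x\<bar> \<le>
      (C * ?\<kappa> y) * (2 powr (p - 1) * ((\<bar>u x\<bar> powr p + \<bar>v x\<bar> powr p) + \<bar>u y\<bar> powr (p - 1) * (1 + \<bar>v x\<bar> powr p)))"
      by (intro mult_mono C(2) that) (auto simp: C(1) less_imp_le)
    also have "\<dots> = (?D * (\<bar>u x\<bar> powr p + \<bar>v x\<bar> powr p)) * ?\<kappa> y + (?D * (1 + \<bar>v x\<bar> powr p)) * (\<bar>u y\<bar> powr (p - 1) * ?\<kappa> y)"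
      by (simp add: algebra_simps)
    finally have "ennreal (gagliardo_kernel s p x y * \<bar>signed_powr p (u x - u y) * v x\<bar>) \<le>
      ennreal ((?D * (\<bar>u x\<bar> powr p + \<bar>v x\<bar> powr p)) * ?\<kappa> y + (?D * (1 + \<bar>v x\<bar> powr p)) * (\<bar>u y\<bar> powr (p - 1) * ?\<kappa> y))"
      by (rule ennreal_leI)
    also have "\<dots> = ennreal ?D * (ennreal (\<bar>u x\<bar> powr p) + ennreal (\<bar>v x\<bar> powr p)) * ennreal (?\<kappa> y)
       + ennreal ?D * (1 + ennreal (\<bar>v x\<bar> powr p)) * ennreal (\<bar>u y\<bar> powr (p - 1) * ?\<kappa> y)"
      using C(1) by (simp add: ennreal_mult ennreal_plus)
    also have "\<dots> = H x y"
      using that UA by (auto simp: H_def A1_def A2_def \<kappa>_def \<kappa>u_def indicator_def)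
    finally show ?thesis by (simp add: ennreal_mult')
  qed
  show "(pairing_integrand p u v) \<in> borel_measurable (gagliardo_measure s p)"
    by simp
  let ?k = "\<lambda>z. ennreal (gagliardo_kernel s p (fst z) (snd z))"
  let ?e = "\<lambda>w z. ?k z * (ennreal (\<bar>w (fst z) - w (snd z)\<bar> powr p) * indicator (U \<times> U) z)"
  let ?i = "\<lambda>z. ?k z * ennreal (norm (pairing_integrand p u v z))"
  have "(\<integral>\<^sup>+z. ennreal (norm (pairing_integrand p u v z)) \<partial>gagliardo_measure s p)
    = (\<integral>\<^sup>+z. ?i z \<partial>(lebesgue \<Otimes>\<^sub>M lebesgue))"
    by (rule nn_integral_gagliardo_measure) measurable
  also have "\<dots> \<le> (\<integral>\<^sup>+z. (?e u z + ?e v z) + (H (fst z) (snd z) + H (snd z) (fst z)) \<partial>(lebesgue \<Otimes>\<^sub>M lebesgue))"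
  proof (rule nn_integral_mono_AE)
    show "AE z in lebesgue \<Otimes>\<^sub>M lebesgue. ?i z \<le> (?e u z + ?e v z) + (H (fst z) (snd z) + H (snd z) (fst z))"
      using AE_lebesgue_fst[OF ae] AE_lebesgue_snd[OF ae]
    proof eventually_elim
      case (elim z)
      obtain x y where z: "z = (x, y)" by (cases z)
      consider "x \<in> U" "y \<in> U" | "x \<in> \<Omega>" "y \<notin> U" | "x \<notin> U" "y \<in> \<Omega>" | "x \<notin> \<Omega>" "y \<notin> \<Omega>"
        using UA by blast
      then show ?case
      proof cases
        case 1
        have "?i z \<le> ?k z * (ennreal (\<bar>u x - u y\<bar> powr p) + ennreal (\<bar>v x - v y\<bar> powr p))"
          using abs_signed_powr_mult_le[OF p(1), of "u x - u y" "v x - v y"]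
          by (intro mult_left_mono) (auto simp: z simp flip: ennreal_plus)
        also have "\<dots> = ?e u z + ?e v z" using 1 by (simp add: z distrib_left)
        finally show ?thesis by (simp add: add_increasing2)
      next
        case 2
        then have "v y = 0" using elim UA by (auto simp: z)
        then have "?i z \<le> H x y" using far[of x y] 2 by (simp add: z)
        then show ?thesis by (simp add: z add_increasing add_increasing2)
      next
        case 3
        then have "v x = 0" using elim UA by (auto simp: z)
        then have "?i z = ennreal (gagliardo_kernel s p y x) * ennreal \<bar>signed_powr p (u y - u x) * v y\<bar>"
          by (simp add: z gagliardo_kernel_commute[of s p x y] abs_mult abs_signed_powr abs_minus_commute)
        also have "\<dots> \<le> H y x" using far[of y x] 3 by simp
        finally show ?thesis by (simp add: z add_increasing add_increasing2)
      next
        case 4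
        then show ?thesis using elim by (simp add: z)
      qed
    qed
  qed
  also have "\<dots> = (gagliardo_pow s p U u + gagliardo_pow s p U v) +
      ((\<integral>\<^sup>+z. A1 (fst z) * \<kappa> (snd z) \<partial>(lebesgue \<Otimes>\<^sub>M lebesgue)) + (\<integral>\<^sup>+z. A2 (fst z) * \<kappa>u (snd z) \<partial>(lebesgue \<Otimes>\<^sub>M lebesgue)) +
      ((\<integral>\<^sup>+z. \<kappa> (fst z) * A1 (snd z) \<partial>(lebesgue \<Otimes>\<^sub>M lebesgue)) + (\<integral>\<^sup>+z. \<kappa>u (fst z) * A2 (snd z) \<partial>(lebesgue \<Otimes>\<^sub>M lebesgue))))"
    unfolding H_def
    by (simp add: nn_integral_add gagliardo_pow_eq_pair mult.commute[of "A1 _" "\<kappa> _"] mult.commute[of "A2 _" "\<kappa>u _"])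
  also have "\<dots> < \<infinity>"
  proof -
    have "gagliardo_pow s p U v \<le> gagliardo_pow s p UNIV v" by (rule gagliardo_pow_mono) simp
    also have "\<dots> < \<infinity>" using v by (simp add: frac_sobolev_0_iff)
    finally have "gagliardo_pow s p U v < \<infinity>" .
    then show ?thesis using U(3) fin finA
      by (simp add: nn_integral_pair_times ennreal_mult_less_top frac_sobolev_iff)
  qed
  finally show "(\<integral>\<^sup>+z. ennreal (norm (pairing_integrand p u v z)) \<partial>gagliardo_measure s p) < \<infinity>" .
qed

section \<open>Averages over dyadic cubes\<close>

definition dyadic_index :: "nat \<Rightarrow> real ^ 'n \<Rightarrow> 'n \<Rightarrow> int" where
  "dyadic_index k x i = \<lfloor>2 ^ k * x $ i\<rfloor>"

definition dyadic_cell :: "nat \<Rightarrow> real ^ 'n \<Rightarrow> (real ^ 'n) set" where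
  "dyadic_cell k x = {y. dyadic_index k y = dyadic_index k x}"

text \<open>The factor is the inverse of the volume of a cube, as \<open>emeasure_dyadic_cell\<close> shows.\<close>

definition dyadic_avg :: "nat \<Rightarrow> (real ^ 'n \<Rightarrow> real) \<Rightarrow> real ^ 'n \<Rightarrow> real" where
  "dyadic_avg k w x = 2 powr (real k * real CARD('n)) * (LINT y:dyadic_cell k x|lebesgue. w y)"

lemma dyadic_cell_self [simp]: "x \<in> dyadic_cell k x"
  by (simp add: dyadic_cell_def)

lemma dyadic_cell_sym: "y \<in> dyadic_cell k x \<longleftrightarrow> x \<in> dyadic_cell k y"
  by (auto simp: dyadic_cell_def)

lemma dyadic_cell_eq: "y \<in> dyadic_cell k x \<Longrightarrow> dyadic_cell k y = dyadic_cell k x"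
  by (auto simp: dyadic_cell_def)

lemma dyadic_index_Suc: "dyadic_index k x i = dyadic_index (Suc k) x i div 2"
  using floor_divide_real_eq_div[of 2 "2 ^ Suc k * x $ i"] by (simp add: dyadic_index_def)

lemma dyadic_cell_Suc_subset: "dyadic_cell (Suc k) x \<subseteq> dyadic_cell k x"
proof
  fix y assume "y \<in> dyadic_cell (Suc k) x"
  then have *: "dyadic_index (Suc k) y i = dyadic_index (Suc k) x i" for i by (simp add: dyadic_cell_def)
  have "dyadic_index k y = dyadic_index k x"
  proof
    show "dyadic_index k y i = dyadic_index k x i" for i
      unfolding dyadic_index_Suc[of k] by (simp only: *)
  qed
  then show "y \<in> dyadic_cell k x" by (simp add: dyadic_cell_def)
qed

lemma dyadic_cell_mono: "k \<le> l \<Longrightarrow> dyadic_cell l x \<subseteq> dyadic_cell k x"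
  by (induction rule: dec_induct) (use dyadic_cell_Suc_subset in blast)+

lemma measurable_dyadic_index [measurable]:
  "(\<lambda>x. dyadic_index k x i) \<in> borel \<rightarrow>\<^sub>M count_space UNIV"
  unfolding dyadic_index_def by measurable

lemma pred_dyadic_cell [measurable (raw)]:
  assumes [measurable]: "f \<in> M \<rightarrow>\<^sub>M borel" "g \<in> M \<rightarrow>\<^sub>M borel"
  shows "Measurable.pred M (\<lambda>z. g z \<in> dyadic_cell k (f z))"
proof -
  have "Measurable.pred M (\<lambda>z. \<forall>i\<in>UNIV. dyadic_index k (g z) i = dyadic_index k (f z) i)"
    by measurable
  then show ?thesis by (simp add: dyadic_cell_def fun_eq_iff)
qed

lemma sets_dyadic_cell [measurable]: "dyadic_cell k x \<in> sets borel"
proof -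
  have "Measurable.pred borel (\<lambda>y. y \<in> dyadic_cell k x)" by measurable
  then show ?thesis by (simp add: pred_def)
qed

lemma sets_lebesgue_dyadic_cell [measurable]: "dyadic_cell k x \<in> sets lebesgue"
  using sets_dyadic_cell by (metis sets_completionI_sets sets_lborel)

lemma emeasure_dyadic_cell:
  fixes x :: "real ^ 'n"
  shows "emeasure lebesgue (dyadic_cell k x) = ennreal (1 / 2 powr (real k * real CARD('n)))"
proof -
  define l :: "real ^ 'n" where "l = (\<chi> i. real_of_int (dyadic_index k x i) / 2 ^ k)"
  define u :: "real ^ 'n" where "u = (\<chi> i. (real_of_int (dyadic_index k x i) + 1) / 2 ^ k)"
  have mem: "y \<in> dyadic_cell k x \<longleftrightarrow> (\<forall>i. l $ i \<le> y $ i \<and> y $ i < u $ i)" for y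
  proof -
    have "dyadic_index k y i = dyadic_index k x i \<longleftrightarrow> l $ i \<le> y $ i \<and> y $ i < u $ i" for i
    proof -
      have "dyadic_index k y i = m \<longleftrightarrow> real_of_int m / 2 ^ k \<le> y $ i \<and> y $ i < (real_of_int m + 1) / 2 ^ k" for m
        unfolding dyadic_index_def floor_eq_iff by (simp add: field_simps)
      then show ?thesis by (simp add: l_def u_def)
    qed
    then show ?thesis by (auto simp: dyadic_cell_def fun_eq_iff)
  qed
  have lu: "l $ i \<le> u $ i" for i by (simp add: l_def u_def divide_right_mono)
  have Basis: "(\<Prod>b\<in>Basis. (u - l) \<bullet> b) = 1 / 2 powr (real k * real CARD('n))"
  proof -
    have "(u - l) \<bullet> b = 1 / 2 ^ k" if "b \<in> Basis" for b
      using that by (auto simp: Basis_vec_def inner_axis l_def u_def simp flip: diff_divide_distrib)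
    then have "(\<Prod>b\<in>Basis. (u - l) \<bullet> b) = (1 / 2 ^ k) ^ CARD('n)" by simp
    also have "\<dots> = 1 / 2 powr (real k * real CARD('n))"
      by (simp add: power_one_over powr_realpow[symmetric] powr_powr[symmetric] flip: power_mult)
    finally show ?thesis .
  qed
  have le: "\<forall>b\<in>Basis. l \<bullet> b \<le> u \<bullet> b" using lu by (auto simp: Basis_vec_def inner_axis)
  have "emeasure lebesgue (box l u) \<le> emeasure lebesgue (dyadic_cell k x)"
    by (rule emeasure_mono) (auto simp: mem mem_box_cart less_imp_le)
  moreover have "emeasure lebesgue (dyadic_cell k x) \<le> emeasure lebesgue (cbox l u)"
    by (rule emeasure_mono) (auto simp: mem mem_box_cart less_imp_le)
  ultimately show ?thesis using le
    by (simp add: emeasure_lborel_box_eq emeasure_lborel_cbox_eq Basis order_antisym)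
qed

lemma norm_diff_dyadic_cell:
  fixes x y :: "real ^ 'n"
  assumes "y \<in> dyadic_cell k x"
  shows "norm (x - y) \<le> real CARD('n) * 2 powr (- real k)"
proof -
  have "\<bar>(x - y) $ i\<bar> \<le> 2 powr (- real k)" for i
  proof -
    have "\<lfloor>2 ^ k * y $ i\<rfloor> = \<lfloor>2 ^ k * x $ i\<rfloor>" using assms by (simp add: dyadic_cell_def dyadic_index_def fun_eq_iff)
    then have "\<bar>2 ^ k * x $ i - 2 ^ k * y $ i\<bar> \<le> 1" by linarith
    then have "2 ^ k * \<bar>(x - y) $ i\<bar> \<le> 1" by (simp add: abs_mult flip: right_diff_distrib)
    then show ?thesis by (simp add: powr_minus powr_realpow field_simps)
  qed
  then have "(\<Sum>i\<in>UNIV. \<bar>(x - y) $ i\<bar>) \<le> (\<Sum>i\<in>(UNIV :: 'n set). 2 powr (- real k))" by (intro sum_mono)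
  then show ?thesis using norm_le_l1_cart[of "x - y"] by simp
qed

lemma dyadic_cell_small:
  fixes S U :: "(real ^ 'n) set"
  assumes "bounded S" "open U" "closure S \<subseteq> U"
  obtains k where "\<And>x. x \<in> S \<Longrightarrow> dyadic_cell k x \<subseteq> U"
proof -
  have "compact (closure S)" "closed (- U)" "closure S \<inter> - U = {}"
    using assms by (auto simp: compact_closure)
  then obtain d where d: "d > 0" "\<And>x y. x \<in> closure S \<Longrightarrow> y \<in> - U \<Longrightarrow> d \<le> dist x y"
    using separate_compact_closed[of "closure S" "- U"] by auto
  obtain k where k: "(1 / 2) ^ k < d / real CARD('n)"
    using real_arch_pow_inv[of "d / real CARD('n)" "1 / 2"] d by auto
  show thesis
  proof
    fix x assume x: "x \<in> S"
    show "dyadic_cell k x \<subseteq> U"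
    proof
      fix y assume "y \<in> dyadic_cell k x"
      then have "norm (x - y) \<le> real CARD('n) * 2 powr (- real k)" by (rule norm_diff_dyadic_cell)
      also have "(2::real) powr (- real k) = (1 / 2) ^ k"
        by (simp only: powr_minus powr_realpow power_one_over inverse_eq_divide zero_less_numeral)
      finally have "norm (x - y) \<le> real CARD('n) * (1 / 2) ^ k" .
      also have "\<dots> < d" using k by (simp add: field_simps)
      finally show "y \<in> U" using d(2)[of x y] x closure_subset[of S] by (force simp: dist_norm)
    qed
  qed
qed

text \<open>Up to a constant, the best level is \<open>T powr (1 / p)\<close>.\<close>

lemma powr_le_of_levels:
  fixes t T p :: real
  assumes "t \<ge> 0" "T \<ge> 0" "p \<ge> 1" and le: "\<And>l. l > 0 \<Longrightarrow> t \<le> l + l powr (1 - p) * T"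
  shows "t powr p \<le> 2 powr p * T"
proof (cases "T = 0")
  case True
  have "t \<le> 0"
  proof (rule field_le_epsilon)
    fix e :: real assume "e > 0"
    from le[OF this] True show "t \<le> 0 + e" by simp
  qed
  then show ?thesis using assms True by simp
next
  case False
  then have T: "T > 0" using assms by simp
  have "(T powr (1 / p)) powr (1 - p) * T = T powr ((1 - p) / p + 1)"
    using T by (simp add: powr_powr powr_add)
  also have "(1 - p) / p + 1 = 1 / p" using assms by (simp add: field_simps)
  finally have "t \<le> 2 * T powr (1 / p)" using le[of "T powr (1 / p)"] T by simp
  then have "t powr p \<le> (2 * T powr (1 / p)) powr p" using assms by (intro powr_mono2) auto
  also have "\<dots> = 2 powr p * T" using assms T by (simp add: powr_mult powr_powr)
  finally show ?thesis .
qed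

text \<open>Integrating \<open>le_level_plus_powr\<close> and optimizing the level yields Jensen's inequality for averages up to
  the factor \<open>2 powr p\<close>. If the right-hand side is finite, then \<open>w\<close> is integrable on \<open>Q\<close>, so that the integral on
  the left is not a default value.\<close>

lemma average_diff_powr_le:
  fixes w :: "'a \<Rightarrow> real"
  assumes [measurable]: "w \<in> borel_measurable M" "Q \<in> sets M"
    and D: "D > 0" and Q: "emeasure M Q = ennreal (1 / D)" and p: "p \<ge> 1"
  shows "ennreal (\<bar>D * (LINT y:Q|M. w y) - c\<bar> powr p) \<le>
    ennreal (2 powr p * D) * (\<integral>\<^sup>+y. ennreal (\<bar>w y - c\<bar> powr p) * indicator Q y \<partial>M)"
proof -
  let ?I = "\<integral>\<^sup>+y. ennreal (\<bar>w y - c\<bar> powr p) * indicator Q y \<partial>M"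
  let ?J = "\<integral>y. \<bar>w y - c\<bar> powr p * indicator Q y \<partial>M" and ?K = "\<integral>y. (w y - c) * indicator Q y \<partial>M" and ?A = "D * (LINT y:Q|M. w y) - c"
  show ?thesis
  proof (cases "?I < \<infinity>")
    case False
    then have "?I = \<infinity>" by (simp add: less_top[symmetric])
    then show ?thesis using D by (simp add: ennreal_mult_top)
  next
    case True
    have ind: "integrable M (indicator Q :: 'a \<Rightarrow> real)"
      using Q by (simp add: integrable_indicator_iff)
    have mQ: "measure M Q = 1 / D" using Q D by (simp add: measure_def)
    have ip: "integrable M (\<lambda>y. \<bar>w y - c\<bar> powr p * indicator Q y)"
      using True by (intro integrableI_bounded) (auto simp: ennreal_mult' ennreal_indicator)
    define T where "T = D * ?J"
    have bnd: "\<bar>w y - c\<bar> * indicator Q y \<le> l * indicator Q y + l powr (1 - p) * (\<bar>w y - c\<bar> powr p * indicator Q y)"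
      if "l > 0" for y l
      using le_level_plus_powr[of "\<bar>w y - c\<bar>" l p] that p by (simp add: indicator_def)
    have i1: "integrable M (\<lambda>y. \<bar>w y - c\<bar> * indicator Q y)"
      by (rule Bochner_Integration.integrable_bound[where f="\<lambda>y. indicator Q y + \<bar>w y - c\<bar> powr p * indicator Q y"])
        (use ind ip bnd[of 1] in \<open>auto simp: abs_mult\<close>)
    have i2: "integrable M (\<lambda>y. (w y - c) * indicator Q y)"
      by (rule Bochner_Integration.integrable_bound[OF i1]) (auto simp: abs_mult)
    have i3: "integrable M (\<lambda>y. w y * indicator Q y)"
      using Bochner_Integration.integrable_add[OF i2 integrable_mult_right[OF ind, of c]] by (simp add: algebra_simps)
    have "?A = D * ((\<integral>y. w y * indicator Q y \<partial>M) - c * measure M Q)"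
      using D by (simp add: set_lebesgue_integral_def mQ algebra_simps)
    also have "\<dots> = D * ?K"
      using i3 ind by (simp add: left_diff_distrib)
    finally have eq: "?A = D * ?K" .
    have "\<bar>?A\<bar> \<le> l + l powr (1 - p) * T" if l: "l > 0" for l
    proof -
      have "\<bar>?K\<bar> \<le> (\<integral>y. \<bar>w y - c\<bar> * indicator Q y \<partial>M)"
        using integral_abs_bound[of M "\<lambda>y. (w y - c) * indicator Q y"] by (simp add: abs_mult)
      also have "\<dots> \<le> (\<integral>y. l * indicator Q y + l powr (1 - p) * (\<bar>w y - c\<bar> powr p * indicator Q y) \<partial>M)"
        using i1 ind ip bnd[OF l] by (intro integral_mono) auto
      also have "\<dots> = l * (1 / D) + l powr (1 - p) * ?J"
        using ind ip by (simp add: mQ)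
      finally have "D * \<bar>?K\<bar> \<le> D * (l * (1 / D) + l powr (1 - p) * ?J)"
        using D by (intro mult_left_mono) auto
      also have "\<dots> = l + l powr (1 - p) * T" using D by (simp add: T_def algebra_simps)
      finally show ?thesis using D by (simp add: eq abs_mult)
    qed
    moreover have "T \<ge> 0" unfolding T_def using D by (intro mult_nonneg_nonneg integral_nonneg_AE) auto
    ultimately have "\<bar>?A\<bar> powr p \<le> 2 powr p * T"
      using p by (intro powr_le_of_levels) auto
    also have "ennreal (2 powr p * T) = ennreal (2 powr p * D) * ennreal ?J"
      unfolding T_def using D by (subst ennreal_mult[symmetric]) (auto intro!: integral_nonneg_AE simp: mult.assoc)
    also have "ennreal ?J = ?I"
      using ip by (subst nn_integral_eq_integral[symmetric]) (auto simp: ennreal_mult' ennreal_indicator)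
    finally show ?thesis by (simp add: ennreal_leI)
  qed
qed

lemma dyadic_avg_diff_powr_le:
  fixes x :: "real ^ 'n"
  assumes "w \<in> borel_measurable lebesgue" "p \<ge> 1"
  shows "ennreal (\<bar>dyadic_avg k w x - c\<bar> powr p) \<le>
    ennreal (2 powr p * 2 powr (real k * real CARD('n))) *
      (\<integral>\<^sup>+y. ennreal (\<bar>w y - c\<bar> powr p) * indicator (dyadic_cell k x) y \<partial>lebesgue)"
  unfolding dyadic_avg_def
  by (rule average_diff_powr_le) (use assms in \<open>auto simp: emeasure_dyadic_cell\<close>)

lemma measurable_dyadic_avg [measurable]:
  assumes [measurable]: "w \<in> borel_measurable lebesgue"
  shows "dyadic_avg k w \<in> borel_measurable lebesgue"
  unfolding dyadic_avg_def[abs_def] set_lebesgue_integral_def by measurable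

text \<open>On the diagonal the kernel has the default value \<open>0\<close>, but there the left-hand side vanishes, too.\<close>

lemma powr_diff_le_gagliardo_kernel:
  fixes x y :: "real ^ 'n"
  assumes "norm (x - y) \<le> d" "p * s \<ge> 0"
  shows "ennreal (\<bar>w x - w y\<bar> powr p) \<le> ennreal (d powr (real CARD('n) + p * s)) *
    (ennreal (gagliardo_kernel s p x y) * ennreal (\<bar>w x - w y\<bar> powr p))"
proof (cases "x = y")
  case False
  then have n: "0 < norm (x - y)" by simp
  have "1 = norm (x - y) powr (real CARD('n) + p * s) * gagliardo_kernel s p x y"
    using n by (simp add: gagliardo_kernel_def flip: powr_add)
  also have "\<dots> \<le> d powr (real CARD('n) + p * s) * gagliardo_kernel s p x y"
    using assms n by (intro mult_right_mono powr_mono2) auto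
  finally have "1 * \<bar>w x - w y\<bar> powr p \<le> d powr (real CARD('n) + p * s) * gagliardo_kernel s p x y * \<bar>w x - w y\<bar> powr p"
    by (intro mult_right_mono) auto
  then show ?thesis by (simp add: mult.assoc ennreal_leI flip: ennreal_mult)
qed simp

lemma powr_diff_le_gagliardo_kernel_cell:
  fixes x y :: "real ^ 'n"
  assumes "y \<in> dyadic_cell k x" "p * s \<ge> 0"
  shows "ennreal (\<bar>w x - w y\<bar> powr p) \<le>
    ennreal (real CARD('n) powr (real CARD('n) + p * s) * 2 powr (- (real k * (real CARD('n) + p * s)))) *
      (ennreal (gagliardo_kernel s p x y) * ennreal (\<bar>w x - w y\<bar> powr p))"
proof -
  have "(real CARD('n) * 2 powr (- real k)) powr (real CARD('n) + p * s) =
    real CARD('n) powr (real CARD('n) + p * s) * 2 powr (- (real k * (real CARD('n) + p * s)))"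
    by (simp add: powr_mult powr_powr)
  then show ?thesis
    using powr_diff_le_gagliardo_kernel[OF norm_diff_dyadic_cell[OF assms(1)] assms(2), of w] by simp
qed

text \<open>The kernel on a cube is at least a multiple of \<open>2 powr (k * (CARD('n) + p * s))\<close>. The volume of the cube accounts for
  \<open>2 powr (k * CARD('n))\<close>, and \<open>2 powr (k * (p * s))\<close> remains as gain.\<close>

lemma dyadic_avg_error:
  fixes \<Omega> U :: "(real ^ 'n) set"
  assumes [measurable]: "w \<in> borel_measurable lebesgue" "\<Omega> \<in> sets lebesgue" "U \<in> sets lebesgue"
    and p: "p \<ge> 1" "s \<ge> 0" and cells: "\<And>x. x \<in> \<Omega> \<Longrightarrow> dyadic_cell k x \<subseteq> U"
  shows "Lp_pow_on p \<Omega> (\<lambda>x. dyadic_avg k w x - w x) \<le>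
    ennreal (2 powr p * real CARD('n) powr (real CARD('n) + p * s) * 2 powr (- (real k * (p * s)))) * gagliardo_pow s p U w"
proof -
  let ?N = "real CARD('n)"
  define C1 where "C1 = 2 powr p * 2 powr (real k * ?N)"
  define C2 where "C2 = ?N powr (?N + p * s) * 2 powr (- (real k * (?N + p * s)))"
  define G where "G x y = ennreal (gagliardo_kernel s p x y) * (ennreal (\<bar>w x - w y\<bar> powr p) * indicator (U \<times> U) (x, y))" for x y
  have [measurable]: "(\<lambda>(x, y). G x y) \<in> borel_measurable (lebesgue \<Otimes>\<^sub>M lebesgue)"
    unfolding G_def case_prod_beta by measurable
  have [measurable]: "(\<lambda>y. G x y) \<in> borel_measurable lebesgue" for x
    unfolding G_def by measurable
  have ps: "p * s \<ge> 0" using p by simp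
  have C: "C1 * C2 = 2 powr p * ?N powr (?N + p * s) * 2 powr (- (real k * (p * s)))"
    unfolding C1_def C2_def by (simp add: algebra_simps flip: powr_add)
  have "Lp_pow_on p \<Omega> (\<lambda>x. dyadic_avg k w x - w x) \<le>
    (\<integral>\<^sup>+x. ennreal (C1 * C2) * (\<integral>\<^sup>+y. G x y \<partial>lebesgue) \<partial>lebesgue)"
  proof (rule nn_integral_mono)
    fix x
    show "ennreal (\<bar>dyadic_avg k w x - w x\<bar> powr p) * indicator \<Omega> x \<le> ennreal (C1 * C2) * (\<integral>\<^sup>+y. G x y \<partial>lebesgue)"
    proof (cases "x \<in> \<Omega>")
      case True
      have "ennreal (\<bar>dyadic_avg k w x - w x\<bar> powr p) \<le>
        ennreal C1 * (\<integral>\<^sup>+y. ennreal (\<bar>w y - w x\<bar> powr p) * indicator (dyadic_cell k x) y \<partial>lebesgue)"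
        unfolding C1_def by (rule dyadic_avg_diff_powr_le) (use p in auto)
      also have "(\<integral>\<^sup>+y. ennreal (\<bar>w y - w x\<bar> powr p) * indicator (dyadic_cell k x) y \<partial>lebesgue) \<le>
        (\<integral>\<^sup>+y. ennreal C2 * G x y \<partial>lebesgue)"
      proof (rule nn_integral_mono)
        fix y
        show "ennreal (\<bar>w y - w x\<bar> powr p) * indicator (dyadic_cell k x) y \<le> ennreal C2 * G x y"
        proof (cases "y \<in> dyadic_cell k x")
          case y: True
          have "(x, y) \<in> U \<times> U" using y cells[OF True] dyadic_cell_self by blast
          then show ?thesis
            using powr_diff_le_gagliardo_kernel_cell[OF y ps, of w] y
            by (simp add: G_def C2_def abs_minus_commute)
        qed simp
      qed
      also have "\<dots> = ennreal C2 * (\<integral>\<^sup>+y. G x y \<partial>lebesgue)" by (simp add: nn_integral_cmult)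
      finally have "ennreal (\<bar>dyadic_avg k w x - w x\<bar> powr p) \<le> ennreal C1 * (ennreal C2 * (\<integral>\<^sup>+y. G x y \<partial>lebesgue))"
        by (simp add: mult_left_mono)
      then show ?thesis using True by (simp add: C1_def C2_def ennreal_mult mult_ac)
    qed simp
  qed
  also have "\<dots> = ennreal (C1 * C2) * gagliardo_pow s p U w"
    unfolding gagliardo_pow_eq[OF assms(1,3)] G_def[symmetric] by (rule nn_integral_cmult) measurable
  finally show ?thesis by (simp add: C)
qed

text \<open>Compare the two averages through the values of \<open>w\<close> on the smaller cube. There are now two averages and
  hence two volume factors, and \<open>2 * CARD('n) - (CARD('n) + p * s)\<close> is the exponent on the right.\<close>

lemma dyadic_avg_step:
  fixes x :: "real ^ 'n"
  assumes [measurable]: "w \<in> borel_measurable lebesgue" and p: "p \<ge> 1" "s \<ge> 0"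
  shows "ennreal (\<bar>dyadic_avg (Suc k) w x - dyadic_avg k w x\<bar> powr p) \<le>
    ennreal (4 powr p * 2 powr real CARD('n) * real CARD('n) powr (real CARD('n) + p * s)
      * 2 powr (real k * (real CARD('n) - p * s))) * gagliardo_pow s p (dyadic_cell k x) w"
proof -
  let ?N = "real CARD('n)" and ?Q = "dyadic_cell k x"
  define C0 where "C0 = 2 powr p * 2 powr (real (Suc k) * ?N)"
  define C1 where "C1 = 2 powr p * 2 powr (real k * ?N)"
  define C2 where "C2 = ?N powr (?N + p * s) * 2 powr (- (real k * (?N + p * s)))"
  define G where "G y z = ennreal (gagliardo_kernel s p y z) * (ennreal (\<bar>w y - w z\<bar> powr p) * indicator (?Q \<times> ?Q) (y, z))" for y z
  have [measurable]: "(\<lambda>(x, y). G x y) \<in> borel_measurable (lebesgue \<Otimes>\<^sub>M lebesgue)"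
    unfolding G_def case_prod_beta by measurable
  have [measurable]: "(\<lambda>y. G x y) \<in> borel_measurable lebesgue" for x
    unfolding G_def by measurable
  have ps: "p * s \<ge> 0" using p by simp
  have C4: "(2::real) powr p * 2 powr p = 4 powr p" by (simp flip: powr_mult)
  have C5: "(2::real) powr (real (Suc k) * ?N) * 2 powr (real k * ?N) * 2 powr (- (real k * (?N + p * s))) =
     2 powr ?N * 2 powr (real k * (?N - p * s))"
    by (simp add: algebra_simps flip: powr_add)
  have "C0 * (C1 * C2) = (2 powr p * 2 powr p) * ?N powr (?N + p * s) *
      (2 powr (real (Suc k) * ?N) * 2 powr (real k * ?N) * 2 powr (- (real k * (?N + p * s))))"
    unfolding C0_def C1_def C2_def by (simp only: mult_ac)
  then have C: "C0 * (C1 * C2) = 4 powr p * 2 powr ?N * ?N powr (?N + p * s) * 2 powr (real k * (?N - p * s))"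
    unfolding C4 C5 by (simp only: mult_ac)
  have C12: "C1 * C2 \<ge> 0" "C0 \<ge> 0" by (auto simp: C0_def C1_def C2_def)
  have "ennreal (\<bar>dyadic_avg (Suc k) w x - dyadic_avg k w x\<bar> powr p) \<le>
    ennreal C0 * (\<integral>\<^sup>+y. ennreal (\<bar>w y - dyadic_avg k w x\<bar> powr p) * indicator (dyadic_cell (Suc k) x) y \<partial>lebesgue)"
    unfolding C0_def by (rule dyadic_avg_diff_powr_le) (use p in auto)
  also have "(\<integral>\<^sup>+y. ennreal (\<bar>w y - dyadic_avg k w x\<bar> powr p) * indicator (dyadic_cell (Suc k) x) y \<partial>lebesgue)
    \<le> (\<integral>\<^sup>+y. ennreal (C1 * C2) * (\<integral>\<^sup>+z. G y z \<partial>lebesgue) \<partial>lebesgue)"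
  proof (rule nn_integral_mono)
    fix y
    show "ennreal (\<bar>w y - dyadic_avg k w x\<bar> powr p) * indicator (dyadic_cell (Suc k) x) y \<le> ennreal (C1 * C2) * (\<integral>\<^sup>+z. G y z \<partial>lebesgue)"
    proof (cases "y \<in> dyadic_cell (Suc k) x")
      case True
      then have y: "y \<in> ?Q" using dyadic_cell_Suc_subset by blast
      have "ennreal (\<bar>dyadic_avg k w x - w y\<bar> powr p) \<le>
        ennreal C1 * (\<integral>\<^sup>+z. ennreal (\<bar>w z - w y\<bar> powr p) * indicator ?Q z \<partial>lebesgue)"
        unfolding C1_def by (rule dyadic_avg_diff_powr_le) (use p in auto)
      also have "(\<integral>\<^sup>+z. ennreal (\<bar>w z - w y\<bar> powr p) * indicator ?Q z \<partial>lebesgue) \<le> (\<integral>\<^sup>+z. ennreal C2 * G y z \<partial>lebesgue)"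
      proof (rule nn_integral_mono)
        fix z
        show "ennreal (\<bar>w z - w y\<bar> powr p) * indicator ?Q z \<le> ennreal C2 * G y z"
        proof (cases "z \<in> ?Q")
          case z: True
          then have "z \<in> dyadic_cell k y" using dyadic_cell_eq[OF y] by simp
          from powr_diff_le_gagliardo_kernel_cell[OF this ps, of w] show ?thesis
            using y z by (simp add: G_def C2_def abs_minus_commute)
        qed simp
      qed
      also have "\<dots> = ennreal C2 * (\<integral>\<^sup>+z. G y z \<partial>lebesgue)" by (simp add: nn_integral_cmult)
      finally have "ennreal (\<bar>dyadic_avg k w x - w y\<bar> powr p) \<le> ennreal C1 * (ennreal C2 * (\<integral>\<^sup>+z. G y z \<partial>lebesgue))"
        by (simp add: mult_left_mono)
      then show ?thesis using True by (simp add: C1_def C2_def ennreal_mult mult_ac abs_minus_commute)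
    qed simp
  qed
  also have "\<dots> = ennreal (C1 * C2) * gagliardo_pow s p ?Q w"
    unfolding gagliardo_pow_eq[OF assms(1) sets_lebesgue_dyadic_cell] G_def[symmetric] by (rule nn_integral_cmult) measurable
  finally have "ennreal (\<bar>dyadic_avg (Suc k) w x - dyadic_avg k w x\<bar> powr p) \<le> ennreal C0 * (ennreal (C1 * C2) * gagliardo_pow s p ?Q w)"
    by (simp add: mult_left_mono)
  also have "\<dots> = ennreal (C0 * (C1 * C2)) * gagliardo_pow s p ?Q w"
    using C12 by (simp add: ennreal_mult mult.assoc)
  finally show ?thesis by (simp add: C)
qed

text \<open>By Tonelli's theorem: a pair of points counts for the energy of the cube around \<open>x\<close> only if it lies in
  that cube, so only for \<open>x\<close> in a set with the volume of one cube.\<close>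

lemma nn_integral_gagliardo_pow_dyadic_cell:
  fixes \<Omega> U :: "(real ^ 'n) set"
  assumes [measurable]: "w \<in> borel_measurable lebesgue" "\<Omega> \<in> sets lebesgue" "U \<in> sets lebesgue"
    and cells: "\<And>x. x \<in> \<Omega> \<Longrightarrow> dyadic_cell k x \<subseteq> U"
  shows "(\<integral>\<^sup>+x. gagliardo_pow s p (dyadic_cell k x) w * indicator \<Omega> x \<partial>lebesgue) \<le>
    ennreal (1 / 2 powr (real k * real CARD('n))) * gagliardo_pow s p U w"
proof -
  interpret T: pair_sigma_finite "lebesgue :: (real ^ 'n) measure" "lebesgue \<Otimes>\<^sub>M lebesgue :: ((real ^ 'n) \<times> (real ^ 'n)) measure"
    by unfold_locales
  define G where "G z = ennreal (gagliardo_kernel s p (fst z) (snd z)) * ennreal (\<bar>w (fst z) - w (snd z)\<bar> powr p)" for z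
  have [measurable]: "G \<in> borel_measurable (lebesgue \<Otimes>\<^sub>M lebesgue)" unfolding G_def[abs_def] by measurable
  define F where "F x z = G z * (indicator (dyadic_cell k x) (fst z) * indicator (dyadic_cell k x) (snd z) * indicator \<Omega> x)" for x z
  have F [measurable]: "(\<lambda>(x, z). F x z) \<in> borel_measurable (lebesgue \<Otimes>\<^sub>M (lebesgue \<Otimes>\<^sub>M lebesgue))"
    unfolding F_def case_prod_beta by measurable
  have "(\<integral>\<^sup>+x. gagliardo_pow s p (dyadic_cell k x) w * indicator \<Omega> x \<partial>lebesgue) =
    (\<integral>\<^sup>+x. \<integral>\<^sup>+z. F x z \<partial>(lebesgue \<Otimes>\<^sub>M lebesgue) \<partial>lebesgue)"
    by (rule nn_integral_cong)
      (auto simp: gagliardo_pow_eq_pair F_def G_def indicator_times mult.assoc nn_integral_multc[symmetric] intro!: nn_integral_cong)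
  also have "\<dots> = (\<integral>\<^sup>+z. \<integral>\<^sup>+x. F x z \<partial>lebesgue \<partial>(lebesgue \<Otimes>\<^sub>M lebesgue))"
    using T.Fubini'[OF F] by simp
  also have "\<dots> \<le> (\<integral>\<^sup>+z. ennreal (1 / 2 powr (real k * real CARD('n))) * (G z * indicator (U \<times> U) z) \<partial>(lebesgue \<Otimes>\<^sub>M lebesgue))"
  proof (rule nn_integral_mono)
    fix z :: "(real ^ 'n) \<times> (real ^ 'n)"
    have "(\<integral>\<^sup>+x. F x z \<partial>lebesgue) \<le> (\<integral>\<^sup>+x. G z * indicator (U \<times> U) z * indicator (dyadic_cell k (fst z)) x \<partial>lebesgue)"
    proof (rule nn_integral_mono)
      fix x
      show "F x z \<le> G z * indicator (U \<times> U) z * indicator (dyadic_cell k (fst z)) x"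
      proof (cases "x \<in> \<Omega> \<and> fst z \<in> dyadic_cell k x \<and> snd z \<in> dyadic_cell k x")
        case True
        then have "z \<in> U \<times> U" "x \<in> dyadic_cell k (fst z)" using cells[of x] by (auto simp: mem_Times_iff dyadic_cell_sym)
        then show ?thesis using True by (simp add: F_def)
      qed (auto simp: F_def indicator_def)
    qed
    also have "\<dots> = G z * indicator (U \<times> U) z * emeasure lebesgue (dyadic_cell k (fst z))"
      by (rule nn_integral_cmult_indicator) simp
    finally show "(\<integral>\<^sup>+x. F x z \<partial>lebesgue) \<le> ennreal (1 / 2 powr (real k * real CARD('n))) * (G z * indicator (U \<times> U) z)"
      by (simp add: emeasure_dyadic_cell mult.commute)
  qed
  also have "\<dots> = ennreal (1 / 2 powr (real k * real CARD('n))) * gagliardo_pow s p U w"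
    by (simp add: nn_integral_cmult gagliardo_pow_eq_pair G_def mult.assoc)
  finally show ?thesis .
qed

section \<open>Subcritical embedding\<close>

lemma tendsto_of_powr_diff_suminf_finite:
  fixes a :: "nat \<Rightarrow> real"
  assumes "(\<Sum>j. ennreal (\<bar>a j - l\<bar> powr p)) < \<infinity>" "p > 0"
  shows "a \<longlonglongrightarrow> l"
proof -
  have "summable (\<lambda>j. \<bar>a j - l\<bar> powr p)"
    by (rule summable_suminf_not_top) (use assms in auto)
  then have "(\<lambda>j. \<bar>a j - l\<bar> powr p) \<longlonglongrightarrow> 0" by (rule summable_LIMSEQ_zero)
  then have "(\<lambda>j. (\<bar>a j - l\<bar> powr p) powr (1 / p)) \<longlonglongrightarrow> 0 powr (1 / p)"
    by (rule tendsto_powr') (use assms in auto)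
  then have "(\<lambda>j. \<bar>a j - l\<bar>) \<longlonglongrightarrow> 0" using assms(2) by (simp add: powr_powr)
  then show ?thesis by (simp add: tendsto_rabs_zero_iff LIM_zero_iff)
qed

lemma suminf_ennreal_geometric:
  fixes c r :: real
  assumes "c \<ge> 0" "0 \<le> r" "r < 1"
  shows "(\<Sum>j. ennreal (c * r ^ j)) = ennreal (c / (1 - r))"
proof (rule suminf_ennreal_eq)
  show "0 \<le> c * r ^ j" for j using assms by simp
  show "(\<lambda>j. c * r ^ j) sums (c / (1 - r))"
    using sums_mult[OF geometric_sums[of r], of c] assms by (simp add: divide_inverse)
qed

text \<open>Differentiation of integrals along dyadic cubes: the \<open>L\<^sup>p\<close> errors of the averages decay
  geometrically in the generation \<open>k\<close>, so that they are summable almost everywhere.\<close>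

lemma AE_dyadic_avg_tendsto:
  fixes \<Omega> U :: "(real ^ 'n) set"
  assumes [measurable]: "w \<in> borel_measurable lebesgue" "\<Omega> \<in> sets lebesgue" "U \<in> sets lebesgue"
    and p: "p \<ge> 1" "s > 0" and cells: "\<And>x. x \<in> \<Omega> \<Longrightarrow> dyadic_cell k0 x \<subseteq> U"
    and E: "gagliardo_pow s p U w < \<infinity>"
  shows "AE x in lebesgue. x \<in> \<Omega> \<longrightarrow> (\<lambda>j. dyadic_avg (k0 + j) w x) \<longlonglongrightarrow> w x"
proof -
  have ps: "p * s > 0" using p by simp
  define c where "c = 2 powr p * real CARD('n) powr (real CARD('n) + p * s) * 2 powr (- (real k0 * (p * s)))"
  define r :: real where "r = 2 powr (- (p * s))"
  have r: "0 \<le> r" "r < 1" using ps powr_less_mono[of "- (p * s)" 0 "2::real"] by (auto simp: r_def)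
  have c: "c \<ge> 0" by (simp add: c_def)
  define F where "F j x = ennreal (\<bar>dyadic_avg (k0 + j) w x - w x\<bar> powr p) * indicator \<Omega> x" for j x
  have [measurable]: "F j \<in> borel_measurable lebesgue" for j unfolding F_def[abs_def] by measurable
  have F: "(\<integral>\<^sup>+x. F j x \<partial>lebesgue) \<le> ennreal (c * r ^ j) * gagliardo_pow s p U w" for j
  proof -
    have cl: "dyadic_cell (k0 + j) x \<subseteq> U" if "x \<in> \<Omega>" for x
      using cells[OF that] dyadic_cell_mono[of k0 "k0 + j" x] by auto
    have "2 powr (- (real (k0 + j) * (p * s))) = 2 powr (- (real k0 * (p * s))) * r ^ j"
      by (simp add: r_def powr_power algebra_simps flip: powr_add)
    then have "2 powr p * real CARD('n) powr (real CARD('n) + p * s) * 2 powr (- (real (k0 + j) * (p * s))) = c * r ^ j"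
      by (simp add: c_def)
    then show ?thesis
      using dyadic_avg_error[OF assms(1-3) p(1) less_imp_le[OF p(2)] cl] unfolding F_def by simp
  qed
  have "(\<integral>\<^sup>+x. (\<Sum>j. F j x) \<partial>lebesgue) = (\<Sum>j. \<integral>\<^sup>+x. F j x \<partial>lebesgue)"
    by (rule nn_integral_suminf) measurable
  also have "\<dots> \<le> (\<Sum>j. ennreal (c * r ^ j) * gagliardo_pow s p U w)"
    by (intro suminf_le F) auto
  also have "\<dots> = ennreal (c / (1 - r)) * gagliardo_pow s p U w"
    unfolding ennreal_suminf_multc suminf_ennreal_geometric[OF c r] ..
  also have "\<dots> < \<infinity>" using E by (simp add: ennreal_mult_less_top)
  finally have fin: "(\<integral>\<^sup>+x. (\<Sum>j. F j x) \<partial>lebesgue) \<noteq> \<infinity>" by simp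
  have "AE x in lebesgue. (\<Sum>j. F j x) \<noteq> \<infinity>"
    by (rule nn_integral_PInf_AE[OF _ fin]) measurable
  then show ?thesis
  proof eventually_elim
    case (elim x)
    show ?case
    proof
      assume "x \<in> \<Omega>"
      then have "(\<Sum>j. ennreal (\<bar>dyadic_avg (k0 + j) w x - w x\<bar> powr p)) < \<infinity>"
        using elim by (simp add: F_def less_top)
      then show "(\<lambda>j. dyadic_avg (k0 + j) w x) \<longlonglongrightarrow> w x"
        by (rule tendsto_of_powr_diff_suminf_finite) (use p in simp)
    qed
  qed
qed

lemma measurable_gagliardo_pow_dyadic_cell [measurable]:
  fixes w :: "real ^ 'n \<Rightarrow> real"
  assumes [measurable]: "w \<in> borel_measurable lebesgue"
  shows "(\<lambda>x. gagliardo_pow s p (dyadic_cell k x) w) \<in> borel_measurable lebesgue"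
proof -
  have T: "sigma_finite_measure (lebesgue \<Otimes>\<^sub>M lebesgue :: ((real ^ 'n) \<times> (real ^ 'n)) measure)"
    by unfold_locales
  have "(\<lambda>(x, z). ennreal (gagliardo_kernel s p (fst z) (snd z)) * (ennreal (\<bar>w (fst z) - w (snd z)\<bar> powr p) *
      (indicator (dyadic_cell k x) (fst z) * indicator (dyadic_cell k x) (snd z))))
    \<in> borel_measurable (lebesgue \<Otimes>\<^sub>M (lebesgue \<Otimes>\<^sub>M lebesgue))"
    unfolding case_prod_beta by measurable
  from sigma_finite_measure.borel_measurable_nn_integral[OF T this] show ?thesis
    by (simp add: gagliardo_pow_eq_pair indicator_times)
qed

lemma abs_le_of_geometric_steps:
  fixes a :: "nat \<Rightarrow> real"
  assumes lim: "a \<longlonglongrightarrow> l" and r: "0 \<le> r" "r < 1" and d: "d \<ge> 0"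
    and step: "\<And>j. \<bar>a (Suc j) - a j\<bar> \<le> d * r ^ j" and a0: "\<bar>a 0\<bar> \<le> A"
  shows "\<bar>l\<bar> \<le> A + d / (1 - r)"
proof -
  have bnd: "\<bar>a n\<bar> \<le> A + d / (1 - r)" for n
  proof -
    have "a n - a 0 = (\<Sum>j<n. a (Suc j) - a j)" by (simp add: sum_lessThan_telescope)
    then have "\<bar>a n - a 0\<bar> \<le> (\<Sum>j<n. \<bar>a (Suc j) - a j\<bar>)" by (simp add: sum_abs)
    also have "\<dots> \<le> (\<Sum>j<n. d * r ^ j)" by (intro sum_mono step)
    also have "\<dots> \<le> (\<Sum>j. d * r ^ j)"
      using r d by (intro sum_le_suminf summable_mult summable_geometric) auto
    also have "\<dots> = d / (1 - r)"
      using sums_mult[OF geometric_sums[of r], of d] r by (simp add: sums_iff divide_inverse)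
    finally show ?thesis using a0 by linarith
  qed
  have "(\<lambda>n. \<bar>a n\<bar>) \<longlonglongrightarrow> \<bar>l\<bar>" using lim by (rule tendsto_rabs)
  then show ?thesis by (rule LIMSEQ_le_const2) (use bnd in auto)
qed

text \<open>
  The telescoping series \<open>w = avg k0 w + (\<Sum>j. avg (k0 + j + 1) w - avg (k0 + j) w)\<close> converges
  geometrically in \<open>L\<^sup>q\<close>. The \<open>q\<close>-th power of a step is its \<open>p\<close>-th power raised to
  \<open>q / p\<close>, and a power \<open>\<ge> 1\<close> of the energy of a cube is at most that energy if it is at most \<open>1\<close>. Summing over
  the cubes yields the factor \<open>2 powr (- k * \<eta>)\<close>, and \<open>\<eta> > 0\<close> says exactly that \<open>q\<close> is subcritical.
  Half of this decay is spent on the weights \<open>1 / r ^ j\<close> in the function \<open>M\<close>: each step is at most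
  \<open>\<rho> ^ j * M powr (1 / q)\<close>, so the whole series is at most a multiple of \<open>M powr (1 / q)\<close>, and \<open>M\<close> is integrable.
\<close>

lemma fractional_embedding_normalized:
  fixes \<Omega> U :: "(real ^ 'n) set"
  assumes \<Omega> [measurable]: "\<Omega> \<in> sets lebesgue" and \<Omega>fin: "emeasure lebesgue \<Omega> < \<infinity>" and [measurable]: "U \<in> sets lebesgue"
    and p: "p \<ge> 1" "s > 0" and N: "real CARD('n) > p * s"
    and q: "p \<le> q" "q < real CARD('n) * p / (real CARD('n) - p * s)"
    and cells: "\<And>x. x \<in> \<Omega> \<Longrightarrow> dyadic_cell k0 x \<subseteq> U"
  obtains C where "C \<ge> 0"
    "\<And>w. w \<in> borel_measurable lebesgue \<Longrightarrow> Lp_pow_on p U w \<le> 1 \<Longrightarrow>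
      gagliardo_pow s p U w \<le> 1 \<Longrightarrow> Lp_pow_on q \<Omega> w \<le> ennreal C"
proof -
  let ?N = "real CARD('n)"
  define \<eta> where "\<eta> = ?N - (?N - p * s) * (q / p)"
  have \<eta>: "\<eta> > 0" using q N p by (simp add: \<eta>_def field_simps)
  define B where "B = 4 powr p * 2 powr ?N * ?N powr (?N + p * s)"
  define B' where "B' = B powr (q / p)"
  have B: "B \<ge> 0" "B' \<ge> 0" by (auto simp: B_def B'_def)
  define D where "D = 2 powr p * 2 powr (real k0 * ?N)"
  have D: "D \<ge> 0" by (simp add: D_def)
  define A where "A = 1 + D"
  define \<rho> :: real where "\<rho> = 2 powr (- (\<eta> / 2) / q)"
  have qp: "q > 0" using p q by simp
  have \<rho>: "0 \<le> \<rho>" "\<rho> < 1"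
    using \<eta> qp powr_less_mono[of "- (\<eta> / 2) / q" 0 "2::real"] by (auto simp: \<rho>_def)
  define r :: real where "r = 2 powr (- (\<eta> / 2))"
  have r: "0 \<le> r" "r < 1" using \<eta> powr_less_mono[of "- (\<eta> / 2)" 0 "2::real"] by (auto simp: r_def)
  have \<rho>r: "\<rho> powr q = r" using qp by (simp add: \<rho>_def r_def powr_powr)
  define K where "K = B' / (1 - r)"
  have K: "K \<ge> 0" using B r by (simp add: K_def)
  define S where "S = 1 / (1 - \<rho>)"
  have S: "S \<ge> 0" using \<rho> by (simp add: S_def)
  show thesis
  proof (rule that[of "2 powr q * (A powr q * measure lebesgue \<Omega> + S powr q * K)"])
    show "0 \<le> 2 powr q * (A powr q * measure lebesgue \<Omega> + S powr q * K)" using K by simp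
    fix w :: "real ^ 'n \<Rightarrow> real"
    assume w [measurable]: "w \<in> borel_measurable lebesgue"
      and wU: "Lp_pow_on p U w \<le> 1"
      and wE: "gagliardo_pow s p U w \<le> 1"
    define a where "a j x = dyadic_avg (k0 + j) w x" for j x
    have am [measurable]: "a j \<in> borel_measurable lebesgue" for j unfolding a_def[abs_def] by measurable
    have cl: "dyadic_cell (k0 + j) x \<subseteq> U" if "x \<in> \<Omega>" for x j
      using cells[OF that] dyadic_cell_mono[of k0 "k0 + j" x] by auto
    define F where "F j x = ennreal (\<bar>a (Suc j) x - a j x\<bar> powr q / r ^ j) * indicator \<Omega> x" for j x
    have [measurable]: "F j \<in> borel_measurable lebesgue" for j unfolding F_def[abs_def] by measurable
    have step: "ennreal (\<bar>a (Suc j) x - a j x\<bar> powr q) \<le>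
        ennreal (B' * 2 powr (real (k0 + j) * (?N - \<eta>))) * gagliardo_pow s p (dyadic_cell (k0 + j) x) w"
      if "x \<in> \<Omega>" for x j
    proof -
      let ?k = "k0 + j"
      let ?e = "\<lambda>x. gagliardo_pow s p (dyadic_cell (k0 + j) x) w" and ?Y = "(2::real) powr (real (k0 + j) * (?N - \<eta>))"
      have "?e x \<le> gagliardo_pow s p U w" by (rule gagliardo_pow_mono[OF cl[OF that]])
      then have le1: "?e x \<le> 1" using wE by simp
      then have "?e x \<noteq> \<infinity>" by (auto simp: top_unique)
      then obtain e where e: "e \<ge> 0" "?e x = ennreal e"
        by (cases "?e x") auto
      have e1: "e \<le> 1" using le1 e by simp
      let ?t = "\<bar>a (Suc j) x - a j x\<bar>" and ?X = "2 powr (real ?k * (?N - p * s))"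
      have "ennreal (?t powr p) \<le> ennreal (B * ?X) * ennreal e"
        using dyadic_avg_step[OF w p(1) less_imp_le[OF p(2)], of ?k x] by (simp add: a_def e B_def)
      then have "?t powr p \<le> B * ?X * e"
        using B e by (simp flip: ennreal_mult)
      then have "(?t powr p) powr (q / p) \<le> (B * ?X * e) powr (q / p)"
        using p q by (intro powr_mono2) auto
      also have "(?t powr p) powr (q / p) = ?t powr q" using p by (simp add: powr_powr)
      also have "(B * ?X * e) powr (q / p) = B' * ?X powr (q / p) * e powr (q / p)"
        using B e by (simp add: powr_mult B'_def)
      also have "?X powr (q / p) = ?Y"
        by (simp add: powr_powr \<eta>_def mult.assoc)
      also have "B' * ?Y * e powr (q / p) \<le> B' * ?Y * e"
      proof (intro mult_left_mono)
        show "e powr (q / p) \<le> e"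
        proof (cases "e = 0")
          case False
          then have "e powr (q / p) \<le> e powr 1" using e e1 p q by (intro powr_mono') auto
          then show ?thesis using e False by simp
        qed simp
      qed (use B in simp)
      finally have "ennreal (?t powr q) \<le> ennreal (B' * ?Y * e)" by (rule ennreal_leI)
      then show ?thesis using e B by (simp add: ennreal_mult)
    qed
    have F: "(\<integral>\<^sup>+x. F j x \<partial>lebesgue) \<le> ennreal (B' * r ^ j)" for j
    proof -
      let ?k = "k0 + j"
      let ?e = "\<lambda>x. gagliardo_pow s p (dyadic_cell (k0 + j) x) w" and ?Y = "(2::real) powr (real (k0 + j) * (?N - \<eta>))"
      have r0: "r ^ j > 0" by (simp add: r_def)
      have "(\<integral>\<^sup>+x. F j x \<partial>lebesgue) \<le> (\<integral>\<^sup>+x. ennreal (B' * ?Y / r ^ j) * (?e x * indicator \<Omega> x) \<partial>lebesgue)"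
      proof (rule nn_integral_mono)
        fix x
        have "F j x = ennreal (1 / r ^ j) * ennreal (\<bar>a (Suc j) x - a j x\<bar> powr q)" if "x \<in> \<Omega>"
          using that r0 by (simp add: F_def flip: ennreal_mult)
        also have "\<dots> \<le> ennreal (1 / r ^ j) * (ennreal (B' * ?Y) * ?e x)" if "x \<in> \<Omega>"
          by (intro mult_left_mono step that) auto
        also have "\<dots> = ennreal (B' * ?Y / r ^ j) * ?e x"
          using r0 B by (subst mult.assoc[symmetric], subst ennreal_mult[symmetric]) auto
        finally show "F j x \<le> ennreal (B' * ?Y / r ^ j) * (?e x * indicator \<Omega> x)"
          by (cases "x \<in> \<Omega>") (auto simp: F_def)
      qed
      also have "\<dots> \<le> ennreal (B' * ?Y / r ^ j) * (ennreal (1 / 2 powr (real ?k * ?N)) * gagliardo_pow s p U w)"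
      proof -
        have "(\<integral>\<^sup>+x. ennreal (B' * ?Y / r ^ j) * (?e x * indicator \<Omega> x) \<partial>lebesgue)
          = ennreal (B' * ?Y / r ^ j) * (\<integral>\<^sup>+x. ?e x * indicator \<Omega> x \<partial>lebesgue)"
          by (rule nn_integral_cmult) measurable
        moreover have "(\<integral>\<^sup>+x. ?e x * indicator \<Omega> x \<partial>lebesgue) \<le>
            ennreal (1 / 2 powr (real ?k * ?N)) * gagliardo_pow s p U w"
          by (rule nn_integral_gagliardo_pow_dyadic_cell[OF w \<Omega> assms(3) cl])
        ultimately show ?thesis by (simp only: mult_left_mono zero_le)
      qed
      also have "\<dots> \<le> ennreal (B' * ?Y / r ^ j) * (ennreal (1 / 2 powr (real ?k * ?N)) * 1)"
        by (intro mult_left_mono wE) auto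
      also have "\<dots> = ennreal (B' * (?Y / 2 powr (real ?k * ?N)) / r ^ j)"
        using r0 B by (simp flip: ennreal_mult)
      also have "?Y / 2 powr (real ?k * ?N) = 2 powr (- (real ?k * \<eta>))"
        by (simp add: algebra_simps flip: powr_diff)
      also have "ennreal (B' * 2 powr (- (real ?k * \<eta>)) / r ^ j) \<le> ennreal (B' * r ^ j)"
      proof (rule ennreal_leI)
        have "r ^ j * r ^ j = 2 powr (- (real j * \<eta>))"
          by (simp add: r_def powr_power mult.commute flip: powr_add)
        moreover have "(2::real) powr (- (real ?k * \<eta>)) \<le> 2 powr (- (real j * \<eta>))"
          using \<eta> by (intro powr_mono) auto
        ultimately have "2 powr (- (real ?k * \<eta>)) / r ^ j \<le> r ^ j" using r0 by (simp add: divide_le_eq)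
        then have "B' * (2 powr (- (real ?k * \<eta>)) / r ^ j) \<le> B' * r ^ j" by (rule mult_left_mono) (rule B)
        then show "B' * 2 powr (- (real ?k * \<eta>)) / r ^ j \<le> B' * r ^ j" by simp
      qed
      finally show ?thesis .
    qed
    define M where "M x = (\<Sum>j. F j x)" for x
    have [measurable]: "M \<in> borel_measurable lebesgue" unfolding M_def[abs_def] by measurable
    have "(\<integral>\<^sup>+x. M x \<partial>lebesgue) = (\<Sum>j. \<integral>\<^sup>+x. F j x \<partial>lebesgue)"
      unfolding M_def by (rule nn_integral_suminf) measurable
    also have "\<dots> \<le> (\<Sum>j. ennreal (B' * r ^ j))" by (intro suminf_le F) auto
    also have "\<dots> = ennreal K" unfolding K_def by (rule suminf_ennreal_geometric) (use B r in auto)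
    finally have M: "(\<integral>\<^sup>+x. M x \<partial>lebesgue) \<le> ennreal K" .
    have Efin: "gagliardo_pow s p U w < \<infinity>" using wE by (rule le_less_trans) simp
    have lim: "AE x in lebesgue. x \<in> \<Omega> \<longrightarrow> (\<lambda>j. a j x) \<longlonglongrightarrow> w x"
      unfolding a_def by (rule AE_dyadic_avg_tendsto[OF w \<Omega> assms(3) p cells Efin])
    have a0: "\<bar>a 0 x\<bar> \<le> A" if "x \<in> \<Omega>" for x
    proof -
      have "ennreal (\<bar>a 0 x\<bar> powr p) \<le> ennreal D * (\<integral>\<^sup>+y. ennreal (\<bar>w y\<bar> powr p) * indicator (dyadic_cell k0 x) y \<partial>lebesgue)"
        using dyadic_avg_diff_powr_le[OF w p(1), of k0 x 0] by (simp add: D_def a_def)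
      also have "\<dots> \<le> ennreal D * Lp_pow_on p U w"
        using cells[OF that] by (intro mult_left_mono nn_integral_mono) (auto simp: indicator_def)
      also have "\<dots> \<le> ennreal D * 1" by (intro mult_left_mono wU) auto
      finally have "\<bar>a 0 x\<bar> powr p \<le> D" using D by simp
      then show ?thesis using le_level_plus_powr[of "\<bar>a 0 x\<bar>" 1 p] p by (simp add: A_def)
    qed
    have "Lp_pow_on q \<Omega> w \<le>
      (\<integral>\<^sup>+x. ennreal (2 powr q) * (ennreal (A powr q) * indicator \<Omega> x + ennreal (S powr q) * M x) \<partial>lebesgue)"
    proof (rule nn_integral_mono_AE)
      show "AE x in lebesgue. ennreal (\<bar>w x\<bar> powr q) * indicator \<Omega> x \<le>
         ennreal (2 powr q) * (ennreal (A powr q) * indicator \<Omega> x + ennreal (S powr q) * M x)"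
        using lim
      proof eventually_elim
        case (elim x)
        show ?case
        proof (cases "x \<in> \<Omega> \<and> M x < \<infinity>")
          case False
          then consider "x \<notin> \<Omega>" | "M x = \<infinity>" by (cases "x \<in> \<Omega>") (auto simp: less_top[symmetric])
          then show ?thesis
          proof cases
            case 2
            have "ennreal (S powr q) \<noteq> 0" using \<rho> by (simp add: S_def)
            then show ?thesis using 2 by (simp add: ennreal_mult_top)
          qed simp
        next
          case True
          then obtain m where m: "m \<ge> 0" "M x = ennreal m" by (cases "M x") auto
          have "\<bar>a (Suc j) x - a j x\<bar> \<le> m powr (1 / q) * \<rho> ^ j" for j
          proof -
            have r0: "r ^ j > 0" by (simp add: r_def)
            have "F j x \<le> M x" unfolding M_def by (rule le_suminf_ennreal)
            then have "\<bar>a (Suc j) x - a j x\<bar> powr q / r ^ j \<le> m"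
              using True m by (simp add: F_def)
            then have "\<bar>a (Suc j) x - a j x\<bar> powr q \<le> m * r ^ j" using r0 by (simp add: divide_le_eq)
            then have "(\<bar>a (Suc j) x - a j x\<bar> powr q) powr (1 / q) \<le> (m * r ^ j) powr (1 / q)"
              using qp by (intro powr_mono2) auto
            moreover have "(r ^ j) powr (1 / q) = \<rho> ^ j"
              using qp by (simp add: r_def \<rho>_def powr_power powr_powr)
            ultimately show ?thesis using qp m r0 by (simp add: powr_powr powr_mult)
          qed
          with elim True have "\<bar>w x\<bar> \<le> A + m powr (1 / q) / (1 - \<rho>)"
            by (intro abs_le_of_geometric_steps[of "\<lambda>j. a j x"] a0 \<rho>) auto
          then have "\<bar>w x\<bar> \<le> A + S * m powr (1 / q)" by (simp add: S_def)
          then have "\<bar>w x\<bar> powr q \<le> (A + S * m powr (1 / q)) powr q" using qp by (intro powr_mono2) auto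
          also have "\<dots> \<le> 2 powr q * (A powr q + (S * m powr (1 / q)) powr q)"
            using qp S D by (intro powr_add_le) (auto simp: A_def)
          also have "(S * m powr (1 / q)) powr q = S powr q * m" using qp S m by (simp add: powr_mult powr_powr)
          finally have "ennreal (\<bar>w x\<bar> powr q) \<le> ennreal (2 powr q * (A powr q + S powr q * m))" by (rule ennreal_leI)
          then show ?thesis using True m by (simp add: ennreal_mult)
        qed
      qed
    qed
    also have "\<dots> = ennreal (2 powr q) * (ennreal (A powr q) * emeasure lebesgue \<Omega> + ennreal (S powr q) * (\<integral>\<^sup>+x. M x \<partial>lebesgue))"
      by (simp add: nn_integral_cmult nn_integral_add nn_integral_cmult_indicator)
    also have "\<dots> \<le> ennreal (2 powr q) * (ennreal (A powr q) * emeasure lebesgue \<Omega> + ennreal (S powr q) * ennreal K)"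
      by (intro mult_left_mono add_left_mono M) auto
    also have "emeasure lebesgue \<Omega> = ennreal (measure lebesgue \<Omega>)"
      using \<Omega>fin by (intro emeasure_eq_ennreal_measure) auto
    also have "ennreal (2 powr q) * (ennreal (A powr q) * ennreal (measure lebesgue \<Omega>) + ennreal (S powr q) * ennreal K)
       = ennreal (2 powr q * (A powr q * measure lebesgue \<Omega> + S powr q * K))"
      using K by (simp add: ennreal_mult)
    finally show "Lp_pow_on q \<Omega> w \<le>
      ennreal (2 powr q * (A powr q * measure lebesgue \<Omega> + S powr q * K))" .
  qed
qed


lemma powr_scale_eq:
  fixes a t p :: real
  assumes "t > 0" "p > 0"
  shows "\<bar>t powr (- (1 / p)) * a\<bar> powr p = \<bar>a\<bar> powr p / t"
  using assms by (simp add: abs_mult powr_mult powr_powr powr_minus_divide powr_divide)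

lemma fractional_embedding:
  fixes \<Omega> U :: "(real ^ 'n) set"
  assumes \<Omega> [measurable]: "\<Omega> \<in> sets lebesgue" and \<Omega>fin: "emeasure lebesgue \<Omega> < \<infinity>" and U [measurable]: "U \<in> sets lebesgue"
    and p: "p \<ge> 1" "s > 0" and N: "real CARD('n) > p * s"
    and q: "p \<le> q" "q < real CARD('n) * p / (real CARD('n) - p * s)"
    and cells: "\<And>x. x \<in> \<Omega> \<Longrightarrow> dyadic_cell k0 x \<subseteq> U"
  obtains C where "C \<ge> 0"
    "\<And>w t. w \<in> borel_measurable lebesgue \<Longrightarrow> t > 0 \<Longrightarrow> Lp_pow_on p U w \<le> ennreal t \<Longrightarrow>
      gagliardo_pow s p U w \<le> ennreal t \<Longrightarrow> Lp_pow_on q \<Omega> w \<le> ennreal (C * t powr (q / p))"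
proof -
  obtain C where C: "C \<ge> 0"
    "\<And>w. w \<in> borel_measurable lebesgue \<Longrightarrow> Lp_pow_on p U w \<le> 1 \<Longrightarrow>
      gagliardo_pow s p U w \<le> 1 \<Longrightarrow> Lp_pow_on q \<Omega> w \<le> ennreal C"
    using fractional_embedding_normalized[OF \<Omega> \<Omega>fin U p N q cells] by blast
  show thesis
  proof (rule that[OF C(1)])
    fix w :: "real ^ 'n \<Rightarrow> real" and t :: real
    assume w [measurable]: "w \<in> borel_measurable lebesgue" and t: "t > 0"
      and wU: "Lp_pow_on p U w \<le> ennreal t"
      and wE: "gagliardo_pow s p U w \<le> ennreal t"
    define c where "c = t powr (- (1 / p))"
    have p0: "p > 0" "q > 0" using p q by auto
    have t1: "ennreal (1 / t) * ennreal t = 1" using t by (simp flip: ennreal_mult)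
    have 1: "Lp_pow_on p U (\<lambda>x. c * w x) \<le> 1"
    proof -
      have "Lp_pow_on p U (\<lambda>x. c * w x) = (\<integral>\<^sup>+x. ennreal (1 / t) * (ennreal (\<bar>w x\<bar> powr p) * indicator U x) \<partial>lebesgue)"
        unfolding c_def powr_scale_eq[OF t p0(1)] using t
        by (intro nn_integral_cong) (simp add: mult.assoc[symmetric] flip: ennreal_mult)
      also have "\<dots> = ennreal (1 / t) * Lp_pow_on p U w"
        by (rule nn_integral_cmult) measurable
      also have "\<dots> \<le> ennreal (1 / t) * ennreal t" by (intro mult_left_mono wU) auto
      finally show ?thesis by (simp only: t1)
    qed
    have 2: "gagliardo_pow s p U (\<lambda>x. c * w x) \<le> 1"
    proof -
      have eq: "\<bar>c * w x - c * w y\<bar> powr p = \<bar>w x - w y\<bar> powr p / t" for x y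
        using powr_scale_eq[OF t p0(1), of "w x - w y"] by (simp add: c_def right_diff_distrib)
      have "gagliardo_pow s p U (\<lambda>x. c * w x) = (\<integral>\<^sup>+z. ennreal (1 / t) * (ennreal (\<bar>w (fst z) - w (snd z)\<bar> powr p) * indicator (U \<times> U) z) \<partial>gagliardo_measure s p)"
        unfolding gagliardo_pow_def eq using t
        by (intro nn_integral_cong) (simp add: mult.assoc[symmetric] flip: ennreal_mult)
      also have "\<dots> = ennreal (1 / t) * gagliardo_pow s p U w"
        unfolding gagliardo_pow_def by (rule nn_integral_cmult) simp
      also have "\<dots> \<le> ennreal (1 / t) * ennreal t" by (intro mult_left_mono wE) auto
      finally show ?thesis by (simp only: t1)
    qed
    have 3: "Lp_pow_on q \<Omega> (\<lambda>x. c * w x) \<le> ennreal C"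
      by (rule C(2)[OF _ 1 2]) measurable
    have eq: "\<bar>w x\<bar> powr q = t powr (q / p) * \<bar>c * w x\<bar> powr q" for x
    proof -
      have "t powr (q / p) * \<bar>c * w x\<bar> powr q = t powr (q / p) * t powr (- (q / p)) * \<bar>w x\<bar> powr q"
        using t by (simp add: c_def abs_mult powr_mult powr_powr)
      also have "t powr (q / p) * t powr (- (q / p)) = 1" using t by (simp flip: powr_add)
      finally show ?thesis by simp
    qed
    have "Lp_pow_on q \<Omega> w = (\<integral>\<^sup>+x. ennreal (t powr (q / p)) * (ennreal (\<bar>c * w x\<bar> powr q) * indicator \<Omega> x) \<partial>lebesgue)"
      unfolding eq by (intro nn_integral_cong) (simp add: ennreal_mult mult.assoc)
    also have "\<dots> = ennreal (t powr (q / p)) * Lp_pow_on q \<Omega> (\<lambda>x. c * w x)"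
      by (rule nn_integral_cmult) measurable
    also have "\<dots> \<le> ennreal (t powr (q / p)) * ennreal C" by (intro mult_left_mono 3) auto
    also have "\<dots> = ennreal (C * t powr (q / p))" using C(1) by (simp add: mult.commute flip: ennreal_mult)
    finally show "Lp_pow_on q \<Omega> w \<le> ennreal (C * t powr (q / p))" .
  qed
qed

text \<open>Cubes that are small compared to the distance from \<open>closure \<Omega>\<close> to the complement of \<open>U\<close> stay inside \<open>U\<close>.\<close>

lemma fractional_embedding_local:
  fixes \<Omega> U :: "(real ^ 'n) set"
  assumes "open \<Omega>" "bounded \<Omega>" "open U" "closure \<Omega> \<subseteq> U"
    and p: "p \<ge> 1" "s > 0" and N: "real CARD('n) > p * s"
    and q: "p \<le> q" "q < real CARD('n) * p / (real CARD('n) - p * s)"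
    and u [measurable]: "u \<in> borel_measurable lebesgue" and uU: "u \<in> frac_sobolev s p U"
  shows "Lp_pow_on q \<Omega> u < \<infinity>"
proof -
  have sets: "\<Omega> \<in> sets lebesgue" "U \<in> sets lebesgue" using assms(1,3) by auto
  have em: "emeasure lebesgue \<Omega> < \<infinity>" using emeasure_bounded_finite[OF assms(2)] assms(1) by simp
  obtain k0 where k0: "\<And>x. x \<in> \<Omega> \<Longrightarrow> dyadic_cell k0 x \<subseteq> U"
    using dyadic_cell_small[OF assms(2-4)] by blast
  obtain C where C: "C \<ge> 0"
    "\<And>w t. w \<in> borel_measurable lebesgue \<Longrightarrow> t > 0 \<Longrightarrow> Lp_pow_on p U w \<le> ennreal t \<Longrightarrow>
      gagliardo_pow s p U w \<le> ennreal t \<Longrightarrow> Lp_pow_on q \<Omega> w \<le> ennreal (C * t powr (q / p))"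
    using fractional_embedding[OF sets(1) em sets(2) p N q k0] by blast
  have fin: "Lp_pow_on p U u < \<infinity>" "gagliardo_pow s p U u < \<infinity>"
    using uU sets by (auto simp: frac_sobolev_iff)
  obtain a where a: "a \<ge> 0" "Lp_pow_on p U u = ennreal a"
    using fin(1) by (cases "Lp_pow_on p U u") auto
  obtain e where e: "e \<ge> 0" "gagliardo_pow s p U u = ennreal e"
    using fin(2) by (cases "gagliardo_pow s p U u") auto
  have "Lp_pow_on q \<Omega> u \<le> ennreal (C * (1 + a + e) powr (q / p))"
    by (rule C(2)[OF u]) (use a e in auto)
  also have "\<dots> < \<infinity>" by simp
  finally show ?thesis .
qed

lemma fractional_embedding_0:
  fixes \<Omega> :: "(real ^ 'n) set"
  assumes "open \<Omega>" "bounded \<Omega>"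
    and p: "p \<ge> 1" "s > 0" and N: "real CARD('n) > p * s"
    and q: "p \<le> q" "q < real CARD('n) * p / (real CARD('n) - p * s)"
  obtains C where "C \<ge> 0"
    "\<And>u t. u \<in> frac_sobolev_0 s p \<Omega> \<Longrightarrow> t > 0 \<Longrightarrow> gagliardo_pow s p UNIV u \<le> ennreal t \<Longrightarrow>
      Lp_pow q u \<le> ennreal (C * t powr (q / p))"
proof -
  have sets: "\<Omega> \<in> sets lebesgue" using assms(1) by auto
  have em: "emeasure lebesgue \<Omega> < \<infinity>" using emeasure_bounded_finite[OF assms(2)] assms(1) by simp
  have p0: "p \<ge> 0" "s \<ge> 0" using p by auto
  have UNIV_sets: "(UNIV :: (real ^ 'n) set) \<in> sets lebesgue" by simp
  obtain C where C: "C \<ge> 0"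
    "\<And>w t. w \<in> borel_measurable lebesgue \<Longrightarrow> t > 0 \<Longrightarrow> Lp_pow_on p UNIV w \<le> ennreal t \<Longrightarrow>
      gagliardo_pow s p UNIV w \<le> ennreal t \<Longrightarrow> Lp_pow_on q \<Omega> w \<le> ennreal (C * t powr (q / p))"
    using fractional_embedding[OF sets em UNIV_sets p N q, of 0, OF subset_UNIV] by blast
  obtain P where P: "P > 0"
    "\<And>u. u \<in> frac_sobolev_0 s p \<Omega> \<Longrightarrow> Lp_pow p u \<le> ennreal P * gagliardo_pow s p UNIV u"
    using fractional_poincare[OF assms(2) p0] by blast
  show thesis
  proof (rule that[of "C * (1 + P) powr (q / p)"])
    show "0 \<le> C * (1 + P) powr (q / p)" using C(1) by simp
    fix u :: "real ^ 'n \<Rightarrow> real" and t :: real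
    assume u: "u \<in> frac_sobolev_0 s p \<Omega>" and t: "t > 0" and E: "gagliardo_pow s p UNIV u \<le> ennreal t"
    have "Lp_pow p u \<le> ennreal P * ennreal t"
      by (rule order_trans[OF P(2)[OF u]]) (intro mult_left_mono E, simp)
    also have "\<dots> = ennreal (P * t)" using P(1) t by (simp flip: ennreal_mult)
    also have "\<dots> \<le> ennreal ((1 + P) * t)" using P(1) t by (intro ennreal_leI) (simp add: algebra_simps)
    finally have 1: "Lp_pow_on p UNIV u \<le> ennreal ((1 + P) * t)" by simp
    have 2: "gagliardo_pow s p UNIV u \<le> ennreal ((1 + P) * t)"
      by (rule order_trans[OF E]) (use P(1) t in \<open>auto intro!: ennreal_leI simp: algebra_simps\<close>)
    have "AE x in lebesgue. x \<notin> \<Omega> \<longrightarrow> u x = 0" using u by (simp add: frac_sobolev_0_def)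
    then have "Lp_pow q u = Lp_pow_on q \<Omega> u"
      by (intro nn_integral_cong_AE) (auto simp: indicator_def)
    also have "\<dots> \<le> ennreal (C * ((1 + P) * t) powr (q / p))"
      by (rule C(2)[OF measurable_frac_sobolev_0[OF u] _ 1 2]) (use P(1) t in simp)
    also have "C * ((1 + P) * t) powr (q / p) = C * (1 + P) powr (q / p) * t powr (q / p)"
      using P(1) t by (simp add: powr_mult)
    finally show "Lp_pow q u \<le> ennreal (C * (1 + P) powr (q / p) * t powr (q / p))" .
  qed
qed

section \<open>Compactness\<close>

lemma dyadic_avg_cong_cell: "y \<in> dyadic_cell k x \<Longrightarrow> dyadic_avg k w y = dyadic_avg k w x"
  by (simp add: dyadic_avg_def dyadic_cell_eq)

text \<open>For each generation \<open>k\<close> the average is a function of one of countably many cubes, so a diagonal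
  argument makes all averages converge at once.\<close>

lemma dyadic_avg_convergent_subsequence:
  fixes u :: "nat \<Rightarrow> real ^ 'n \<Rightarrow> real"
  assumes bnd: "\<And>n k x. \<bar>dyadic_avg k (u n) x\<bar> \<le> K k"
  obtains r where "strict_mono r" "\<And>k x. \<exists>l. (\<lambda>n. dyadic_avg k (u (r n)) x) \<longlonglongrightarrow> l"
proof -
  define rep :: "nat \<Rightarrow> ('n \<Rightarrow> int) \<Rightarrow> real ^ 'n" where "rep k m = (\<chi> i. real_of_int (m i) / 2 ^ k)" for k m
  have rep: "dyadic_avg k w (rep k (dyadic_index k x)) = dyadic_avg k w x" for k w x
    by (rule dyadic_avg_cong_cell) (simp add: dyadic_cell_def dyadic_index_def rep_def fun_eq_iff)
  define f where "f n = (\<lambda>(k, m). dyadic_avg k (u n) (rep k m) / (1 + K k))" for n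
  have K: "K k \<ge> 0" for k using bnd[of k undefined undefined] by linarith
  have f1: "norm (f n z) \<le> 1" for n z
  proof -
    obtain k m where z: "z = (k, m)" by (cases z)
    have "\<bar>dyadic_avg k (u n) (rep k m)\<bar> \<le> 1 + K k" using bnd[of k n "rep k m"] by linarith
    then show ?thesis using K[of k] by (simp add: f_def z abs_divide)
  qed
  obtain r where r: "strict_mono r" "\<And>z. z \<in> UNIV \<Longrightarrow> \<exists>l. (\<lambda>n. f (r n) z) \<longlonglongrightarrow> l"
    using function_convergent_subsequence[of UNIV f 1] f1 by (metis countableI_type)
  show thesis
  proof (rule that[OF r(1)])
    fix k x
    obtain l where "(\<lambda>n. f (r n) (k, dyadic_index k x)) \<longlonglongrightarrow> l" using r(2) by blast
    then have "(\<lambda>n. (1 + K k) * f (r n) (k, dyadic_index k x)) \<longlonglongrightarrow> (1 + K k) * l" by (rule tendsto_mult_left)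
    moreover have "(1 + K k) * f (r n) (k, dyadic_index k x) = dyadic_avg k (u (r n)) x" for n
      using K[of k] by (simp add: f_def rep)
    ultimately show "\<exists>l. (\<lambda>n. dyadic_avg k (u (r n)) x) \<longlonglongrightarrow> l" by auto
  qed
qed

lemma integrable_of_powr_integrable:
  fixes u :: "'a \<Rightarrow> real"
  assumes [measurable]: "u \<in> borel_measurable M" and "finite_measure M" and p: "p \<ge> 1"
    and fin: "(\<integral>\<^sup>+x. ennreal (\<bar>u x\<bar> powr p) \<partial>M) < \<infinity>"
  shows "integrable M u"
proof -
  interpret finite_measure M by fact
  have "integrable M (\<lambda>x. \<bar>u x\<bar> powr p)" by (rule integrableI_bounded) (use fin in auto)
  then have "integrable M (\<lambda>x. 1 + \<bar>u x\<bar> powr p)" by simp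
  then show ?thesis
    by (rule Bochner_Integration.integrable_bound) (use le_level_plus_powr[of "\<bar>_\<bar>" 1 p] p in auto)
qed

text \<open>The fractional Rellich theorem. Averages over small cubes approximate in \<open>L\<^sup>1(\<Omega>)\<close>, uniformly on
  sets of bounded energy, and for a fixed size of the cubes the averages of a subsequence converge in \<open>L\<^sup>1(\<Omega>)\<close> by dominated
  convergence. So the subsequence is Cauchy in \<open>L\<^sup>1(\<Omega>)\<close>.\<close>

lemma fractional_rellich:
  fixes \<Omega> :: "(real ^ 'n) set" and u :: "nat \<Rightarrow> real ^ 'n \<Rightarrow> real"
  assumes \<Omega>: "open \<Omega>" "bounded \<Omega>" and p: "p \<ge> 1" "s > 0"
    and u: "\<And>n. u n \<in> frac_sobolev_0 s p \<Omega>" and E: "\<And>n. gagliardo_pow s p UNIV (u n) \<le> ennreal B"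
  obtains r w where "strict_mono r" "w \<in> borel_measurable lebesgue" "AE x in lebesgue. (\<lambda>n. u (r n) x) \<longlonglongrightarrow> w x"
proof -
  let ?N = "real CARD('n)"
  have sets [measurable]: "\<Omega> \<in> sets lebesgue" using \<Omega>(1) by auto
  have em: "emeasure lebesgue \<Omega> < \<infinity>" using emeasure_bounded_finite[OF \<Omega>(2)] \<Omega>(1) by simp
  have um [measurable]: "u n \<in> borel_measurable lebesgue" for n using u by (rule measurable_frac_sobolev_0)
  have p0: "p \<ge> 0" "s \<ge> 0" and ps: "p * s > 0" using p by auto
  obtain P where P: "P > 0"
    "\<And>u. u \<in> frac_sobolev_0 s p \<Omega> \<Longrightarrow> Lp_pow p u \<le> ennreal P * gagliardo_pow s p UNIV u"
    using fractional_poincare[OF \<Omega>(2) p0] by blast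
  define b where "b = max B 0"
  have b: "b \<ge> 0" and Eb: "gagliardo_pow s p UNIV (u n) \<le> ennreal b" for n
    using E[of n] by (auto simp: b_def max_def ennreal_neg)
  have Lp: "Lp_pow p (u n) \<le> ennreal (P * b)" for n
  proof -
    have "Lp_pow p (u n) \<le> ennreal P * ennreal b"
      by (rule order_trans[OF P(2)[OF u]]) (intro mult_left_mono Eb, simp)
    then show ?thesis using P(1) b by (simp add: ennreal_mult)
  qed
  define K where "K k = 1 + 2 powr p * 2 powr (real k * ?N) * (P * b)" for k :: nat
  have avgK: "\<bar>dyadic_avg k (u n) x\<bar> \<le> K k" for n k x
  proof -
    let ?D = "2 powr p * 2 powr (real k * ?N)"
    have "ennreal (\<bar>dyadic_avg k (u n) x\<bar> powr p) \<le> ennreal ?D * (\<integral>\<^sup>+y. ennreal (\<bar>u n y\<bar> powr p) * indicator (dyadic_cell k x) y \<partial>lebesgue)"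
      using dyadic_avg_diff_powr_le[OF um p(1), of k n x 0] by simp
    also have "\<dots> \<le> ennreal ?D * Lp_pow p (u n)"
      by (intro mult_left_mono nn_integral_mono) (auto simp: indicator_def)
    also have "\<dots> \<le> ennreal ?D * ennreal (P * b)" by (intro mult_left_mono Lp) auto
    also have "\<dots> = ennreal (?D * (P * b))" using P(1) b by (simp flip: ennreal_mult)
    finally have "\<bar>dyadic_avg k (u n) x\<bar> powr p \<le> ?D * (P * b)"
      using P(1) b by (subst (asm) ennreal_le_iff) auto
    then show ?thesis using le_level_plus_powr[of "\<bar>dyadic_avg k (u n) x\<bar>" 1 p] p by (simp add: K_def)
  qed
  obtain r where r: "strict_mono r" "\<And>k x. \<exists>l. (\<lambda>n. dyadic_avg k (u (r n)) x) \<longlonglongrightarrow> l"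
    using dyadic_avg_convergent_subsequence[of u K, OF avgK] by blast
  define l where "l k x = lim (\<lambda>n. dyadic_avg k (u (r n)) x)" for k x
  have l: "(\<lambda>n. dyadic_avg k (u (r n)) x) \<longlonglongrightarrow> l k x" for k x
    unfolding l_def using r(2) by (metis convergent_LIMSEQ_iff convergentI)
  have lm [measurable]: "l k \<in> borel_measurable lebesgue" for k
    by (rule borel_measurable_LIMSEQ_real[OF l]) measurable
  have lK: "\<bar>l k x\<bar> \<le> K k" for k x
    by (rule LIMSEQ_le_const2[OF tendsto_rabs[OF l]]) (use avgK in auto)
  define v where "v n = u (r n)" for n
  have vm [measurable]: "v n \<in> borel_measurable lebesgue" for n by (simp add: v_def)
  have avgKv: "\<bar>dyadic_avg k (v n) x\<bar> \<le> K k" for n k x unfolding v_def by (rule avgK)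
  let ?M = "lebesgue_on \<Omega>"
  interpret M: finite_measure ?M
    by (rule finite_measureI) (use em in \<open>simp add: emeasure_restrict_space\<close>)
  have vm' [measurable]: "v n \<in> borel_measurable ?M" for n by (simp add: measurable_restrict_space1)
  have am' [measurable]: "dyadic_avg k (v n) \<in> borel_measurable ?M" for n k
    by (intro measurable_restrict_space1 measurable_dyadic_avg vm)
  have lm' [measurable]: "l k \<in> borel_measurable ?M" for k by (simp add: measurable_restrict_space1)
  have vi: "integrable ?M (v n)" for n
  proof (rule integrable_of_powr_integrable[OF vm' M.finite_measure_axioms p(1)])
    have "(\<integral>\<^sup>+x. ennreal (\<bar>v n x\<bar> powr p) \<partial>?M) \<le> Lp_pow p (v n)"
      by (subst nn_integral_restrict_space) (auto intro!: nn_integral_mono simp: indicator_def)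
    also have "\<dots> < \<infinity>" using Lp[of "r n"] by (auto simp: v_def intro: le_less_trans)
    finally show "(\<integral>\<^sup>+x. ennreal (\<bar>v n x\<bar> powr p) \<partial>?M) < \<infinity>" .
  qed
  have ai: "integrable ?M (dyadic_avg k (v n))" for k n
    by (rule M.integrable_const_bound[of _ "K k"]) (use avgKv in auto)
  have li: "integrable ?M (l k)" for k
    by (rule M.integrable_const_bound[of _ "K k"]) (use lK in auto)
  define m where "m = measure lebesgue \<Omega>"
  define C where "C = 2 powr p * ?N powr (?N + p * s) * b"
  have C: "C \<ge> 0" using b by (simp add: C_def)
  have approx: "(\<integral>x. \<bar>dyadic_avg k (v n) x - v n x\<bar> \<partial>?M) \<le> h * m + h powr (1 - p) * (C * 2 powr (- (real k * (p * s))))"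
    if h: "h > 0" for h k n
  proof -
    let ?d = "\<lambda>x. \<bar>dyadic_avg k (v n) x - v n x\<bar>"
    have "(\<integral>\<^sup>+x. ennreal (?d x powr p) * indicator \<Omega> x \<partial>lebesgue) \<le>
      ennreal (2 powr p * ?N powr (?N + p * s) * 2 powr (- (real k * (p * s)))) * gagliardo_pow s p UNIV (v n)"
      by (rule dyadic_avg_error[OF vm sets _ p(1) p0(2)]) auto
    also have "\<dots> \<le> ennreal (2 powr p * ?N powr (?N + p * s) * 2 powr (- (real k * (p * s)))) * ennreal b"
      unfolding v_def by (intro mult_left_mono Eb) auto
    also have "\<dots> = ennreal (C * 2 powr (- (real k * (p * s))))"
      using b by (simp add: C_def mult_ac flip: ennreal_mult)
    finally have 1: "(\<integral>\<^sup>+x. ennreal (?d x powr p) * indicator \<Omega> x \<partial>lebesgue) \<le> ennreal (C * 2 powr (- (real k * (p * s))))" .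
    have "ennreal (\<integral>x. ?d x \<partial>?M) = (\<integral>\<^sup>+x. ennreal (?d x) \<partial>?M)"
      using vi ai by (intro nn_integral_eq_integral[symmetric]) auto
    also have "\<dots> = (\<integral>\<^sup>+x. ennreal (?d x) * indicator \<Omega> x \<partial>lebesgue)"
      by (subst nn_integral_restrict_space) auto
    also have "\<dots> \<le> (\<integral>\<^sup>+x. ennreal h * indicator \<Omega> x + ennreal (h powr (1 - p)) * (ennreal (?d x powr p) * indicator \<Omega> x) \<partial>lebesgue)"
    proof (rule nn_integral_mono)
      fix x
      have "ennreal (?d x) \<le> ennreal (h + h powr (1 - p) * ?d x powr p)"
        using le_level_plus_powr[of "?d x" h p] h p by (intro ennreal_leI) auto
      then show "ennreal (?d x) * indicator \<Omega> x \<le> ennreal h * indicator \<Omega> x + ennreal (h powr (1 - p)) * (ennreal (?d x powr p) * indicator \<Omega> x)"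
        using h by (auto simp: indicator_def ennreal_plus ennreal_mult)
    qed
    also have "\<dots> = ennreal h * emeasure lebesgue \<Omega> + ennreal (h powr (1 - p)) * (\<integral>\<^sup>+x. ennreal (?d x powr p) * indicator \<Omega> x \<partial>lebesgue)"
      by (simp add: nn_integral_add nn_integral_cmult nn_integral_cmult_indicator)
    also have "\<dots> \<le> ennreal h * emeasure lebesgue \<Omega> + ennreal (h powr (1 - p)) * ennreal (C * 2 powr (- (real k * (p * s))))"
      by (intro add_left_mono mult_left_mono 1) auto
    also have "emeasure lebesgue \<Omega> = ennreal m"
      unfolding m_def using em by (intro emeasure_eq_ennreal_measure) auto
    also have "ennreal h * ennreal m + ennreal (h powr (1 - p)) * ennreal (C * 2 powr (- (real k * (p * s))))
      = ennreal (h * m + h powr (1 - p) * (C * 2 powr (- (real k * (p * s)))))"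
      using h C by (simp add: ennreal_mult ennreal_plus m_def)
    finally show ?thesis
      using h C by (subst (asm) ennreal_le_iff) (auto simp: m_def)
  qed
  have conv: "(\<lambda>n. \<integral>x. \<bar>dyadic_avg k (v n) x - l k x\<bar> \<partial>?M) \<longlonglongrightarrow> 0" for k
  proof -
    have "(\<lambda>n. \<integral>x. \<bar>dyadic_avg k (v n) x - l k x\<bar> \<partial>?M) \<longlonglongrightarrow> (\<integral>x. 0 \<partial>?M)"
    proof (rule integral_dominated_convergence[where w="\<lambda>x. 2 * K k"])
      show "AE x in ?M. (\<lambda>n. \<bar>dyadic_avg k (v n) x - l k x\<bar>) \<longlonglongrightarrow> 0"
        using l by (intro AE_I2) (simp add: v_def tendsto_rabs_zero_iff LIM_zero)
      show "AE x in ?M. norm \<bar>dyadic_avg k (v n) x - l k x\<bar> \<le> 2 * K k" for n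
      proof (rule AE_I2)
        fix x
        show "norm \<bar>dyadic_avg k (v n) x - l k x\<bar> \<le> 2 * K k"
          using avgK[of k "r n" x] lK[of k x] unfolding v_def real_norm_def by linarith
      qed
    qed auto
    then show ?thesis by simp
  qed
  have cauchy: "\<exists>N. \<forall>i\<ge>N. \<forall>j\<ge>N. (\<integral>x. norm (v i x - v j x) \<partial>?M) < e" if e: "e > 0" for e
  proof -
    \<comment> \<open>The level \<open>h\<close> is chosen before the generation \<open>k\<close>, which has to beat \<open>h powr (1 - p)\<close>.\<close>
    define h where "h = e / (8 * (m + 1))"
    have m0: "m \<ge> 0" by (simp add: m_def)
    have h: "h > 0" using e m0 by (simp add: h_def)
    have hm: "h * m < e / 8" using e m0 by (simp add: h_def field_simps)
    have "(\<lambda>k. h powr (1 - p) * (C * (2 powr (- (p * s))) ^ k)) \<longlonglongrightarrow> h powr (1 - p) * (C * 0)"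
      using ps powr_less_mono[of "- (p * s)" 0 "2::real"] by (intro tendsto_intros LIMSEQ_realpow_zero) auto
    then have "eventually (\<lambda>k. h powr (1 - p) * (C * (2 powr (- (p * s))) ^ k) < e / 8) sequentially"
      using e by (intro order_tendstoD(2)) auto
    then obtain k where k: "h powr (1 - p) * (C * (2 powr (- (p * s))) ^ k) < e / 8"
      by (auto simp: eventually_sequentially)
    have "(2 powr (- (p * s))) ^ k = (2::real) powr (- (real k * (p * s)))" by (simp add: powr_power mult.commute)
    with k have k: "h powr (1 - p) * (C * 2 powr (- (real k * (p * s)))) < e / 8" by simp
    have ap: "(\<integral>x. \<bar>dyadic_avg k (v n) x - v n x\<bar> \<partial>?M) < e / 4" for n
      using approx[OF h, of k n] hm k by linarith
    have "eventually (\<lambda>n. (\<integral>x. \<bar>dyadic_avg k (v n) x - l k x\<bar> \<partial>?M) < e / 4) sequentially"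
      using conv[of k] e by (intro order_tendstoD(2)) auto
    then obtain N where N: "\<And>n. n \<ge> N \<Longrightarrow> (\<integral>x. \<bar>dyadic_avg k (v n) x - l k x\<bar> \<partial>?M) < e / 4"
      by (auto simp: eventually_sequentially)
    show ?thesis
    proof (intro exI allI impI)
      fix i j assume ij: "i \<ge> N" "j \<ge> N"
      let ?a = "\<lambda>n x. \<bar>dyadic_avg k (v n) x - v n x\<bar>" and ?c = "\<lambda>n x. \<bar>dyadic_avg k (v n) x - l k x\<bar>"
      have "(\<integral>x. norm (v i x - v j x) \<partial>?M) \<le> (\<integral>x. (?a i x + ?c i x) + (?a j x + ?c j x) \<partial>?M)"
      proof (rule integral_mono)
        show "integrable ?M (\<lambda>x. norm (v i x - v j x))" using vi by auto
        show "integrable ?M (\<lambda>x. (?a i x + ?c i x) + (?a j x + ?c j x))" using vi ai li by auto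
        show "norm (v i x - v j x) \<le> (?a i x + ?c i x) + (?a j x + ?c j x)" for x
          unfolding real_norm_def by linarith
      qed
      also have "\<dots> = ((\<integral>x. ?a i x \<partial>?M) + (\<integral>x. ?c i x \<partial>?M)) + ((\<integral>x. ?a j x \<partial>?M) + (\<integral>x. ?c j x \<partial>?M))"
        using vi ai li by simp
      also have "\<dots> < e" using ap[of i] ap[of j] N[OF ij(1)] N[OF ij(2)] by linarith
      finally show "(\<integral>x. norm (v i x - v j x) \<partial>?M) < e" .
    qed
  qed
  obtain r' where r': "strict_mono r'" "AE x in ?M. Cauchy (\<lambda>i. v (r' i) x)"
    using cauchy_L1_AE_cauchy_subseq[OF vi cauchy] by blast
  define w where "w x = lim (\<lambda>i. v (r' i) x)" for x
  have wm: "w \<in> borel_measurable lebesgue"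
    unfolding w_def by (rule borel_measurable_lim_metric) measurable
  have "AE x in lebesgue. x \<in> \<Omega> \<longrightarrow> Cauchy (\<lambda>i. v (r' i) x)"
    using r'(2) by (simp add: AE_restrict_space_iff)
  moreover have "AE x in lebesgue. \<forall>n. x \<notin> \<Omega> \<longrightarrow> u n x = 0"
    by (subst AE_all_countable) (use u in \<open>simp add: frac_sobolev_0_def\<close>)
  ultimately have "AE x in lebesgue. (\<lambda>i. v (r' i) x) \<longlonglongrightarrow> w x"
  proof eventually_elim
    case (elim x)
    have "convergent (\<lambda>i. v (r' i) x)"
    proof (cases "x \<in> \<Omega>")
      case True
      then show ?thesis using elim by (simp add: Cauchy_convergent)
    next
      case False
      then show ?thesis using elim by (simp add: v_def convergent_const)
    qed
    then show ?case unfolding w_def by (simp add: convergent_LIMSEQ_iff)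
  qed
  then show thesis
    using that[OF strict_mono_o[OF r(1) r'(1)] wm] by (simp add: v_def)
qed

section \<open>The comparison principle\<close>

lemma frac_sobolev_0_restrict:
  assumes "u \<in> frac_sobolev_0 s p \<Omega>" "U \<in> sets lebesgue"
  shows "u \<in> frac_sobolev s p U"
proof -
  have [measurable]: "u \<in> borel_measurable lebesgue" using assms(1) by (rule measurable_frac_sobolev_0)
  have "Lp_pow_on p U u \<le> Lp_pow p u"
    by (intro nn_integral_mono) (auto simp: indicator_def)
  also have "\<dots> < \<infinity>" using assms(1) by (simp add: frac_sobolev_0_iff)
  finally have 1: "Lp_pow_on p U u < \<infinity>" .
  have "gagliardo_pow s p U u \<le> gagliardo_pow s p UNIV u" by (rule gagliardo_pow_mono) simp
  also have "\<dots> < \<infinity>" using assms(1) by (simp add: frac_sobolev_0_iff)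
  finally show ?thesis using 1 assms(2) by (simp add: frac_sobolev_iff)
qed

text \<open>These are the test functions of the comparison argument.\<close>

lemma frac_sobolev_0_pos_part_diff:
  fixes \<Omega> U :: "(real ^ 'n) set"
  assumes \<Omega>: "open \<Omega>" "bounded \<Omega>" and U: "open U" "closure \<Omega> \<subseteq> U" and p: "p > 0" "s > 0"
    and [measurable]: "a \<in> borel_measurable lebesgue" "b \<in> borel_measurable lebesgue"
    and aU: "a \<in> frac_sobolev s p U" and bU: "b \<in> frac_sobolev s p U"
    and ae: "AE x in lebesgue. x \<notin> \<Omega> \<longrightarrow> a x \<le> b x"
  shows "(\<lambda>x. max 0 (a x - b x)) \<in> frac_sobolev_0 s p \<Omega>"
proof (rule frac_sobolev_0_of_local[OF \<Omega> U p])
  show "(\<lambda>x. max 0 (a x - b x)) \<in> borel_measurable lebesgue" by measurable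
  show "AE x in lebesgue. x \<notin> \<Omega> \<longrightarrow> max 0 (a x - b x) = 0"
    using ae by eventually_elim simp
  show "(\<lambda>x. max 0 (a x - b x)) \<in> frac_sobolev s p U"
    by (rule frac_sobolev_le_add[OF _ _ _ _ _ aU bU]) (use U p in auto)
qed

text \<open>
  The operator is strictly monotone: in the difference of the two pairings the integrand is nonnegative.
  Since the integral is not positive, the integrand vanishes almost everywhere. So the test function has vanishing energy, and it is zero by the
  Poincare inequality.
\<close>

lemma fractional_comparison:
  fixes \<Omega> :: "(real ^ 'n) set"
  assumes "bounded \<Omega>" and p: "p > 1" "s \<ge> 0"
    and v: "(\<lambda>x. max 0 (a x - b x)) \<in> frac_sobolev_0 s p \<Omega>"
    and ia: "integrable (gagliardo_measure s p)
      (\<lambda>z. signed_powr p (a (fst z) - a (snd z)) * (max 0 (a (fst z) - b (fst z)) - max 0 (a (snd z) - b (snd z))))"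
    and ib: "integrable (gagliardo_measure s p)
      (\<lambda>z. signed_powr p (b (fst z) - b (snd z)) * (max 0 (a (fst z) - b (fst z)) - max 0 (a (snd z) - b (snd z))))"
    and le: "frac_p_laplacian s p a (\<lambda>x. max 0 (a x - b x)) \<le> frac_p_laplacian s p b (\<lambda>x. max 0 (a x - b x))"
  shows "AE x in lebesgue. a x \<le> b x"
proof -
  define v where "v x = max 0 (a x - b x)" for x
  have v0: "v \<in> frac_sobolev_0 s p \<Omega>" using v by (simp add: v_def[abs_def])
  have [measurable]: "v \<in> borel_measurable lebesgue" using v0 by (rule measurable_frac_sobolev_0)
  define g where "g z = signed_powr p (a (fst z) - a (snd z)) * (v (fst z) - v (snd z))
    - signed_powr p (b (fst z) - b (snd z)) * (v (fst z) - v (snd z))" for z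
  have ig: "integrable (gagliardo_measure s p) g"
    using Bochner_Integration.integrable_diff[OF ia ib] by (simp add: g_def[abs_def] v_def)
  have gpos: "g z \<ge> 0 \<and> (g z = 0 \<longrightarrow> v (fst z) = v (snd z))" for z
  proof -
    let ?c = "a (fst z) - a (snd z)" and ?d = "b (fst z) - b (snd z)" and ?e = "v (fst z) - v (snd z)"
    have g: "g z = (signed_powr p ?c - signed_powr p ?d) * ?e" by (simp add: g_def algebra_simps)
    consider "?c = ?d" | "?c < ?d" | "?c > ?d" by linarith
    then show ?thesis
    proof cases
      case 1
      then have "?e = 0" by (simp add: v_def)
      then show ?thesis by (simp add: g)
    next
      case 2
      then have "signed_powr p ?c < signed_powr p ?d" using p by (intro signed_powr_less) auto
      moreover have "?e \<le> 0" using 2 by (simp add: v_def)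
      ultimately show ?thesis by (simp add: g mult_nonpos_nonpos)
    next
      case 3
      then have "signed_powr p ?c > signed_powr p ?d" using p by (intro signed_powr_less) auto
      moreover have "?e \<ge> 0" using 3 by (simp add: v_def)
      ultimately show ?thesis by (simp add: g)
    qed
  qed
  have "(\<integral>z. g z \<partial>gagliardo_measure s p) = frac_p_laplacian s p a v - frac_p_laplacian s p b v"
    unfolding frac_p_laplacian_eq g_def v_def by (rule Bochner_Integration.integral_diff[OF ia ib])
  also have "\<dots> \<le> 0" using le by (simp add: v_def[abs_def])
  finally have "(\<integral>z. g z \<partial>gagliardo_measure s p) = 0"
    using gpos by (intro antisym integral_nonneg_AE) auto
  then have "AE z in gagliardo_measure s p. g z = 0"
    using integral_nonneg_eq_0_iff_AE[OF ig] gpos by simp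
  then have "AE z in gagliardo_measure s p. ennreal (\<bar>v (fst z) - v (snd z)\<bar> powr p) = 0"
    by eventually_elim (use gpos in auto)
  then have E0: "gagliardo_pow s p UNIV v = 0"
    unfolding gagliardo_pow_UNIV by (subst nn_integral_0_iff_AE) auto
  have p0: "p \<ge> 0" using p by simp
  obtain C where C: "C > 0"
    "\<And>u. u \<in> frac_sobolev_0 s p \<Omega> \<Longrightarrow> Lp_pow p u \<le> ennreal C * gagliardo_pow s p UNIV u"
    using fractional_poincare[OF assms(1) p0 p(2)] by blast
  have "Lp_pow p v = 0" using C(2)[OF v0] E0 by simp
  then have "AE x in lebesgue. ennreal (\<bar>v x\<bar> powr p) = 0" by (subst (asm) nn_integral_0_iff_AE) auto
  then show ?thesis
  proof eventually_elim
    case (elim x)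
    have "\<bar>v x\<bar> powr p \<le> 0" using elim by (simp only: ennreal_eq_0_iff)
    then have "v x = 0" using powr_ge_zero[of "\<bar>v x\<bar>" p] by simp
    then show ?case by (simp add: v_def max_def split: if_splits)
  qed
qed

section \<open>Caratheodory nonlinearities and their primitives\<close>

text \<open>Joint measurability is clear after the second argument has been rounded down to a grid, which takes only countably
  many values; continuity in that argument allows to refine the grid.\<close>

lemma measurable_caratheodory_pair:
  fixes F :: "'a \<Rightarrow> real \<Rightarrow> real"
  assumes F: "\<And>t. (\<lambda>x. F x t) \<in> borel_measurable M" and cont: "\<And>x. continuous_on UNIV (F x)"
  shows "(\<lambda>z. F (fst z) (snd z)) \<in> borel_measurable (M \<Otimes>\<^sub>M borel)"
proof (rule borel_measurable_LIMSEQ_real)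
  fix k :: nat
  show "(\<lambda>z. F (fst z) (real_of_int \<lfloor>real (Suc k) * snd z\<rfloor> / real (Suc k))) \<in> borel_measurable (M \<Otimes>\<^sub>M borel)"
    (is "(\<lambda>z. F (fst z) (?a \<lfloor>_ z\<rfloor>)) \<in> _")
  proof (rule measurable_compose_countable'[where I=UNIV and f="\<lambda>i z. F (fst z) (?a i)"])
    show "(\<lambda>z. F (fst z) (?a i)) \<in> borel_measurable (M \<Otimes>\<^sub>M borel)" for i
      using F by (rule measurable_compose[OF measurable_fst])
    show "(\<lambda>z. \<lfloor>real (Suc k) * snd z\<rfloor>) \<in> measurable (M \<Otimes>\<^sub>M borel) (count_space UNIV)"
      by measurable
  qed simp
next
  fix z :: "'a \<times> real"
  have "(\<lambda>k. real_of_int \<lfloor>real (Suc k) * snd z\<rfloor> / real (Suc k)) \<longlonglongrightarrow> snd z"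
  proof (rule LIMSEQ_I)
    fix e :: real assume "e > 0"
    then obtain n where n: "inverse (real (Suc n)) < e" using reals_Archimedean by blast
    have "norm (real_of_int \<lfloor>real (Suc k) * snd z\<rfloor> / real (Suc k) - snd z) < e" if "k \<ge> n" for k
    proof -
      have "real_of_int \<lfloor>real (Suc k) * snd z\<rfloor> / real (Suc k) - snd z
        = (real_of_int \<lfloor>real (Suc k) * snd z\<rfloor> - real (Suc k) * snd z) / real (Suc k)"
        by (simp add: diff_divide_distrib del: of_nat_Suc)
      also have "norm \<dots> \<le> 1 / real (Suc k)"
        unfolding real_norm_def abs_divide by (intro frac_le) linarith+
      also have "\<dots> \<le> inverse (real (Suc n))" using that by (simp add: field_simps)
      finally show ?thesis using n by linarith
    qed
    then show "\<exists>no. \<forall>k\<ge>no. norm (real_of_int \<lfloor>real (Suc k) * snd z\<rfloor> / real (Suc k) - snd z) < e" by blast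
  qed
  moreover have "isCont (F (fst z)) (snd z)" using cont by (simp add: continuous_on_eq_continuous_at)
  ultimately show "(\<lambda>k. F (fst z) (real_of_int \<lfloor>real (Suc k) * snd z\<rfloor> / real (Suc k))) \<longlonglongrightarrow> F (fst z) (snd z)"
    by (rule isCont_tendsto_compose[rotated])
qed

definition primitive :: "(real \<Rightarrow> real) \<Rightarrow> real \<Rightarrow> real" where
  "primitive \<phi> t = (LBINT y=0..t. \<phi> y)"

lemma primitive_zero [simp]: "primitive \<phi> 0 = 0"
  by (simp add: primitive_def flip: zero_ereal_def)

lemma primitive_has_derivative:
  assumes "continuous_on UNIV \<phi>"
  shows "(primitive \<phi> has_real_derivative \<phi> t) (at t)"
proof -
  have "((\<lambda>u. LBINT y=0..u. \<phi> y) has_vector_derivative \<phi> t) (at t within {min 0 t - 1..max 0 t + 1})"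
    using interval_integral_FTC2[of "min 0 t - 1" 0 "max 0 t + 1" \<phi> t] continuous_on_subset[OF assms]
    by (auto simp: zero_ereal_def min_def max_def)
  moreover have "at t within {min 0 t - 1..max 0 t + 1} = at t"
    by (rule at_within_interior) (auto simp: min_def max_def)
  ultimately show ?thesis
    by (simp add: primitive_def[abs_def] has_real_derivative_iff_has_vector_derivative)
qed

lemma primitive_diff_le:
  assumes "continuous_on UNIV \<phi>" "\<And>t. \<bar>\<phi> t\<bar> \<le> K"
  shows "\<bar>primitive \<phi> t - primitive \<phi> t'\<bar> \<le> K * \<bar>t - t'\<bar>"
  using field_differentiable_bound[of UNIV "primitive \<phi>" \<phi> K t t'] primitive_has_derivative[OF assms(1)] assms(2)
  by simp

lemma measurable_primitive:
  fixes u :: "'a \<Rightarrow> real"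
  assumes g [measurable]: "(\<lambda>z. g (fst z) (snd z)) \<in> borel_measurable (M \<Otimes>\<^sub>M borel)"
    and [measurable]: "u \<in> borel_measurable M"
  shows "(\<lambda>x. primitive (g x) (u x)) \<in> borel_measurable M"
proof -
  have gm [measurable]: "(\<lambda>(x, y). g x y) \<in> borel_measurable (M \<Otimes>\<^sub>M lborel)"
    using g by (simp add: case_prod_beta' cong: measurable_cong_sets)
  have "primitive (g x) (u x) = (if 0 \<le> u x then (\<integral>y. (if 0 < y \<and> y < u x then g x y else 0) \<partial>lborel)
      else - (\<integral>y. (if u x < y \<and> y < 0 then g x y else 0) \<partial>lborel))" for x
    unfolding primitive_def interval_lebesgue_integral_def set_lebesgue_integral_def zero_ereal_def
    by (auto simp: indicator_def intro!: Bochner_Integration.integral_cong)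
  moreover have "(\<lambda>x. if 0 \<le> u x then (\<integral>y. (if 0 < y \<and> y < u x then g x y else 0) \<partial>lborel)
      else - (\<integral>y. (if u x < y \<and> y < 0 then g x y else 0) \<partial>lborel)) \<in> borel_measurable M"
    by measurable
  ultimately show ?thesis by simp
qed

text \<open>The integrand exceeds \<open>\<epsilon> * d powr q\<close> only where \<open>d\<close> is at most a multiple of \<open>h\<close>, and there a multiple of the integrable
  function \<open>h powr q\<close> dominates it. The remainder \<open>\<epsilon> * d powr q\<close> has a small integral by the bound in \<open>L\<^sup>q\<close>.\<close>

lemma weighted_integral_tendsto_0:
  fixes d :: "nat \<Rightarrow> 'a \<Rightarrow> real"
  assumes [measurable]: "h \<in> borel_measurable M" "\<And>n. d n \<in> borel_measurable M"
    and h: "\<And>x. h x \<ge> 0" and d: "\<And>n x. d n x \<ge> 0" and q: "q > 1"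
    and hi: "integrable M (\<lambda>x. h x powr q)" and di: "\<And>n. integrable M (\<lambda>x. d n x powr q)"
    and bound: "\<And>n. (\<integral>x. d n x powr q \<partial>M) \<le> C" and ae: "AE x in M. (\<lambda>n. d n x) \<longlonglongrightarrow> 0"
  shows "(\<lambda>n. \<integral>x. h x powr (q - 1) * d n x \<partial>M) \<longlonglongrightarrow> 0"
proof (rule LIMSEQ_I)
  fix e :: real assume e: "e > 0"
  have "0 \<le> (\<integral>x. d 0 x powr q \<partial>M)" by (intro integral_nonneg_AE) auto
  then have C: "C \<ge> 0" using bound[of 0] by linarith
  define \<epsilon> where "\<epsilon> = e / (2 * (C + 1))"
  have \<epsilon>: "\<epsilon> > 0" using e C by (simp add: \<epsilon>_def)
  have \<epsilon>C: "\<epsilon> * C < e / 2" using e C by (simp add: \<epsilon>_def field_simps)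
  define K where "K = \<epsilon> powr (- (1 / (q - 1)))"
  have K: "K > 0" using \<epsilon> by (simp add: K_def)
  have "K powr (q - 1) = \<epsilon> powr (- (1 / (q - 1)) * (q - 1))" by (simp only: K_def powr_powr)
  also have "- (1 / (q - 1)) * (q - 1) = - 1" using q by simp
  finally have Kq: "K powr (q - 1) = 1 / \<epsilon>" using \<epsilon> by (simp add: powr_minus_divide)
  define r where "r n x = max 0 (h x powr (q - 1) * d n x - \<epsilon> * d n x powr q)" for n x
  have rm [measurable]: "r n \<in> borel_measurable M" for n unfolding r_def[abs_def] by measurable
  have r_le: "r n x \<le> K * h x powr q" for n x
  proof (cases "d n x \<le> K * h x")
    case True
    have "h x powr (q - 1) * d n x \<le> h x powr (q - 1) * (K * h x)" using True by (intro mult_left_mono) auto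
    also have "\<dots> = K * h x powr q"
      using h[of x] powr_add[of "h x" "q - 1" 1] by (cases "h x = 0") auto
    finally have "h x powr (q - 1) * d n x \<le> K * h x powr q" .
    moreover have "\<epsilon> * d n x powr q \<ge> 0" "K * h x powr q \<ge> 0" using \<epsilon> K by auto
    ultimately show ?thesis unfolding r_def by simp
  next
    case False
    then have dp: "d n x > 0" using K h[of x] by (smt (verit) mult_nonneg_nonneg)
    have "K * h x \<le> d n x" using False by simp
    then have "(K * h x) powr (q - 1) \<le> d n x powr (q - 1)" using q K h[of x] by (intro powr_mono2) auto
    moreover have "(K * h x) powr (q - 1) = h x powr (q - 1) / \<epsilon>"
      using K h[of x] by (simp add: powr_mult Kq)
    ultimately have "h x powr (q - 1) \<le> \<epsilon> * d n x powr (q - 1)" using \<epsilon> by (simp add: pos_divide_le_eq mult.commute)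
    then have "h x powr (q - 1) * d n x \<le> \<epsilon> * d n x powr (q - 1) * d n x" using dp by (intro mult_right_mono) auto
    also have "\<dots> = \<epsilon> * d n x powr q" using dp powr_add[of "d n x" "q - 1" 1] by simp
    finally have "r n x = 0" by (simp add: r_def)
    then show ?thesis using K by simp
  qed
  have r0: "r n x \<ge> 0" for n x by (simp add: r_def)
  have ri: "integrable M (r n)" for n
    by (rule Bochner_Integration.integrable_bound[of _ "\<lambda>x. K * h x powr q"])
      (use hi r_le[of n] r0[of n] K in \<open>auto simp: abs_of_nonneg\<close>)
  have "(\<lambda>n. \<integral>x. r n x \<partial>M) \<longlonglongrightarrow> (\<integral>x. 0 \<partial>M)"
  proof (rule integral_dominated_convergence[where w="\<lambda>x. K * h x powr q"])
    show "AE x in M. (\<lambda>n. r n x) \<longlonglongrightarrow> 0"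
      using ae
    proof eventually_elim
      case (elim x)
      have "(\<lambda>n. h x powr (q - 1) * d n x) \<longlonglongrightarrow> h x powr (q - 1) * 0" by (intro tendsto_intros elim)
      then have lim: "(\<lambda>n. h x powr (q - 1) * d n x) \<longlonglongrightarrow> 0" by simp
      have "r n x \<le> h x powr (q - 1) * d n x" for n
        using \<epsilon> d[of n x] by (simp add: r_def)
      then show ?case by (intro tendsto_sandwich[OF _ _ tendsto_const lim]) (auto simp: r0)
    qed
    show "AE x in M. norm (r n x) \<le> K * h x powr q" for n
      using r_le[of n] r0[of n] by (simp add: abs_of_nonneg)
  qed (use hi in auto)
  then have "(\<lambda>n. \<integral>x. r n x \<partial>M) \<longlonglongrightarrow> 0" by simp
  then have "eventually (\<lambda>n. (\<integral>x. r n x \<partial>M) < e / 2) sequentially"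
    using e by (intro order_tendstoD(2)) auto
  then obtain N where N: "\<And>n. n \<ge> N \<Longrightarrow> (\<integral>x. r n x \<partial>M) < e / 2" by (auto simp: eventually_sequentially)
  show "\<exists>N. \<forall>n\<ge>N. norm ((\<integral>x. h x powr (q - 1) * d n x \<partial>M) - 0) < e"
  proof (intro exI allI impI)
    fix n assume n: "n \<ge> N"
    have le: "h x powr (q - 1) * d n x \<le> r n x + \<epsilon> * d n x powr q" for x by (simp add: r_def)
    have i: "integrable M (\<lambda>x. r n x + \<epsilon> * d n x powr q)" using ri di by auto
    have i': "integrable M (\<lambda>x. h x powr (q - 1) * d n x)"
      by (rule Bochner_Integration.integrable_bound[OF i])
        (use d[of n] h in \<open>auto simp: abs_of_nonneg intro!: AE_I2 order_trans[OF le abs_ge_self]\<close>)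
    have "(\<integral>x. h x powr (q - 1) * d n x \<partial>M) \<le> (\<integral>x. r n x + \<epsilon> * d n x powr q \<partial>M)"
      by (rule integral_mono[OF i' i le])
    also have "\<dots> = (\<integral>x. r n x \<partial>M) + \<epsilon> * (\<integral>x. d n x powr q \<partial>M)" using ri di by simp
    also have "\<dots> \<le> (\<integral>x. r n x \<partial>M) + \<epsilon> * C" using \<epsilon> bound[of n] by (intro add_left_mono mult_left_mono) auto
    also have "\<dots> < e" using N[OF n] \<epsilon>C by linarith
    finally have "(\<integral>x. h x powr (q - 1) * d n x \<partial>M) < e" .
    moreover have "(\<integral>x. h x powr (q - 1) * d n x \<partial>M) \<ge> 0" using d by (intro integral_nonneg_AE) auto
    ultimately show "norm ((\<integral>x. h x powr (q - 1) * d n x \<partial>M) - 0) < e" by simp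
  qed
qed

section \<open>Minimization of the energy\<close>

lemma gagliardo_energy_integrable:
  assumes "u \<in> frac_sobolev_0 s p \<Omega>"
  shows "integrable (gagliardo_measure s p) (\<lambda>z. \<bar>u (fst z) - u (snd z)\<bar> powr p)"
    and "gagliardo_pow s p UNIV u = ennreal (\<integral>z. \<bar>u (fst z) - u (snd z)\<bar> powr p \<partial>gagliardo_measure s p)"
proof -
  have [measurable]: "u \<in> borel_measurable lebesgue" using assms by (rule measurable_frac_sobolev_0)
  show i: "integrable (gagliardo_measure s p) (\<lambda>z. \<bar>u (fst z) - u (snd z)\<bar> powr p)"
    by (rule integrableI_bounded) (use assms in \<open>auto simp: frac_sobolev_0_iff gagliardo_pow_UNIV\<close>)
  show "gagliardo_pow s p UNIV u = ennreal (\<integral>z. \<bar>u (fst z) - u (snd z)\<bar> powr p \<partial>gagliardo_measure s p)"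
    unfolding gagliardo_pow_UNIV by (rule nn_integral_eq_integral[OF i]) auto
qed

definition gagliardo_energy :: "real \<Rightarrow> real \<Rightarrow> (real ^ 'n \<Rightarrow> real) \<Rightarrow> real" where
  "gagliardo_energy s p u = (\<integral>z. \<bar>u (fst z) - u (snd z)\<bar> powr p \<partial>gagliardo_measure s p)"

lemma gagliardo_energy_nonneg [simp]: "gagliardo_energy s p u \<ge> 0"
  unfolding gagliardo_energy_def by (rule integral_nonneg_AE) simp

lemma gagliardo_pow_eq_energy:
  "u \<in> frac_sobolev_0 s p \<Omega> \<Longrightarrow> gagliardo_pow s p UNIV u = ennreal (gagliardo_energy s p u)"
  by (simp add: gagliardo_energy_def gagliardo_energy_integrable(2))

text \<open>The energy is convex, and the pairing is its derivative up to the factor \<open>p\<close>.\<close>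

lemma gagliardo_energy_diff_le:
  fixes \<Omega> :: "(real ^ 'n) set"
  assumes p: "p > 1" and u: "u \<in> frac_sobolev_0 s p \<Omega>" and v: "v \<in> frac_sobolev_0 s p \<Omega>"
  shows "gagliardo_energy s p (\<lambda>x. u x + \<theta> * v x) - gagliardo_energy s p u
    \<le> p * \<theta> * frac_p_laplacian s p (\<lambda>x. u x + \<theta> * v x) v"
proof -
  let ?w = "\<lambda>x. u x + \<theta> * v x" and ?M = "gagliardo_measure s p :: ((real ^ 'n) \<times> (real ^ 'n)) measure"
  have p1: "p \<ge> 1" "p \<ge> 0" using p by auto
  have w: "?w \<in> frac_sobolev_0 s p \<Omega>" by (rule frac_sobolev_0_add_scale[OF p1(2) u v])
  note i = gagliardo_energy_integrable(1)[OF w] gagliardo_energy_integrable(1)[OF u]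
  note j = integrable_pairing_frac_sobolev_0[OF p1(1) w v]
  have "gagliardo_energy s p ?w - gagliardo_energy s p u =
    (\<integral>z. \<bar>?w (fst z) - ?w (snd z)\<bar> powr p - \<bar>u (fst z) - u (snd z)\<bar> powr p \<partial>?M)"
    unfolding gagliardo_energy_def by (rule Bochner_Integration.integral_diff[OF i, symmetric])
  also have "\<dots> \<le> (\<integral>z. (p * \<theta>) * (signed_powr p (?w (fst z) - ?w (snd z)) * (v (fst z) - v (snd z))) \<partial>?M)"
  proof (rule integral_mono)
    show "integrable ?M (\<lambda>z. \<bar>?w (fst z) - ?w (snd z)\<bar> powr p - \<bar>u (fst z) - u (snd z)\<bar> powr p)"
      by (rule Bochner_Integration.integrable_diff[OF i])
    show "integrable ?M (\<lambda>z. (p * \<theta>) * (signed_powr p (?w (fst z) - ?w (snd z)) * (v (fst z) - v (snd z))))"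
      by (rule integrable_mult_right[OF j])
    fix z :: "(real ^ 'n) \<times> (real ^ 'n)"
    let ?a = "u (fst z) - u (snd z)" and ?b = "v (fst z) - v (snd z)" and ?c = "?w (fst z) - ?w (snd z)"
    have "?a - ?c = - (\<theta> * ?b)" by (simp add: algebra_simps)
    then show "\<bar>?c\<bar> powr p - \<bar>?a\<bar> powr p \<le> (p * \<theta>) * (signed_powr p ?c * ?b)"
      using powr_tangent[OF p, of ?c ?a] by (simp add: algebra_simps)
  qed
  also have "\<dots> = p * \<theta> * frac_p_laplacian s p ?w v"
    unfolding frac_p_laplacian_eq by (rule integral_mult_right_zero)
  finally show ?thesis .
qed

lemma frac_p_laplacian_tendsto:
  fixes \<Omega> :: "(real ^ 'n) set"
  assumes p: "p \<ge> 2" and u: "u \<in> frac_sobolev_0 s p \<Omega>" and v: "v \<in> frac_sobolev_0 s p \<Omega>"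
    and \<theta>: "\<theta> \<longlonglongrightarrow> 0" "\<And>n. \<bar>\<theta> n\<bar> \<le> 1"
  shows "(\<lambda>n. frac_p_laplacian s p (\<lambda>x. u x + \<theta> n * v x) v) \<longlonglongrightarrow> frac_p_laplacian s p u v"
proof -
  let ?M = "gagliardo_measure s p :: ((real ^ 'n) \<times> (real ^ 'n)) measure"
  let ?a = "\<lambda>z. u (fst z) - u (snd z)" and ?b = "\<lambda>z. v (fst z) - v (snd z)"
  let ?w = "\<lambda>n x. u x + \<theta> n * v x"
  have [measurable]: "u \<in> borel_measurable lebesgue" "v \<in> borel_measurable lebesgue" using u v by (auto intro: measurable_frac_sobolev_0)
  have c: "?w n (fst z) - ?w n (snd z) = ?a z + \<theta> n * ?b z" for n z by (simp add: algebra_simps)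
  have lim: "(\<lambda>n. pairing_integrand p (?w n) v z) \<longlonglongrightarrow> pairing_integrand p u v z" for z
  proof -
    have "(\<lambda>n. ?a z + \<theta> n * ?b z) \<longlonglongrightarrow> ?a z + 0 * ?b z" by (intro tendsto_intros \<theta>)
    then have "(\<lambda>n. ?a z + \<theta> n * ?b z) \<longlonglongrightarrow> ?a z" by simp
    moreover have "isCont (signed_powr p) (?a z)"
      using continuous_on_signed_powr[OF p] by (simp add: continuous_on_eq_continuous_at)
    ultimately have "(\<lambda>n. signed_powr p (?a z + \<theta> n * ?b z)) \<longlonglongrightarrow> signed_powr p (?a z)"
      by (rule isCont_tendsto_compose[rotated])
    then show ?thesis unfolding c by (rule tendsto_mult_right)
  qed
  have bnd: "norm (pairing_integrand p (?w n) v z) \<le> 2 powr p * (\<bar>?a z\<bar> powr p + \<bar>?b z\<bar> powr p) + \<bar>?b z\<bar> powr p" for n z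
  proof -
    have "\<bar>\<theta> n * ?b z\<bar> \<le> 1 * \<bar>?b z\<bar>" unfolding abs_mult by (intro mult_right_mono \<theta>) auto
    moreover have "\<bar>?a z + \<theta> n * ?b z\<bar> \<le> \<bar>?a z\<bar> + \<bar>\<theta> n * ?b z\<bar>" by (rule abs_triangle_ineq)
    ultimately have "\<bar>?a z + \<theta> n * ?b z\<bar> \<le> \<bar>?a z\<bar> + \<bar>?b z\<bar>" by simp
    then have "\<bar>?a z + \<theta> n * ?b z\<bar> powr p \<le> (\<bar>?a z\<bar> + \<bar>?b z\<bar>) powr p" using p by (intro powr_mono2) auto
    also have "\<dots> \<le> 2 powr p * (\<bar>?a z\<bar> powr p + \<bar>?b z\<bar> powr p)" using p by (intro powr_add_le) auto
    finally have "\<bar>?a z + \<theta> n * ?b z\<bar> powr p \<le> 2 powr p * (\<bar>?a z\<bar> powr p + \<bar>?b z\<bar> powr p)" .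
    moreover have "\<bar>signed_powr p (?a z + \<theta> n * ?b z) * ?b z\<bar> \<le> \<bar>?a z + \<theta> n * ?b z\<bar> powr p + \<bar>?b z\<bar> powr p"
      using p by (intro abs_signed_powr_mult_le) auto
    ultimately show ?thesis unfolding real_norm_def c by linarith
  qed
  have int: "integrable ?M (\<lambda>z. 2 powr p * (\<bar>?a z\<bar> powr p + \<bar>?b z\<bar> powr p) + \<bar>?b z\<bar> powr p)"
    using gagliardo_energy_integrable(1)[OF u] gagliardo_energy_integrable(1)[OF v] by auto
  show ?thesis
    unfolding frac_p_laplacian_eq
    by (rule integral_dominated_convergence[OF _ _ int]) (use lim bnd in \<open>auto intro!: AE_I2\<close>)
qed

text \<open>Fatou's lemma, for the energy on the product space and for the \<open>L\<^sup>p\<close> norm.\<close>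

lemma gagliardo_pow_le_liminf:
  fixes u :: "nat \<Rightarrow> real ^ 'n \<Rightarrow> real"
  assumes [measurable]: "\<And>n. u n \<in> borel_measurable lebesgue" "w \<in> borel_measurable lebesgue"
    and p: "p > 0" and ae: "AE x in lebesgue. (\<lambda>n. u n x) \<longlonglongrightarrow> w x"
  shows "gagliardo_pow s p UNIV w \<le> liminf (\<lambda>n. gagliardo_pow s p UNIV (u n))"
    and "Lp_pow p w \<le> liminf (\<lambda>n. Lp_pow p (u n))"
proof -
  have lim: "(\<lambda>n. ennreal (\<bar>a n\<bar> powr p)) \<longlonglongrightarrow> ennreal (\<bar>b\<bar> powr p)" if "a \<longlonglongrightarrow> b" for a :: "nat \<Rightarrow> real" and b
    using that p by (intro tendsto_ennrealI tendsto_powr' tendsto_rabs tendsto_const) auto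
  have "gagliardo_pow s p UNIV w = (\<integral>\<^sup>+z. liminf (\<lambda>n. ennreal (\<bar>u n (fst z) - u n (snd z)\<bar> powr p)) \<partial>gagliardo_measure s p)"
    unfolding gagliardo_pow_UNIV
  proof (rule nn_integral_cong_AE)
    have "AE z in gagliardo_measure s p. (\<lambda>n. u n (fst z)) \<longlonglongrightarrow> w (fst z)" "AE z in gagliardo_measure s p. (\<lambda>n. u n (snd z)) \<longlonglongrightarrow> w (snd z)"
      by (intro AE_gagliardo_measureI AE_lebesgue_fst AE_lebesgue_snd ae)+
    then show "AE z in gagliardo_measure s p. ennreal (\<bar>w (fst z) - w (snd z)\<bar> powr p) =
        liminf (\<lambda>n. ennreal (\<bar>u n (fst z) - u n (snd z)\<bar> powr p))"
    proof eventually_elim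
      case (elim z)
      show ?case by (rule lim_imp_Liminf[symmetric, OF _ lim]) (auto intro!: tendsto_diff elim)
    qed
  qed
  also have "\<dots> \<le> liminf (\<lambda>n. gagliardo_pow s p UNIV (u n))"
    unfolding gagliardo_pow_UNIV by (rule nn_integral_liminf) simp
  finally show "gagliardo_pow s p UNIV w \<le> liminf (\<lambda>n. gagliardo_pow s p UNIV (u n))" .
  have "Lp_pow p w = (\<integral>\<^sup>+x. liminf (\<lambda>n. ennreal (\<bar>u n x\<bar> powr p)) \<partial>lebesgue)"
  proof (rule nn_integral_cong_AE)
    show "AE x in lebesgue. ennreal (\<bar>w x\<bar> powr p) = liminf (\<lambda>n. ennreal (\<bar>u n x\<bar> powr p))"
      using ae
    proof eventually_elim
      case (elim x)
      show ?case by (rule lim_imp_Liminf[symmetric, OF _ lim]) (auto intro!: elim)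
    qed
  qed
  also have "\<dots> \<le> liminf (\<lambda>n. Lp_pow p (u n))"
    by (rule nn_integral_liminf) measurable
  finally show "Lp_pow p w \<le> liminf (\<lambda>n. Lp_pow p (u n))" .
qed

text \<open>
  The functional \<open>gagliardo_energy s p u / p - (\<integral>x. primitive (g x) (u x))\<close> is coercive, because the bound on \<open>g\<close> lets its
  second term grow only like the norm, that is like the \<open>p\<close>-th root of the energy. So a minimizing sequence has
  bounded energy, and a subsequence converges almost everywhere. Along it the first term is lower
  semicontinuous and the second one converges, so the limit is a minimizer. Its
  Euler-Lagrange equation is the claim.
\<close>

lemma exists_weak_solution_dominated:
  fixes \<Omega> :: "(real ^ 'n) set" and g :: "real ^ 'n \<Rightarrow> real \<Rightarrow> real"
  assumes \<Omega>: "open \<Omega>" "bounded \<Omega>" and p: "p \<ge> 2" "s > 0" and N: "real CARD('n) > p * s"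
    and q: "p \<le> q" "q < real CARD('n) * p / (real CARD('n) - p * s)"
    and g [measurable]: "(\<lambda>z. g (fst z) (snd z)) \<in> borel_measurable (lebesgue \<Otimes>\<^sub>M borel)"
    and cont: "\<And>x. continuous_on UNIV (g x)"
    and h [measurable]: "h \<in> borel_measurable lebesgue" and h0: "\<And>x. h x \<ge> 0"
    and gh: "\<And>x t. \<bar>g x t\<bar> \<le> h x powr (q - 1)" and hi: "integrable lebesgue (\<lambda>x. h x powr q)"
  obtains u where "u \<in> frac_sobolev_0 s p \<Omega>"
    "\<And>v. v \<in> frac_sobolev_0 s p \<Omega> \<Longrightarrow> integrable lebesgue (\<lambda>x. g x (u x) * v x)"
    "\<And>v. v \<in> frac_sobolev_0 s p \<Omega> \<Longrightarrow> frac_p_laplacian s p u v = (\<integral>x. g x (u x) * v x \<partial>lebesgue)"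
proof -
  let ?W = "frac_sobolev_0 s p \<Omega>" and ?E = "gagliardo_energy s p"
  have p1: "p \<ge> 1" "p > 1" "p \<ge> 0" "p > 0" and q1: "q > 1" "q \<ge> 1" using p q by auto
  note Wm [measurable_dest] = measurable_frac_sobolev_0[where s=s and p=p and \<Omega>=\<Omega>]
  obtain C where C: "C \<ge> 0"
    "\<And>u t. u \<in> ?W \<Longrightarrow> t > 0 \<Longrightarrow> gagliardo_pow s p UNIV u \<le> ennreal t \<Longrightarrow>
      Lp_pow q u \<le> ennreal (C * t powr (q / p))"
    using fractional_embedding_0[OF \<Omega> p1(1) p(2) N q] by blast
  have Lq: "integrable lebesgue (\<lambda>x. \<bar>u x\<bar> powr q) \<and> (\<integral>x. \<bar>u x\<bar> powr q \<partial>lebesgue) \<le> C * t powr (q / p)"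
    if u: "u \<in> ?W" and t: "t > 0" "?E u \<le> t" for u t
  proof -
    have [measurable]: "u \<in> borel_measurable lebesgue" using u by (rule Wm)
    have le: "Lp_pow q u \<le> ennreal (C * t powr (q / p))"
      by (rule C(2)[OF u t(1)]) (use t in \<open>simp add: gagliardo_pow_eq_energy[OF u] ennreal_leI\<close>)
    have i: "integrable lebesgue (\<lambda>x. \<bar>u x\<bar> powr q)"
      by (rule integrableI_bounded) (use le in \<open>auto intro: le_less_trans\<close>)
    have "ennreal (\<integral>x. \<bar>u x\<bar> powr q \<partial>lebesgue) \<le> ennreal (C * t powr (q / p))"
      using le by (subst (asm) nn_integral_eq_integral[OF i]) auto
    then show ?thesis using i C(1) by (subst (asm) ennreal_le_iff) auto
  qed
  have Lqi: "integrable lebesgue (\<lambda>x. \<bar>u x\<bar> powr q)" if "u \<in> ?W" for u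
    using Lq[OF that, of "1 + ?E u"] by (simp add: add_pos_nonneg)
  have hv: "integrable lebesgue (\<lambda>x. h x powr (q - 1) * \<bar>v x\<bar>)" if v: "v \<in> ?W" for v
  proof (rule Bochner_Integration.integrable_bound[where f="\<lambda>x. h x powr q + \<bar>v x\<bar> powr q"])
    have [measurable]: "v \<in> borel_measurable lebesgue" using v by (rule Wm)
    show "(\<lambda>x. h x powr (q - 1) * \<bar>v x\<bar>) \<in> borel_measurable lebesgue" by measurable
    show "integrable lebesgue (\<lambda>x. h x powr q + \<bar>v x\<bar> powr q)" using hi Lqi[OF v] by simp
    show "AE x in lebesgue. norm (h x powr (q - 1) * \<bar>v x\<bar>) \<le> norm (h x powr q + \<bar>v x\<bar> powr q)"
      using powr_mult_le_sum[of "h _" "\<bar>v _\<bar>" q] h0 q1 by (intro AE_I2) (simp add: abs_mult)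
  qed
  define H where "H = (\<integral>x. h x powr q \<partial>lebesgue)"
  have H: "H \<ge> 0" unfolding H_def by (rule integral_nonneg_AE) simp
  have hv_le: "(\<integral>x. h x powr (q - 1) * \<bar>u x\<bar> \<partial>lebesgue) \<le> t powr (1 / p) * (H + C)"
    if u: "u \<in> ?W" and t: "t > 0" "?E u \<le> t" for u t
  proof -
    define \<tau> where "\<tau> = t powr (1 / p)"
    have \<tau>: "\<tau> > 0" "\<tau> powr q = t powr (q / p)" using t by (auto simp: \<tau>_def powr_powr)
    have "(\<integral>x. h x powr (q - 1) * \<bar>u x\<bar> \<partial>lebesgue) \<le> (\<integral>x. \<tau> * (h x powr q + \<bar>u x\<bar> powr q / \<tau> powr q) \<partial>lebesgue)"
    proof (rule integral_mono[OF hv[OF u]])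
      show "integrable lebesgue (\<lambda>x. \<tau> * (h x powr q + \<bar>u x\<bar> powr q / \<tau> powr q))" using hi Lqi[OF u] by simp
      fix x
      have "h x powr (q - 1) * (\<bar>u x\<bar> / \<tau>) \<le> h x powr q + (\<bar>u x\<bar> / \<tau>) powr q"
        using h0 \<tau> q1 by (intro powr_mult_le_sum) auto
      then have "\<tau> * (h x powr (q - 1) * (\<bar>u x\<bar> / \<tau>)) \<le> \<tau> * (h x powr q + (\<bar>u x\<bar> / \<tau>) powr q)"
        using \<tau> by (intro mult_left_mono) auto
      then show "h x powr (q - 1) * \<bar>u x\<bar> \<le> \<tau> * (h x powr q + \<bar>u x\<bar> powr q / \<tau> powr q)"
        using \<tau> by (simp add: powr_divide)
    qed
    also have "\<dots> = \<tau> * (H + (\<integral>x. \<bar>u x\<bar> powr q \<partial>lebesgue) / \<tau> powr q)"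
      using hi Lqi[OF u] by (simp add: H_def)
    also have "\<dots> \<le> \<tau> * (H + C)"
    proof (intro mult_left_mono add_left_mono)
      show "(\<integral>x. \<bar>u x\<bar> powr q \<partial>lebesgue) / \<tau> powr q \<le> C"
        using Lq[OF u t] \<tau> t by (simp add: divide_le_eq)
    qed (use \<tau> in auto)
    finally show ?thesis by (simp add: \<tau>_def)
  qed
  define G where "G x t = primitive (g x) t" for x t
  have Gm [measurable]: "(\<lambda>x. G x (u x)) \<in> borel_measurable lebesgue" if [measurable]: "u \<in> borel_measurable lebesgue" for u
    unfolding G_def by (rule measurable_primitive) measurable
  have Glip: "\<bar>G x t - G x t'\<bar> \<le> h x powr (q - 1) * \<bar>t - t'\<bar>" for x t t'
    unfolding G_def by (rule primitive_diff_le[OF cont gh])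
  have Gle: "\<bar>G x t\<bar> \<le> h x powr (q - 1) * \<bar>t\<bar>" for x t
    using Glip[of x t 0] by (simp add: G_def)
  have Gi: "integrable lebesgue (\<lambda>x. G x (u x))" if u: "u \<in> ?W" for u
  proof (rule Bochner_Integration.integrable_bound[OF hv[OF u]])
    show "(\<lambda>x. G x (u x)) \<in> borel_measurable lebesgue" using Gm[OF Wm[OF u]] .
    show "AE x in lebesgue. norm (G x (u x)) \<le> norm (h x powr (q - 1) * \<bar>u x\<bar>)"
      using Gle by (intro AE_I2) (simp add: abs_mult)
  qed
  define Q where "Q u = (\<integral>x. G x (u x) \<partial>lebesgue)" for u
  define \<Phi> where "\<Phi> u = ?E u / p - Q u" for u
  have Qle: "\<bar>Q u\<bar> \<le> (1 + ?E u) powr (1 / p) * (H + C)" if u: "u \<in> ?W" for u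
  proof -
    have "\<bar>Q u\<bar> \<le> (\<integral>x. \<bar>G x (u x)\<bar> \<partial>lebesgue)" unfolding Q_def by (rule integral_abs_bound)
    also have "\<dots> \<le> (\<integral>x. h x powr (q - 1) * \<bar>u x\<bar> \<partial>lebesgue)"
      by (rule integral_mono) (use Gi[OF u] hv[OF u] Gle in auto)
    also have "\<dots> \<le> (1 + ?E u) powr (1 / p) * (H + C)" by (rule hv_le[OF u]) (auto simp: add_pos_nonneg)
    finally show ?thesis .
  qed
  \<comment> \<open>The level \<open>L\<close> absorbs half of the energy into the first term of \<open>\<Phi>\<close>.\<close>
  define L where "L = (2 * p * (H + C) + 1) powr (1 / (p - 1))"
  define C2 where "C2 = (H + C) * L + 1 / (2 * p)"
  have base: "2 * p * (H + C) + 1 > 0" using p1 H C(1) by (intro add_nonneg_pos mult_nonneg_nonneg) auto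
  have L: "L > 0" using base by (simp add: L_def)
  have coercive: "?E u / (2 * p) - C2 \<le> \<Phi> u" if u: "u \<in> ?W" for u
  proof -
    let ?t = "1 + ?E u"
    have t: "?t > 0" by (simp add: add_pos_nonneg)
    have "L powr (1 - p) = (2 * p * (H + C) + 1) powr (1 / (p - 1) * (1 - p))" by (simp only: L_def powr_powr)
    also have "1 / (p - 1) * (1 - p) = - 1" using p1 by (simp add: field_simps)
    finally have L1: "L powr (1 - p) = 1 / (2 * p * (H + C) + 1)" using base by (simp add: powr_minus_divide)
    have "(H + C) * (L powr (1 - p)) \<le> 1 / (2 * p)"
      unfolding L1 using base p1 by (simp add: field_simps)
    then have L2: "(H + C) * (L powr (1 - p)) * ?t \<le> 1 / (2 * p) * ?t" using t by (intro mult_right_mono) auto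
    have "(?t powr (1 / p)) powr p = ?t" using t p1 by (simp add: powr_powr)
    then have "?t powr (1 / p) \<le> L + L powr (1 - p) * ?t"
      using le_level_plus_powr[of "?t powr (1 / p)" L p] L p1 by simp
    then have "?t powr (1 / p) * (H + C) \<le> (L + L powr (1 - p) * ?t) * (H + C)"
      using H C(1) by (intro mult_right_mono) auto
    also have "\<dots> = (H + C) * L + (H + C) * (L powr (1 - p)) * ?t" by (simp add: algebra_simps)
    also have "\<dots> \<le> (H + C) * L + 1 / (2 * p) * ?t" using L2 by simp
    also have "\<dots> = C2 + ?E u / (2 * p)" using p1 by (simp add: C2_def field_simps)
    finally have "\<bar>Q u\<bar> \<le> C2 + ?E u / (2 * p)" using Qle[OF u] by linarith
    moreover have "?E u / p = ?E u / (2 * p) + ?E u / (2 * p)" by simp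
    ultimately show ?thesis unfolding \<Phi>_def by linarith
  qed
  define m where "m = Inf (\<Phi> ` ?W)"
  have bdd: "bdd_below (\<Phi> ` ?W)"
  proof (rule bdd_belowI2)
    fix u assume u: "u \<in> ?W"
    have "0 \<le> ?E u / (2 * p)" using p1 by simp
    then show "- C2 \<le> \<Phi> u" using coercive[OF u] by linarith
  qed
  have ne: "\<Phi> ` ?W \<noteq> {}" using zero_frac_sobolev_0 by blast
  have m_le: "m \<le> \<Phi> u" if "u \<in> ?W" for u unfolding m_def using bdd that by (intro cInf_lower) auto
  have "\<exists>u\<in>?W. \<Phi> u < m + 1 / real (Suc n)" for n
    using cInf_lessD[OF ne, of "m + 1 / real (Suc n)"] by (auto simp: m_def)
  then obtain u where u: "\<And>n. u n \<in> ?W" "\<And>n. \<Phi> (u n) < m + 1 / real (Suc n)" by metis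
  define B where "B = 2 * p * (m + 1 + C2)"
  have EB: "?E (u n) \<le> B" for n
  proof -
    have "1 / real (Suc n) \<le> 1" by simp
    then have "?E (u n) / (2 * p) \<le> m + 1 + C2" using coercive[OF u(1)[of n]] u(2)[of n] by linarith
    then show ?thesis using p1 by (simp add: B_def field_simps)
  qed
  have EB': "gagliardo_pow s p UNIV (u n) \<le> ennreal B" for n
    using EB[of n] by (simp add: gagliardo_pow_eq_energy[OF u(1)] ennreal_leI)
  obtain r w where r: "strict_mono r" and wm [measurable]: "w \<in> borel_measurable lebesgue"
    and ae: "AE x in lebesgue. (\<lambda>n. u (r n) x) \<longlonglongrightarrow> w x"
    by (rule fractional_rellich[OF \<Omega> p1(1) p(2) u(1) EB'])
  define v where "v n = u (r n)" for n
  have v: "v n \<in> ?W" and vB: "?E (v n) \<le> B" for n by (auto simp: v_def u EB)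
  have vm [measurable]: "v n \<in> borel_measurable lebesgue" for n using v by (rule Wm)
  have vae: "AE x in lebesgue. (\<lambda>n. v n x) \<longlonglongrightarrow> w x" using ae by (simp add: v_def)
  have vlim: "(\<lambda>n. \<Phi> (v n)) \<longlonglongrightarrow> m"
  proof -
    have "(\<lambda>n. \<Phi> (u n)) \<longlonglongrightarrow> m"
    proof (rule tendsto_sandwich[of "\<lambda>n. m" _ _ "\<lambda>n. m + 1 / real (Suc n)"])
      show "(\<lambda>n. m + 1 / real (Suc n)) \<longlonglongrightarrow> m"
        using tendsto_add[OF tendsto_const LIMSEQ_Suc[OF lim_1_over_n], of m] by simp
    qed (use m_le u in \<open>auto intro!: always_eventually less_imp_le\<close>)
    then show ?thesis using LIMSEQ_subseq_LIMSEQ[OF _ r, of "\<lambda>n. \<Phi> (u n)" m] by (simp add: v_def o_def)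
  qed
  have w: "w \<in> ?W"
  proof -
    obtain P where P: "P > 0"
      "\<And>u. u \<in> ?W \<Longrightarrow> Lp_pow p u \<le> ennreal P * gagliardo_pow s p UNIV u"
      using fractional_poincare[OF \<Omega>(2) p1(3) less_imp_le[OF p(2)]] by blast
    have le: "gagliardo_pow s p UNIV (v n) \<le> ennreal B" for n using EB' by (simp add: v_def)
    have "gagliardo_pow s p UNIV w \<le> liminf (\<lambda>n. gagliardo_pow s p UNIV (v n))"
      by (rule gagliardo_pow_le_liminf(1)[OF vm wm p1(4) vae])
    also have "\<dots> \<le> liminf (\<lambda>n. ennreal B)" by (intro Liminf_mono always_eventually allI le)
    finally have 1: "gagliardo_pow s p UNIV w < \<infinity>" by (simp add: Liminf_const le_less_trans)
    have "Lp_pow p w \<le> liminf (\<lambda>n. Lp_pow p (v n))"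
      by (rule gagliardo_pow_le_liminf(2)[OF vm wm p1(4) vae])
    also have "\<dots> \<le> liminf (\<lambda>n. ennreal P * ennreal B)"
      by (intro Liminf_mono always_eventually allI order_trans[OF P(2)[OF v]] mult_left_mono le) auto
    finally have 2: "Lp_pow p w < \<infinity>"
      by (simp add: Liminf_const le_less_trans ennreal_mult_less_top)
    have "AE x in lebesgue. \<forall>n. x \<notin> \<Omega> \<longrightarrow> v n x = 0"
      by (subst AE_all_countable) (use v in \<open>simp add: frac_sobolev_0_def\<close>)
    with vae have "AE x in lebesgue. x \<notin> \<Omega> \<longrightarrow> w x = 0"
      by eventually_elim (auto intro: LIMSEQ_unique)
    with 1 2 wm show ?thesis by (simp add: frac_sobolev_0_iff)
  qed
  have Qlim: "(\<lambda>n. Q (v n)) \<longlonglongrightarrow> Q w"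
  proof -
    define d where "d n x = \<bar>v n x - w x\<bar>" for n x
    have dW: "(\<lambda>x. v n x - w x) \<in> ?W" for n
      using frac_sobolev_0_add_scale[OF p1(3) v[of n] w, of "- 1"] by simp
    have dm [measurable]: "d n \<in> borel_measurable lebesgue" for n unfolding d_def[abs_def] by measurable
    have dae: "AE x in lebesgue. (\<lambda>n. d n x) \<longlonglongrightarrow> 0"
      using vae by eventually_elim (simp add: d_def tendsto_rabs_zero_iff LIM_zero)
    have di: "integrable lebesgue (\<lambda>x. d n x powr q)" for n unfolding d_def by (rule Lqi[OF dW])
    define t where "t = 1 + max B 0 + ?E w"
    have t: "t > 0" by (simp add: t_def add_pos_nonneg)
    define K where "K = 2 powr q * (C * t powr (q / p) + C * t powr (q / p))"
    have dK: "(\<integral>x. d n x powr q \<partial>lebesgue) \<le> K" for n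
    proof -
      have "(\<integral>x. d n x powr q \<partial>lebesgue) \<le> (\<integral>x. 2 powr q * (\<bar>v n x\<bar> powr q + \<bar>w x\<bar> powr q) \<partial>lebesgue)"
        by (rule integral_mono[OF di])
          (use Lqi[OF v] Lqi[OF w] q1 in \<open>auto simp: d_def intro!: abs_diff_powr_le\<close>)
      also have "\<dots> = 2 powr q * ((\<integral>x. \<bar>v n x\<bar> powr q \<partial>lebesgue) + (\<integral>x. \<bar>w x\<bar> powr q \<partial>lebesgue))"
        using Lqi[OF v] Lqi[OF w] by simp
      also have "\<dots> \<le> K" unfolding K_def
      proof (intro mult_left_mono add_mono)
        have "?E (v n) \<le> t" using vB[of n] gagliardo_energy_nonneg[of s p w] unfolding t_def by linarith
        then show "(\<integral>x. \<bar>v n x\<bar> powr q \<partial>lebesgue) \<le> C * t powr (q / p)" using Lq[OF v t] by blast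
        have "?E w \<le> t" unfolding t_def by linarith
        then show "(\<integral>x. \<bar>w x\<bar> powr q \<partial>lebesgue) \<le> C * t powr (q / p)" using Lq[OF w t] by blast
      qed simp
      finally show ?thesis .
    qed
    have "(\<lambda>n. \<integral>x. h x powr (q - 1) * d n x \<partial>lebesgue) \<longlonglongrightarrow> 0"
      by (rule weighted_integral_tendsto_0[OF h dm h0 _ q1(1) hi di dK dae]) (simp add: d_def)
    moreover have "norm (Q (v n) - Q w) \<le> (\<integral>x. h x powr (q - 1) * d n x \<partial>lebesgue)" for n
    proof -
      have "Q (v n) - Q w = (\<integral>x. G x (v n x) - G x (w x) \<partial>lebesgue)"
        unfolding Q_def by (rule Bochner_Integration.integral_diff[symmetric]) (intro Gi v w)+
      then have "norm (Q (v n) - Q w) \<le> (\<integral>x. \<bar>G x (v n x) - G x (w x)\<bar> \<partial>lebesgue)"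
        by (simp add: integral_abs_bound)
      also have "\<dots> \<le> (\<integral>x. h x powr (q - 1) * d n x \<partial>lebesgue)"
      proof (rule integral_mono)
        show "integrable lebesgue (\<lambda>x. \<bar>G x (v n x) - G x (w x)\<bar>)"
          by (intro Bochner_Integration.integrable_abs Bochner_Integration.integrable_diff Gi v w)
        show "integrable lebesgue (\<lambda>x. h x powr (q - 1) * d n x)" unfolding d_def by (rule hv[OF dW])
        show "\<bar>G x (v n x) - G x (w x)\<bar> \<le> h x powr (q - 1) * d n x" for x unfolding d_def by (rule Glip)
      qed
      finally show ?thesis .
    qed
    ultimately have "(\<lambda>n. Q (v n) - Q w) \<longlonglongrightarrow> 0"
      by (intro Lim_null_comparison[of "\<lambda>n. Q (v n) - Q w"]) (auto intro!: always_eventually)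
    then show ?thesis by (simp add: LIM_zero_iff)
  qed
  have Elim: "(\<lambda>n. ?E (v n)) \<longlonglongrightarrow> p * (m + Q w)"
  proof -
    have "(\<lambda>n. p * (\<Phi> (v n) + Q (v n))) \<longlonglongrightarrow> p * (m + Q w)" by (intro tendsto_intros vlim Qlim)
    moreover have "p * (\<Phi> (v n) + Q (v n)) = ?E (v n)" for n using p1 by (simp add: \<Phi>_def)
    ultimately show ?thesis by simp
  qed
  have "ennreal (?E w) \<le> liminf (\<lambda>n. gagliardo_pow s p UNIV (v n))"
    using gagliardo_pow_le_liminf(1)[OF vm wm p1(4) vae, of s] by (simp add: gagliardo_pow_eq_energy[OF w])
  also have "\<dots> = liminf (\<lambda>n. ennreal (?E (v n)))" by (simp add: gagliardo_pow_eq_energy[OF v])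
  also have "\<dots> = ennreal (p * (m + Q w))"
    by (rule lim_imp_Liminf) (auto intro: tendsto_ennrealI Elim)
  finally have "ennreal (?E w) \<le> ennreal (p * (m + Q w))" .
  moreover have "p * (m + Q w) \<ge> 0" by (rule LIMSEQ_le_const[OF Elim]) auto
  ultimately have "?E w \<le> p * (m + Q w)" by (simp add: ennreal_le_iff)
  then have "\<Phi> w \<le> m" using p1 by (simp add: \<Phi>_def field_simps)
  then have min: "\<Phi> w \<le> \<Phi> v" if "v \<in> ?W" for v using m_le[OF that] by linarith
  have gi: "integrable lebesgue (\<lambda>x. g x (w x) * v x)" if v: "v \<in> ?W" for v
  proof (rule Bochner_Integration.integrable_bound[OF hv[OF v]])
    have [measurable]: "v \<in> borel_measurable lebesgue" using v by (rule Wm)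
    have "(\<lambda>x. g (fst (x, w x)) (snd (x, w x))) \<in> borel_measurable lebesgue"
      by (rule measurable_compose[OF _ g]) measurable
    then show "(\<lambda>x. g x (w x) * v x) \<in> borel_measurable lebesgue" by simp
    show "AE x in lebesgue. norm (g x (w x) * v x) \<le> norm (h x powr (q - 1) * \<bar>v x\<bar>)"
      using gh by (intro AE_I2) (auto simp: abs_mult intro!: mult_right_mono)
  qed
  have ge: "frac_p_laplacian s p w v \<ge> (\<integral>x. g x (w x) * v x \<partial>lebesgue)" if v: "v \<in> ?W" for v
  proof -
    define \<theta> where "\<theta> n = 1 / real (Suc n)" for n
    have \<theta>: "\<theta> \<longlonglongrightarrow> 0" "\<And>n. \<bar>\<theta> n\<bar> \<le> 1" "\<And>n. \<theta> n > 0"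
      unfolding \<theta>_def using LIMSEQ_Suc[OF lim_1_over_n] by auto
    define z where "z n = (\<lambda>x. w x + \<theta> n * v x)" for n
    have zW: "z n \<in> ?W" for n unfolding z_def by (rule frac_sobolev_0_add_scale[OF p1(3) w v])
    have [measurable]: "v \<in> borel_measurable lebesgue" using v by (rule Wm)
    have zm [measurable]: "z n \<in> borel_measurable lebesgue" for n using zW by (rule Wm)
    have "(\<lambda>n. \<integral>x. (G x (z n x) - G x (w x)) / \<theta> n \<partial>lebesgue) \<longlonglongrightarrow> (\<integral>x. g x (w x) * v x \<partial>lebesgue)"
    proof (rule integral_dominated_convergence[where w="\<lambda>x. h x powr (q - 1) * \<bar>v x\<bar>", OF _ _ hv[OF v]])
      show "(\<lambda>x. g x (w x) * v x) \<in> borel_measurable lebesgue" using gi[OF v] by simp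
      show "(\<lambda>x. (G x (z n x) - G x (w x)) / \<theta> n) \<in> borel_measurable lebesgue" for n by measurable
      show "AE x in lebesgue. (\<lambda>n. (G x (z n x) - G x (w x)) / \<theta> n) \<longlonglongrightarrow> g x (w x) * v x"
      proof (rule AE_I2)
        fix x
        have "((\<lambda>t. G x (w x + t * v x)) has_real_derivative g x (w x + 0 * v x) * (0 + 1 * v x)) (at 0)"
          unfolding G_def
          by (rule DERIV_chain2[of "primitive (g x)"], rule primitive_has_derivative[OF cont]) (auto intro!: derivative_eq_intros)
        then have "((\<lambda>t. (G x (w x + t * v x) - G x (w x)) / t) \<longlongrightarrow> g x (w x) * v x) (at 0)"
          by (simp add: has_field_derivative_iff)
        then have "(\<lambda>n. (G x (w x + \<theta> n * v x) - G x (w x)) / \<theta> n) \<longlonglongrightarrow> g x (w x) * v x"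
          by (rule filterlim_compose) (use \<theta> in \<open>auto simp: filterlim_at intro!: always_eventually less_imp_neq[symmetric]\<close>)
        then show "(\<lambda>n. (G x (z n x) - G x (w x)) / \<theta> n) \<longlonglongrightarrow> g x (w x) * v x" by (simp add: z_def)
      qed
      show "AE x in lebesgue. norm ((G x (z n x) - G x (w x)) / \<theta> n) \<le> h x powr (q - 1) * \<bar>v x\<bar>" for n
      proof (rule AE_I2)
        fix x
        have "\<bar>G x (z n x) - G x (w x)\<bar> \<le> h x powr (q - 1) * \<bar>\<theta> n * v x\<bar>"
          using Glip[of x "z n x" "w x"] by (simp add: z_def)
        then show "norm ((G x (z n x) - G x (w x)) / \<theta> n) \<le> h x powr (q - 1) * \<bar>v x\<bar>"
          using \<theta>(3)[of n] by (simp add: abs_mult pos_divide_le_eq mult_ac)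
      qed
    qed
    moreover have "(\<lambda>n. frac_p_laplacian s p (z n) v) \<longlonglongrightarrow> frac_p_laplacian s p w v"
      unfolding z_def by (rule frac_p_laplacian_tendsto[OF p(1) w v \<theta>(1,2)])
    moreover have "(\<integral>x. (G x (z n x) - G x (w x)) / \<theta> n \<partial>lebesgue) \<le> frac_p_laplacian s p (z n) v" for n
    proof -
      have "Q (z n) - Q w = (\<integral>x. G x (z n x) - G x (w x) \<partial>lebesgue)"
        unfolding Q_def by (rule Bochner_Integration.integral_diff[symmetric]) (intro Gi zW w)+
      then have Qd: "(\<integral>x. (G x (z n x) - G x (w x)) / \<theta> n \<partial>lebesgue) = (Q (z n) - Q w) / \<theta> n" by simp
      have "?E (z n) - ?E w \<le> p * \<theta> n * frac_p_laplacian s p (z n) v"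
        unfolding z_def by (rule gagliardo_energy_diff_le[OF p1(2) w v])
      then have "(?E (z n) - ?E w) / p \<le> \<theta> n * frac_p_laplacian s p (z n) v" using p1 by (simp add: pos_divide_le_eq mult_ac)
      moreover have "Q (z n) - Q w \<le> (?E (z n) - ?E w) / p"
        using min[OF zW[of n]] by (simp add: \<Phi>_def diff_divide_distrib)
      ultimately have "Q (z n) - Q w \<le> \<theta> n * frac_p_laplacian s p (z n) v" by linarith
      then show ?thesis unfolding Qd using \<theta>(3)[of n] by (simp add: pos_divide_le_eq mult.commute)
    qed
    ultimately show ?thesis by (intro LIMSEQ_le) auto
  qed
  show thesis
  proof (rule that[OF w gi])
    fix v assume v: "v \<in> ?W"
    have v': "(\<lambda>x. - 1 * v x) \<in> ?W" by (rule frac_sobolev_0_scale[OF v])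
    have "frac_p_laplacian s p w (\<lambda>x. - 1 * v x) = - frac_p_laplacian s p w v"
      unfolding frac_p_laplacian_eq by (subst Bochner_Integration.integral_minus[symmetric]) (simp add: algebra_simps)
    moreover have "(\<integral>x. g x (w x) * (- 1 * v x) \<partial>lebesgue) = - (\<integral>x. g x (w x) * v x \<partial>lebesgue)" by simp
    ultimately show "frac_p_laplacian s p w v = (\<integral>x. g x (w x) * v x \<partial>lebesgue)"
      using ge[OF v] ge[OF v'] by linarith
  qed
qed

section \<open>The method of sub- and supersolutions\<close>

text \<open>The truncation \<open>T x\<close> clamps its argument to the interval from \<open>lo x\<close> to \<open>up x\<close>, and \<open>g\<close> is the truncated nonlinearity. On the set
  where \<open>u\<close> exceeds \<open>up\<close>, that is where the test function \<open>max 0 (u - up)\<close> lives, \<open>T x (u x)\<close> is \<open>up x\<close>. So \<open>u\<close> and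
  \<open>up\<close> are compared with the same right-hand side, and likewise for \<open>lo\<close>.\<close>

lemma exists_solution_between:
  fixes \<Omega> :: "(real ^ 'n) set"
  assumes \<Omega>: "open \<Omega>" "bounded \<Omega>" and p: "p \<ge> 2" "s > 0" and N: "real CARD('n) > p * s"
    and f: "caratheodory \<Omega> f" and c0: "c0 > 0"
    and q: "p < q" "q < real CARD('n) * p / (real CARD('n) - p * s)"
    and growth: "AE x in lebesgue. x \<in> \<Omega> \<longrightarrow> (\<forall>t. \<bar>f x t\<bar> \<le> c0 * (1 + \<bar>t\<bar> powr (q - 1)))"
    and pair: "sub_supersolution_pair s p \<Omega> f lo up"
  shows "\<exists>u. u \<in> solution_set s p \<Omega> f lo up"
proof -
  have p1: "p \<ge> 1" "p > 1" "p > 0" "s \<ge> 0" and q1: "q > 1" "q \<ge> 0" "p \<le> q" using p q by auto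
  have sets_\<Omega> [measurable]: "\<Omega> \<in> sets lebesgue" using \<Omega>(1) by auto
  have em: "emeasure lebesgue \<Omega> < \<infinity>" using emeasure_bounded_finite[OF \<Omega>(2)] \<Omega>(1) by simp
  have lo: "lo \<in> frac_sobolev_tilde s p \<Omega>" "AE x in lebesgue. x \<notin> \<Omega> \<longrightarrow> lo x \<le> 0"
    "\<And>v. v \<in> frac_sobolev_0_nonneg s p \<Omega> \<Longrightarrow> frac_p_laplacian s p lo v \<le> (LINT x:\<Omega>|lebesgue. f x (lo x) * v x)"
    and up: "up \<in> frac_sobolev_tilde s p \<Omega>" "AE x in lebesgue. x \<notin> \<Omega> \<longrightarrow> 0 \<le> up x"
    "\<And>v. v \<in> frac_sobolev_0_nonneg s p \<Omega> \<Longrightarrow> frac_p_laplacian s p up v \<ge> (LINT x:\<Omega>|lebesgue. f x (up x) * v x)"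
    and lo_up: "AE x in lebesgue. x \<in> \<Omega> \<longrightarrow> lo x \<le> up x"
    using pair by (auto simp: sub_supersolution_pair_def subsolution_def supersolution_def)
  have [measurable]: "lo \<in> borel_measurable lebesgue" "up \<in> borel_measurable lebesgue"
    using lo(1) up(1) by (auto intro: measurable_frac_sobolev_tilde)
  obtain V where V: "open V" "closure \<Omega> \<subseteq> V" "lo \<in> frac_sobolev s p V"
    using frac_sobolev_tilde_localE[OF lo(1)] .
  obtain U where U: "open U" "closure \<Omega> \<subseteq> U" "up \<in> frac_sobolev s p U"
    using frac_sobolev_tilde_localE[OF up(1)] .
  have loq: "Lp_pow_on q \<Omega> lo < \<infinity>"
    by (rule fractional_embedding_local[OF \<Omega> V(1,2) p1(1) p(2) N q1(3) q(2) _ V(3)]) measurable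
  have upq: "Lp_pow_on q \<Omega> up < \<infinity>"
    by (rule fractional_embedding_local[OF \<Omega> U(1,2) p1(1) p(2) N q1(3) q(2) _ U(3)]) measurable

  \<comment> \<open>All pointwise hypotheses hold on \<open>A\<close>, which differs from \<open>\<Omega>\<close> by a null set.\<close>
  define A where "A = {x \<in> \<Omega>. continuous_on UNIV (f x) \<and> (\<forall>t. \<bar>f x t\<bar> \<le> c0 * (1 + \<bar>t\<bar> powr (q - 1))) \<and> lo x \<le> up x}"
  have A\<Omega>: "AE x in lebesgue. x \<in> \<Omega> \<longleftrightarrow> x \<in> A"
    using growth lo_up f unfolding caratheodory_def A_def by auto
  have sets_A [measurable]: "A \<in> sets lebesgue"
    by (rule completion.in_sets_AE[OF A\<Omega> sets_\<Omega>]) simp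
  define F where "F x t = (if x \<in> A then f x t else 0)" for x t
  have Fm: "(\<lambda>x. F x t) \<in> borel_measurable lebesgue" for t
  proof -
    have [measurable]: "(\<lambda>x. if x \<in> \<Omega> then f x t else 0) \<in> borel_measurable lebesgue"
      using f by (simp add: caratheodory_def borel_measurable_if)
    have "(\<lambda>x. if x \<in> A then (if x \<in> \<Omega> then f x t else 0) else 0) \<in> borel_measurable lebesgue" by measurable
    moreover have "F x t = (if x \<in> A then (if x \<in> \<Omega> then f x t else 0) else 0)" for x by (auto simp: F_def A_def)
    ultimately show ?thesis by simp
  qed
  have Fc: "continuous_on UNIV (F x)" for x
  proof (cases "x \<in> A")
    case True
    then have "F x = f x" by (simp add: F_def fun_eq_iff)
    then show ?thesis using True by (simp add: A_def)
  next
    case False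
    then have "F x = (\<lambda>t. 0)" by (simp add: F_def fun_eq_iff)
    then show ?thesis by simp
  qed
  define T where "T x t = max (lo x) (min t (up x))" for x t
  define g where "g x t = F x (T x t)" for x t
  have gm: "(\<lambda>z. g (fst z) (snd z)) \<in> borel_measurable (lebesgue \<Otimes>\<^sub>M borel)"
  proof -
    have "(\<lambda>z. (fst z, T (fst z) (snd z))) \<in> (lebesgue \<Otimes>\<^sub>M borel) \<rightarrow>\<^sub>M (lebesgue \<Otimes>\<^sub>M borel)"
      unfolding T_def by measurable
    from measurable_compose[OF this measurable_caratheodory_pair[OF Fm Fc]] show ?thesis by (simp add: g_def)
  qed
  have gc: "continuous_on UNIV (g x)" for x
    unfolding g_def[abs_def] T_def by (rule continuous_on_compose2[OF Fc]) (auto intro!: continuous_intros)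
  \<comment> \<open>\<open>h\<close> is scaled so that \<open>h powr (q - 1)\<close> is the growth bound \<open>2 * c0 * b powr (q - 1)\<close>.\<close>
  define b where "b x = 1 + \<bar>lo x\<bar> + \<bar>up x\<bar>" for x
  define \<kappa> where "\<kappa> = (2 * c0) powr (1 / (q - 1))"
  define h where "h x = (if x \<in> A then \<kappa> * b x else 0)" for x
  have [measurable]: "b \<in> borel_measurable lebesgue" unfolding b_def[abs_def] by measurable
  have b: "b x \<ge> 1" for x by (simp add: b_def)
  have \<kappa>: "\<kappa> > 0" using c0 by (simp add: \<kappa>_def)
  have \<kappa>q: "\<kappa> powr (q - 1) = 2 * c0" using c0 q1 by (simp add: \<kappa>_def powr_powr)
  have hm: "h \<in> borel_measurable lebesgue" unfolding h_def[abs_def] by measurable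
  have h0: "h x \<ge> 0" for x using \<kappa> b[of x] by (simp add: h_def)
  have gh: "\<bar>g x t\<bar> \<le> h x powr (q - 1)" for x t
  proof (cases "x \<in> A")
    case True
    then have "lo x \<le> up x" by (simp add: A_def)
    then have "\<bar>T x t\<bar> \<le> b x" by (auto simp: T_def b_def max_def min_def abs_if)
    then have "\<bar>T x t\<bar> powr (q - 1) \<le> b x powr (q - 1)" using q1 by (intro powr_mono2) auto
    moreover have "1 \<le> b x powr (q - 1)" using b[of x] q1 by (intro ge_one_powr_ge_zero) auto
    ultimately have "c0 * (1 + \<bar>T x t\<bar> powr (q - 1)) \<le> c0 * (2 * b x powr (q - 1))" using c0 by (intro mult_left_mono) auto
    also have "\<dots> = h x powr (q - 1)" using True \<kappa> b[of x] by (simp add: h_def powr_mult \<kappa>q)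
    finally have "c0 * (1 + \<bar>T x t\<bar> powr (q - 1)) \<le> h x powr (q - 1)" .
    moreover have "\<bar>f x (T x t)\<bar> \<le> c0 * (1 + \<bar>T x t\<bar> powr (q - 1))" using True by (simp add: A_def)
    ultimately show ?thesis using True by (simp add: g_def F_def)
  qed (simp add: g_def F_def)
  let ?H = "\<lambda>x. \<kappa> powr q * (2 powr q * (2 powr q * (indicator \<Omega> x + \<bar>lo x\<bar> powr q * indicator \<Omega> x) + \<bar>up x\<bar> powr q * indicator \<Omega> x))"
  have hi: "integrable lebesgue (\<lambda>x. h x powr q)"
  proof (rule Bochner_Integration.integrable_bound)
    have "integrable lebesgue (\<lambda>x. indicator \<Omega> x :: real)" using em by (simp add: integrable_indicator_iff)
    moreover have "integrable lebesgue (\<lambda>x. \<bar>lo x\<bar> powr q * indicator \<Omega> x)"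
      by (rule integrableI_bounded) (use loq in \<open>auto simp: ennreal_mult' ennreal_indicator\<close>)
    moreover have "integrable lebesgue (\<lambda>x. \<bar>up x\<bar> powr q * indicator \<Omega> x)"
      by (rule integrableI_bounded) (use upq in \<open>auto simp: ennreal_mult' ennreal_indicator\<close>)
    ultimately show "integrable lebesgue (\<lambda>x. ?H x)"
      by auto
    show "(\<lambda>x. h x powr q) \<in> borel_measurable lebesgue" using hm by measurable
    show "AE x in lebesgue. norm (h x powr q) \<le>
        norm (?H x)"
    proof (rule AE_I2)
      fix x
      show "norm (h x powr q) \<le>
        norm (?H x)"
      proof (cases "x \<in> A")
        case True
        then have x: "x \<in> \<Omega>" by (simp add: A_def)
        have "b x powr q \<le> 2 powr q * ((1 + \<bar>lo x\<bar>) powr q + \<bar>up x\<bar> powr q)"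
          unfolding b_def using q1 by (intro powr_add_le) auto
        also have "\<dots> \<le> 2 powr q * (2 powr q * (1 powr q + \<bar>lo x\<bar> powr q) + \<bar>up x\<bar> powr q)"
          using q1 by (intro mult_left_mono add_right_mono powr_add_le) auto
        finally have "\<kappa> powr q * b x powr q \<le> \<kappa> powr q * (2 powr q * (2 powr q * (1 + \<bar>lo x\<bar> powr q) + \<bar>up x\<bar> powr q))"
          by (intro mult_left_mono) auto
        moreover have "h x powr q = \<kappa> powr q * b x powr q" using True \<kappa> b[of x] by (simp add: h_def powr_mult)
        ultimately have "h x powr q \<le> ?H x"
          using x by simp
        then show ?thesis unfolding real_norm_def by (rule order_trans[OF _ abs_ge_self, OF order_trans[rotated]]) simp
      qed (simp add: h_def)
    qed
  qed
  have "\<exists>u\<in>frac_sobolev_0 s p \<Omega>. \<forall>v\<in>frac_sobolev_0 s p \<Omega>. integrable lebesgue (\<lambda>x. g x (u x) * v x) \<and>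
      frac_p_laplacian s p u v = (\<integral>x. g x (u x) * v x \<partial>lebesgue)"
    by (rule exists_weak_solution_dominated[OF \<Omega> p N q1(3) q(2) gm gc hm h0 gh hi]) blast
  then obtain u where u: "u \<in> frac_sobolev_0 s p \<Omega>"
    and uv: "\<forall>v\<in>frac_sobolev_0 s p \<Omega>. integrable lebesgue (\<lambda>x. g x (u x) * v x) \<and>
      frac_p_laplacian s p u v = (\<integral>x. g x (u x) * v x \<partial>lebesgue)" ..
  have gi: "integrable lebesgue (\<lambda>x. g x (u x) * v x)"
    and eq: "frac_p_laplacian s p u v = (\<integral>x. g x (u x) * v x \<partial>lebesgue)" if "v \<in> frac_sobolev_0 s p \<Omega>" for v
    using uv that by auto
  have [measurable]: "u \<in> borel_measurable lebesgue" using u by (rule measurable_frac_sobolev_0)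
  have u0: "AE x in lebesgue. x \<notin> \<Omega> \<longrightarrow> u x = 0" using u by (simp add: frac_sobolev_0_def)
  have eq': "frac_p_laplacian s p u v = (LINT x:\<Omega>|lebesgue. k x * v x)"
    if v: "v \<in> frac_sobolev_0 s p \<Omega>" and k: "AE x in lebesgue. x \<in> A \<longrightarrow> v x \<noteq> 0 \<longrightarrow> f x (T x (u x)) = k x" for v k
  proof -
    have v0: "AE x in lebesgue. x \<notin> \<Omega> \<longrightarrow> v x = 0" using v by (simp add: frac_sobolev_0_def)
    have ae: "AE x in lebesgue. g x (u x) * v x = indicator \<Omega> x *\<^sub>R (k x * v x)"
      using k v0 A\<Omega>
    proof eventually_elim
      case (elim x)
      then show ?case by (cases "x \<in> A"; cases "v x = 0") (auto simp: g_def F_def)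
    qed
    have m: "(\<lambda>x. g x (u x) * v x) \<in> borel_measurable lebesgue" using gi[OF v] by simp
    have "(\<integral>x. g x (u x) * v x \<partial>lebesgue) = (\<integral>x. indicator \<Omega> x *\<^sub>R (k x * v x) \<partial>lebesgue)"
      by (rule integral_cong_AE[OF m borel_measurable_AE[OF m ae] ae])
    then show ?thesis by (simp add: eq[OF v] set_lebesgue_integral_def)
  qed
  have u_up: "AE x in lebesgue. u x \<le> up x"
  proof -
    let ?v = "\<lambda>x. max 0 (u x - up x)"
    have "AE x in lebesgue. x \<notin> \<Omega> \<longrightarrow> u x \<le> up x" using u0 up(2) by eventually_elim auto
    then have v: "?v \<in> frac_sobolev_0 s p \<Omega>"
      by (intro frac_sobolev_0_pos_part_diff[OF \<Omega> U(1,2) p1(3) p(2)] frac_sobolev_0_restrict[OF u] U) (use U in auto)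
    have "frac_p_laplacian s p u ?v = (LINT x:\<Omega>|lebesgue. f x (up x) * ?v x)"
    proof (rule eq'[OF v], rule AE_I2, intro impI)
      fix x assume "x \<in> A" "?v x \<noteq> 0"
      then have "T x (u x) = up x" by (auto simp: T_def A_def max_def min_def split: if_splits)
      then show "f x (T x (u x)) = f x (up x)" by simp
    qed
    also have "\<dots> \<le> frac_p_laplacian s p up ?v" by (rule up(3)) (use v in \<open>simp add: frac_sobolev_0_nonneg_def\<close>)
    finally show ?thesis
      by (intro fractional_comparison[OF \<Omega>(2) p1(2,4) v] integrable_pairing_frac_sobolev_0[OF p1(1) u v]
          integrable_pairing_frac_sobolev_tilde[OF \<Omega> p1(1) p(2) up(1) v])
  qed
  have lo_u: "AE x in lebesgue. lo x \<le> u x"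
  proof -
    let ?v = "\<lambda>x. max 0 (lo x - u x)"
    have "AE x in lebesgue. x \<notin> \<Omega> \<longrightarrow> lo x \<le> u x" using u0 lo(2) by eventually_elim auto
    then have v: "?v \<in> frac_sobolev_0 s p \<Omega>"
      by (intro frac_sobolev_0_pos_part_diff[OF \<Omega> V(1,2) p1(3) p(2)] frac_sobolev_0_restrict[OF u] V) (use V in auto)
    have "frac_p_laplacian s p lo ?v \<le> (LINT x:\<Omega>|lebesgue. f x (lo x) * ?v x)"
      by (rule lo(3)) (use v in \<open>simp add: frac_sobolev_0_nonneg_def\<close>)
    also have "\<dots> = frac_p_laplacian s p u ?v"
    proof (rule eq'[OF v, symmetric], rule AE_I2, intro impI)
      fix x assume "x \<in> A" "?v x \<noteq> 0"
      then have "T x (u x) = lo x" by (auto simp: T_def A_def max_def min_def split: if_splits)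
      then show "f x (T x (u x)) = f x (lo x)" by simp
    qed
    finally show ?thesis
      by (intro fractional_comparison[OF \<Omega>(2) p1(2,4) v] integrable_pairing_frac_sobolev_0[OF p1(1) u v]
          integrable_pairing_frac_sobolev_tilde[OF \<Omega> p1(1) p(2) lo(1) v])
  qed
  have "frac_p_laplacian s p u v = (LINT x:\<Omega>|lebesgue. f x (u x) * v x)" if v: "v \<in> frac_sobolev_0 s p \<Omega>" for v
  proof (rule eq'[OF v])
    show "AE x in lebesgue. x \<in> A \<longrightarrow> v x \<noteq> 0 \<longrightarrow> f x (T x (u x)) = f x (u x)"
      using u_up lo_u by eventually_elim (simp add: T_def)
  qed
  then have "solution s p \<Omega> f u" using u by (simp add: solution_def)
  moreover have "AE x in lebesgue. lo x \<le> u x \<and> u x \<le> up x" using lo_u u_up by eventually_elim simp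
  ultimately show ?thesis unfolding solution_set_def by blast
qed

theorem lemma3p2:
  fixes \<Omega> :: "(real ^ 'n) set"
    and f :: "real ^ 'n \<Rightarrow> real \<Rightarrow> real"
    and sub_u super_u :: "real ^ 'n \<Rightarrow> real"
    and s p q c0 :: real
  assumes "CARD('n) > 1"
    and "p \<ge> 2"
    and "0 < s" and "s < 1"
    and "real CARD('n) > p * s"
    and "bounded_C11_domain \<Omega>"
    and "caratheodory \<Omega> f"
    and "c0 > 0"
    and "p < q" and "q < sobolev_exponent TYPE('n) s p"
    and "AE x in lebesgue. x \<in> \<Omega> \<longrightarrow> (\<forall>t. \<bar>f x t\<bar> \<le> c0 * (1 + \<bar>t\<bar> powr (q - 1)))"
    and "sub_u \<in> frac_sobolev_tilde s p \<Omega>" and "super_u \<in> frac_sobolev_tilde s p \<Omega>"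
    and "sub_supersolution_pair s p \<Omega> f sub_u super_u"
  shows "\<exists>u. u \<in> solution_set s p \<Omega> f sub_u super_u"
proof (rule exists_solution_between)
  show "open \<Omega>" "bounded \<Omega>" using assms(6) by (simp_all add: bounded_C11_domain_def)
  show "q < real CARD('n) * p / (real CARD('n) - p * s)" using assms(10) by (simp add: sobolev_exponent_def)
qed (use assms in auto)

end
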